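(* There exist absolute constants $C, c, \varepsilon_0 > 0$ such that the following holds. Let $\varepsilon \in (0, \varepsilon_0]$ and let $x_1, \dots, x_n$ be i.i.d. samples from a centered elliptical distribution on $\mathbb{R}^p$ with shape matrix $\Sigma$, where $n \geq C p^2 / \varepsilon^2$. Then with probability at least $1 - \exp(-c\, n \varepsilon^2 / p^2)$, Tyler's M-estimator $\widehat{\Sigma}$ of $x_1,\dots,x_n$ exists and satisfies $$\|I_p - \Sigma^{1/2} \widehat{\Sigma}^{-1} \Sigma^{1/2}\|_{F} \leq \varepsilon.$$
   Context: A centered elliptical distribution on $\mathbb{R}^p$ with shape matrix $\Sigma$ is the law of $X = u\, \Sigma^{1/2} V$, where $\Sigma$ is a fixed $p \times p$ positive-definite matrix normalized so that $\operatorname{tr}\Sigma = p$, $V$ is uniformly distributed on the unit sphere $\mathbb{S}^{p-1}$, and $u$ is a real random scalar independent of $V$ with $u \neq 0$ almost surely. Given $x_1, \dots, x_n \in \mathbb{R}^p$, Tyler's M-estimator $\widehat{\Sigma}$ is the unique positive-definite $p\times p$ matrix satisfying $$\frac{p}{n}\sum_{i=1}^n \frac{x_i x_i^\top}{x_i^\top \widehat{\Sigma}^{-1} x_i} = \widehat{\Sigma}, \qquad \operatorname{tr}\widehat{\Sigma} = p,$$ when such a solution exists and is unique. $\|\cdot\|_F$ is the Frobenius norm. *)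

theory Defs
  imports
    "HOL-Probability.Probability"
    "Jordan_Normal_Form.Matrix"
    "Jordan_Normal_Form.Gauss_Jordan_Elimination"
begin

text \<open>
  The constants of the theorem are uniform in the dimension, which therefore has to be quantified
  inside the formula; vectors and matrices are those of Jordan Normal Form, whose dimensions are
  natural numbers. HOL-Analysis also declares a type and a function called \<open>vec\<close>, hence
  the qualified names.
\<close>

no_notation inner (infix \<open>\<bullet>\<close> 70)
no_notation vec_nth (infixl \<open>$\<close> 90)

type_synonym rvec = "real Matrix.vec"
type_synonym rmat = "real Matrix.mat"

definition mat_trace :: "rmat \<Rightarrow> real" where
  "mat_trace A = (\<Sum>i<dim_row A. A $$ (i, i))"

definition frobenius_norm :: "rmat \<Rightarrow> real" where
  "frobenius_norm A = sqrt (\<Sum>i<dim_row A. \<Sum>j<dim_col A. (A $$ (i, j))\<^sup>2)"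

definition pos_def :: "nat \<Rightarrow> rmat \<Rightarrow> bool" where
  "pos_def p A \<longleftrightarrow> A \<in> carrier_mat p p \<and> transpose_mat A = A \<and>
     (\<forall>v \<in> carrier_vec p. v \<noteq> 0\<^sub>v p \<longrightarrow> v \<bullet> (A *\<^sub>v v) > 0)"

definition mat_inv :: "rmat \<Rightarrow> rmat" where
  "mat_inv A = the (mat_inverse A)"

definition mat_sqrt :: "rmat \<Rightarrow> rmat" where
  "mat_sqrt A = (THE R. pos_def (dim_row A) R \<and> R * R = A)"

definition euclid_norm :: "rvec \<Rightarrow> real" where
  "euclid_norm v = sqrt (v \<bullet> v)"

text \<open>The Borel sigma-algebra of \<open>p\<close>-dimensional space, generated by the coordinates.\<close>

definition vec_borel :: "nat \<Rightarrow> rvec measure" where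
  "vec_borel p = vimage_algebra (carrier_vec p) (\<lambda>v. \<lambda>i\<in>{..<p}. v $ i) (\<Pi>\<^sub>M i\<in>{..<p}. borel)"

definition vec_lborel :: "nat \<Rightarrow> rvec measure" where
  "vec_lborel p = distr (\<Pi>\<^sub>M i\<in>{..<p}. lborel) (vec_borel p) (Matrix.vec p)"

text \<open>
  Normalized surface measure of the unit sphere, by the usual cone construction: the measure of
  a set \<open>A\<close> of unit vectors is the proportion of the volume of the unit ball taken up by the
  cone \<open>{r v | 0 < r \<le> 1, v \<in> A}\<close>. For \<open>p = 1\<close> this is the uniform distribution
  on the two points \<open>1\<close> and \<open>-1\<close>.
\<close>

definition sphere_uniform :: "nat \<Rightarrow> rvec measure" where
  "sphere_uniform p =
     distr (uniform_measure (vec_lborel p) {v \<in> carrier_vec p. euclid_norm v \<le> 1})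
       (vec_borel p) (\<lambda>v. (1 / euclid_norm v) \<cdot>\<^sub>v v)"

text \<open>
  In the following definition, \<open>\<mu>\<close> is the law of the scalar \<open>u\<close>; as \<open>u\<close> and \<open>V\<close> are
  independent, the law of the pair is a product measure.
\<close>

definition elliptical :: "nat \<Rightarrow> rmat \<Rightarrow> rvec measure \<Rightarrow> bool" where
  "elliptical p \<Sigma> D \<longleftrightarrow> pos_def p \<Sigma> \<and> mat_trace \<Sigma> = real p \<and>
     (\<exists>\<mu> :: real measure. prob_space \<mu> \<and> sets \<mu> = sets borel \<and> (AE u in \<mu>. u \<noteq> 0) \<and>
        D = distr (\<mu> \<Otimes>\<^sub>M sphere_uniform p) (vec_borel p)
              (\<lambda>(u, v). u \<cdot>\<^sub>v (mat_sqrt \<Sigma> *\<^sub>v v)))"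

text \<open>
  Since \<open>z / 0 = 0\<close>, a zero sample contributes a zero summand to the equation below. This admits
  no spurious solutions: multiplying the equation by the inverse of \<open>S\<close> and taking traces shows
  that it is solvable only if all samples are nonzero.
\<close>

definition tyler_solution :: "nat \<Rightarrow> nat \<Rightarrow> (nat \<Rightarrow> rvec) \<Rightarrow> rmat \<Rightarrow> bool" where
  "tyler_solution p n x S \<longleftrightarrow> pos_def p S \<and>
     Matrix.mat p p (\<lambda>(a, b). real p / real n *
       (\<Sum>i<n. (x i $ a * x i $ b) / (x i \<bullet> (mat_inv S *\<^sub>v x i)))) = S \<and>
     mat_trace S = real p"

definition tyler_exists :: "nat \<Rightarrow> nat \<Rightarrow> (nat \<Rightarrow> rvec) \<Rightarrow> bool" where
  "tyler_exists p n x \<longleftrightarrow> (\<exists>!S. tyler_solution p n x S)"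

definition tyler :: "nat \<Rightarrow> nat \<Rightarrow> (nat \<Rightarrow> rvec) \<Rightarrow> rmat" where
  "tyler p n x = (THE S. tyler_solution p n x S)"

end

theory Submission
  imports Defs "Jordan_Normal_Form.Determinant" "HOL-Real_Asymp.Real_Asymp"
begin

text \<open>
  Whitening and normalizing the samples reduces the claim to unit vectors \<open>v\<^sub>1, \<dots>, v\<^sub>n\<close> uniformly
  distributed on the sphere, with \<open>T(S) = (p/n) \<Sum> v\<^sub>i v\<^sub>i\<^sup>T / (v\<^sub>i\<^sup>T S\<^sup>-\<^sup>1 v\<^sub>i)\<close>. Two properties of the sample are
  used: \<open>M = (p/n) \<Sum> v\<^sub>i v\<^sub>i\<^sup>T\<close> is within \<open>t\<close> of the identity in operator norm, with \<open>t\<close> of the order of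
  \<open>\<epsilon> / sqrt p\<close>, and \<open>(p/n) \<Sum> \<langle>v\<^sub>i, e\<rangle>\<^sup>2 \<langle>v\<^sub>i, f\<rangle>\<^sup>2 \<ge> c / p\<close> for all unit vectors \<open>e\<close>, \<open>f\<close>.

  The derivative of \<open>T\<close> at the identity is the positive map \<open>E \<mapsto> (p/n) \<Sum> (v\<^sub>i\<^sup>T E v\<^sub>i) v\<^sub>i v\<^sub>i\<^sup>T\<close>. If \<open>E \<le> \<eta> I\<close> has
  trace zero, the second property applied to \<open>\<eta> I - E \<ge> 0\<close>, which has trace \<open>\<eta> p\<close>, shows that the image of
  \<open>E\<close> is at most \<open>(1 + t - c) \<eta> I\<close>. So a recentred version of \<open>T\<close> contracts a small operator norm ball
  around the identity, and its fixed point is within \<open>O(t)\<close> of the identity; this also absorbs the change of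
  the trace normalization when going back to the samples, and the Frobenius norm costs a factor \<open>sqrt p\<close>.
  The second property also says that no two hyperplanes cover the sample, which makes the solution unique.

  For the probability, the direction of a Gaussian vector and Jensen's inequality give
  \<open>E exp (l p \<langle>e, v\<rangle>\<^sup>2) \<le> (1 - 2 l) powr (- 1/2)\<close> for all \<open>l < 1/2\<close>. Positive and negative small \<open>l\<close> yield the
  first property on a net with \<open>exp (O(p))\<close> points; very negative \<open>l\<close> shows that for each direction less than a
  third of the samples is nearly orthogonal to it, uniformly over a net with \<open>exp (O(p\<^sup>2))\<close> points, which
  gives the second property by pigeonhole.
\<close>

section \<open>Symmetric matrices and their quadratic forms\<close>

declare minus_carrier_mat [simp]

lemma smult_mat_mult_vec:
  fixes A :: rmat
  assumes "A \<in> carrier_mat n m" "v \<in> carrier_vec m"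
  shows "(k \<cdot>\<^sub>m A) *\<^sub>v v = k \<cdot>\<^sub>v (A *\<^sub>v v)"
  using assms by (intro eq_vecI) auto

lemma mult_mat_zero_vec: "A \<in> carrier_mat n m \<Longrightarrow> (A :: rmat) *\<^sub>v 0\<^sub>v m = 0\<^sub>v n"
  by (intro eq_vecI) auto

lemma mult_mat3_vec:
  fixes A B C :: rmat
  assumes "A \<in> carrier_mat p p" "B \<in> carrier_mat p p" "C \<in> carrier_mat p p" "x \<in> carrier_vec p"
  shows "(A * B * C) *\<^sub>v x = A *\<^sub>v (B *\<^sub>v (C *\<^sub>v x))"
  using assms assoc_mult_mat_vec[of "A * B" p p C p x] by simp

lemma mat_eq_vecI:
  fixes A B :: rmat
  assumes A: "A \<in> carrier_mat p p" and B: "B \<in> carrier_mat p p"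
    and eq: "\<And>x. x \<in> carrier_vec p \<Longrightarrow> A *\<^sub>v x = B *\<^sub>v x"
  shows "A = B"
proof (rule eq_matI)
  fix i j assume ij: "i < dim_row B" "j < dim_col B"
  have "(A *\<^sub>v unit_vec p j) $ i = (B *\<^sub>v unit_vec p j) $ i"
    by (simp add: eq)
  then show "A $$ (i, j) = B $$ (i, j)"
    using A B ij by simp
qed (use A B in auto)

lemma mat_minus_eq_0D:
  fixes A B :: rmat
  assumes A: "A \<in> carrier_mat n m" and B: "B \<in> carrier_mat n m" and diff: "A - B = 0\<^sub>m n m"
  shows "A = B"
proof (rule eq_matI)
  fix i j assume ij: "i < dim_row B" "j < dim_col B"
  then have "(A - B) $$ (i, j) = 0" using B by (simp add: diff)
  then show "A $$ (i, j) = B $$ (i, j)" using ij by simp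
qed (use A B in auto)

definition symmetric :: "nat \<Rightarrow> rmat \<Rightarrow> bool" where
  "symmetric p A \<longleftrightarrow> A \<in> carrier_mat p p \<and> transpose_mat A = A"

lemma symmetric_carrier [dest]: "symmetric p A \<Longrightarrow> A \<in> carrier_mat p p"
  by (simp add: symmetric_def)

lemma symmetric_index: "symmetric p A \<Longrightarrow> i < p \<Longrightarrow> j < p \<Longrightarrow> A $$ (i, j) = A $$ (j, i)"
  unfolding symmetric_def by (metis carrier_matD index_transpose_mat(1))

lemma symmetricI:
  "A \<in> carrier_mat p p \<Longrightarrow> (\<And>i j. i < p \<Longrightarrow> j < p \<Longrightarrow> A $$ (i, j) = A $$ (j, i)) \<Longrightarrow> symmetric p A"
  unfolding symmetric_def by (auto intro!: eq_matI)

lemma symmetric_one: "symmetric p (1\<^sub>m p)"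
  by (simp add: symmetric_def)

lemma symmetric_zero: "symmetric p (0\<^sub>m p p)"
  by (rule symmetricI) auto

lemma symmetric_add:
  assumes A: "symmetric p A" and B: "symmetric p B"
  shows "symmetric p (A + B)"
  using transpose_add[OF symmetric_carrier[OF A] symmetric_carrier[OF B]] A B
  by (simp add: symmetric_def)

lemma symmetric_smult: "symmetric p A \<Longrightarrow> symmetric p (c \<cdot>\<^sub>m A)"
  by (rule symmetricI) (auto simp: symmetric_index carrier_matD[OF symmetric_carrier])

lemma symmetric_minus:
  assumes A: "symmetric p A" and B: "symmetric p B"
  shows "symmetric p (A - B)"
  using transpose_minus[OF symmetric_carrier[OF A] symmetric_carrier[OF B]] A B
  by (simp add: symmetric_def)

lemma symmetric_square:
  assumes "symmetric p A"
  shows "symmetric p (A * A)"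
  using assms transpose_mult[of A p p A p] by (auto simp: symmetric_def)

lemma form_entries:
  assumes "A \<in> carrier_mat p p" "x \<in> carrier_vec p" "y \<in> carrier_vec p"
  shows "x \<bullet> (A *\<^sub>v y) = (\<Sum>i<p. \<Sum>j<p. x $ i * A $$ (i, j) * y $ j)"
  using assms by (auto simp: scalar_prod_def atLeast0LessThan sum_distrib_left mult_ac intro!: sum.cong)

lemma form_symmetric:
  assumes "symmetric p A" "x \<in> carrier_vec p" "y \<in> carrier_vec p"
  shows "x \<bullet> (A *\<^sub>v y) = (A *\<^sub>v x) \<bullet> y"
  using assms transpose_vec_mult_scalar[of A p p y x] by (auto simp: symmetric_def)

lemma form_commute:
  assumes "symmetric p A" "x \<in> carrier_vec p" "y \<in> carrier_vec p"
  shows "x \<bullet> (A *\<^sub>v y) = y \<bullet> (A *\<^sub>v x)"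
  using form_symmetric[OF assms] assms by (metis comm_scalar_prod mult_mat_vec_carrier symmetric_carrier)

lemma form_add:
  fixes A B :: rmat
  assumes "A \<in> carrier_mat p p" "B \<in> carrier_mat p p" "x \<in> carrier_vec p" "y \<in> carrier_vec p"
  shows "x \<bullet> ((A + B) *\<^sub>v y) = x \<bullet> (A *\<^sub>v y) + x \<bullet> (B *\<^sub>v y)"
  using assms by (simp add: add_mult_distrib_mat_vec[where nr = p and nc = p] scalar_prod_add_distrib[where n = p])

lemma form_minus:
  fixes A B :: rmat
  assumes "A \<in> carrier_mat p p" "B \<in> carrier_mat p p" "x \<in> carrier_vec p" "y \<in> carrier_vec p"
  shows "x \<bullet> ((A - B) *\<^sub>v y) = x \<bullet> (A *\<^sub>v y) - x \<bullet> (B *\<^sub>v y)"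
  using assms by (simp add: minus_mult_distrib_mat_vec[where nr = p and nc = p] scalar_prod_minus_distrib[where n = p])

lemma form_smult:
  fixes A :: rmat
  assumes "A \<in> carrier_mat p p" "x \<in> carrier_vec p" "y \<in> carrier_vec p"
  shows "x \<bullet> ((c \<cdot>\<^sub>m A) *\<^sub>v y) = c * (x \<bullet> (A *\<^sub>v y))"
  using assms by (simp add: smult_mat_mult_vec[where n = p and m = p])

lemma form_zero: "x \<in> carrier_vec p \<Longrightarrow> y \<in> carrier_vec p \<Longrightarrow> x \<bullet> (0\<^sub>m p p *\<^sub>v y) = (0 :: real)"
  by (subst form_entries[where p = p]) auto

lemma form_square:
  assumes A: "symmetric p A" and x: "x \<in> carrier_vec p"
  shows "x \<bullet> ((A * A) *\<^sub>v x) = (A *\<^sub>v x) \<bullet> (A *\<^sub>v x)"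
proof -
  have "A \<in> carrier_mat p p" "A *\<^sub>v x \<in> carrier_vec p"
    using A x by auto
  then show ?thesis
    using form_symmetric[OF A x, of "A *\<^sub>v x"] assoc_mult_mat_vec[of A p p A p x] x by simp
qed

lemma form_add_smult_vec:
  assumes A: "symmetric p A" and x: "x \<in> carrier_vec p" and y: "y \<in> carrier_vec p"
  shows "(x + s \<cdot>\<^sub>v y) \<bullet> (A *\<^sub>v (x + s \<cdot>\<^sub>v y)) =
    x \<bullet> (A *\<^sub>v x) + 2 * s * (x \<bullet> (A *\<^sub>v y)) + s\<^sup>2 * (y \<bullet> (A *\<^sub>v y))"
proof -
  note A_carrier = symmetric_carrier[OF A]
  have "A *\<^sub>v (x + s \<cdot>\<^sub>v y) = A *\<^sub>v x + s \<cdot>\<^sub>v (A *\<^sub>v y)"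
    using mult_add_distrib_mat_vec[OF A_carrier x, of "s \<cdot>\<^sub>v y"] mult_mat_vec[OF A_carrier y] y by simp
  then show ?thesis
    using x y A_carrier form_commute[OF A x y]
    by (simp add: scalar_prod_add_distrib[where n = p] add_scalar_prod_distrib[where n = p]
        power2_eq_square algebra_simps)
qed

lemma form_unit_vec:
  fixes A :: rmat
  assumes "A \<in> carrier_mat p p" "i < p" "j < p"
  shows "unit_vec p i \<bullet> (A *\<^sub>v unit_vec p j) = A $$ (i, j)"
  using assms by simp

lemma scalar_prod_sum: "y \<in> carrier_vec p \<Longrightarrow> (x :: rvec) \<bullet> y = (\<Sum>i<p. x $ i * y $ i)"
  by (auto simp: scalar_prod_def atLeast0LessThan)

lemma scalar_prod_self_sum: "x \<in> carrier_vec p \<Longrightarrow> (x :: rvec) \<bullet> x = (\<Sum>i<p. (x $ i)\<^sup>2)"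
  by (simp add: scalar_prod_sum power2_eq_square)

lemma scalar_prod_self_nonneg: "0 \<le> (x :: rvec) \<bullet> x"
  by (auto simp: scalar_prod_def intro: sum_nonneg)

lemma scalar_prod_self_pos:
  assumes "x \<in> carrier_vec p" "x \<noteq> 0\<^sub>v p"
  shows "0 < (x :: rvec) \<bullet> x"
proof -
  obtain i where i: "i < p" "x $ i \<noteq> 0" using assms by (auto simp: vec_eq_iff)
  then have "0 < (x $ i)\<^sup>2" by simp
  also have "\<dots> \<le> (\<Sum>i<p. (x $ i)\<^sup>2)" using i by (intro member_le_sum) auto
  finally show ?thesis using assms by (simp add: scalar_prod_self_sum)
qed

lemma scalar_prod_self_eq_0D: "x \<in> carrier_vec p \<Longrightarrow> (x :: rvec) \<bullet> x = 0 \<Longrightarrow> x = 0\<^sub>v p"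
  using scalar_prod_self_pos[of x p] by (cases "x = 0\<^sub>v p") auto

definition psd :: "nat \<Rightarrow> rmat \<Rightarrow> bool" where
  "psd p A \<longleftrightarrow> symmetric p A \<and> (\<forall>x \<in> carrier_vec p. 0 \<le> x \<bullet> (A *\<^sub>v x))"

definition loewner_le :: "nat \<Rightarrow> rmat \<Rightarrow> rmat \<Rightarrow> bool" where
  "loewner_le p A B \<longleftrightarrow> (\<forall>x \<in> carrier_vec p. x \<bullet> (A *\<^sub>v x) \<le> x \<bullet> (B *\<^sub>v x))"

lemma loewner_leD: "loewner_le p A B \<Longrightarrow> x \<in> carrier_vec p \<Longrightarrow> x \<bullet> (A *\<^sub>v x) \<le> x \<bullet> (B *\<^sub>v x)"
  by (simp add: loewner_le_def)

lemma psd_nonneg: "psd p A \<Longrightarrow> x \<in> carrier_vec p \<Longrightarrow> 0 \<le> x \<bullet> (A *\<^sub>v x)"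
  by (simp add: psd_def)

lemma psd_symmetric: "psd p A \<Longrightarrow> symmetric p A"
  by (simp add: psd_def)

lemma psd_minus_if_loewner_le:
  assumes "symmetric p A" "symmetric p B" "loewner_le p A B"
  shows "psd p (B - A)"
  using assms
  by (auto simp: psd_def loewner_le_def form_minus[OF symmetric_carrier symmetric_carrier] intro: symmetric_minus)

lemma pos_def_symmetric [dest]: "pos_def p A \<Longrightarrow> symmetric p A"
  by (simp add: pos_def_def symmetric_def)

lemma pos_def_carrier: "pos_def p A \<Longrightarrow> A \<in> carrier_mat p p"
  by (simp add: pos_def_def)

lemma pos_def_pos: "pos_def p A \<Longrightarrow> x \<in> carrier_vec p \<Longrightarrow> x \<noteq> 0\<^sub>v p \<Longrightarrow> 0 < x \<bullet> (A *\<^sub>v x)"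
  by (simp add: pos_def_def)

lemma pos_defI:
  assumes "symmetric p A" "\<And>x. x \<in> carrier_vec p \<Longrightarrow> x \<noteq> 0\<^sub>v p \<Longrightarrow> 0 < x \<bullet> (A *\<^sub>v x)"
  shows "pos_def p A"
  using assms by (auto simp: pos_def_def symmetric_def)

lemma pos_def_psd:
  assumes "pos_def p A"
  shows "psd p A"
proof -
  have "0 \<le> x \<bullet> (A *\<^sub>v x)" if "x \<in> carrier_vec p" for x
    using pos_def_pos[OF assms that] pos_def_carrier[OF assms]
    by (cases "x = 0\<^sub>v p") (auto intro: less_imp_le)
  with assms show ?thesis by (auto simp: psd_def)
qed

lemma pos_def_one: "pos_def p (1\<^sub>m p)"
  by (simp add: pos_def_def scalar_prod_self_pos)

lemma pos_def_smult: "pos_def p A \<Longrightarrow> 0 < s \<Longrightarrow> pos_def p (s \<cdot>\<^sub>m A)"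
  using symmetric_smult[OF pos_def_symmetric, of p A s]
  by (auto simp: pos_def_def symmetric_def form_smult[where p = p])

lemma quadratic_nonneg_discriminant:
  fixes a b c :: real
  assumes "0 \<le> c" and nonneg: "\<And>s. 0 \<le> a + 2 * s * b + s\<^sup>2 * c"
  shows "b\<^sup>2 \<le> a * c"
proof (cases "c = 0")
  case True
  have "b = 0"
  proof (rule ccontr)
    assume "b \<noteq> 0"
    with nonneg[of "- (a + 1) / (2 * b)"] True show False by (simp add: field_simps)
  qed
  with True show ?thesis by simp
next
  case False
  with \<open>0 \<le> c\<close> nonneg[of "- b / c"] show ?thesis by (simp add: power2_eq_square field_simps)
qed

lemma psd_Cauchy_Schwarz:
  assumes A: "psd p A" and x: "x \<in> carrier_vec p" and y: "y \<in> carrier_vec p"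
  shows "(x \<bullet> (A *\<^sub>v y))\<^sup>2 \<le> (x \<bullet> (A *\<^sub>v x)) * (y \<bullet> (A *\<^sub>v y))"
proof (rule quadratic_nonneg_discriminant)
  show "0 \<le> y \<bullet> (A *\<^sub>v y)" by (rule psd_nonneg[OF A y])
  show "0 \<le> x \<bullet> (A *\<^sub>v x) + 2 * s * (x \<bullet> (A *\<^sub>v y)) + s\<^sup>2 * (y \<bullet> (A *\<^sub>v y))" for s
    using psd_nonneg[OF A, of "x + s \<cdot>\<^sub>v y"] x y form_add_smult_vec[OF psd_symmetric[OF A] x y, of s] by simp
qed

lemma psd_mult_vec_eq_0:
  assumes A: "psd p A" and x: "x \<in> carrier_vec p" and null: "x \<bullet> (A *\<^sub>v x) = 0"
  shows "A *\<^sub>v x = 0\<^sub>v p"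
proof -
  have Ax: "A *\<^sub>v x \<in> carrier_vec p" using A x by (auto simp: psd_def)
  have "((A *\<^sub>v x) \<bullet> (A *\<^sub>v x))\<^sup>2 \<le> 0"
    using psd_Cauchy_Schwarz[OF A Ax x] null by simp
  then show ?thesis using scalar_prod_self_eq_0D[OF Ax] by simp
qed

lemma scalar_prod_Cauchy_Schwarz:
  assumes "x \<in> carrier_vec p" "y \<in> carrier_vec p"
  shows "((x :: rvec) \<bullet> y)\<^sup>2 \<le> (x \<bullet> x) * (y \<bullet> y)"
  using psd_Cauchy_Schwarz[OF pos_def_psd[OF pos_def_one] assms] assms by simp

lemma euclid_norm_square: "(euclid_norm x)\<^sup>2 = x \<bullet> x"
  by (simp add: euclid_norm_def scalar_prod_self_nonneg)

lemma euclid_norm_nonneg [simp]: "0 \<le> euclid_norm x"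
  by (simp add: euclid_norm_def scalar_prod_self_nonneg)

lemma euclid_norm_pos: "x \<in> carrier_vec p \<Longrightarrow> x \<noteq> 0\<^sub>v p \<Longrightarrow> 0 < euclid_norm x"
  by (simp add: euclid_norm_def scalar_prod_self_pos)

lemma abs_scalar_prod_le:
  assumes "x \<in> carrier_vec p" "y \<in> carrier_vec p"
  shows "\<bar>x \<bullet> y\<bar> \<le> euclid_norm x * euclid_norm y"
  using scalar_prod_Cauchy_Schwarz[OF assms] abs_le_square_iff[of "x \<bullet> y" "euclid_norm x * euclid_norm y"]
  by (simp add: power_mult_distrib euclid_norm_square)

lemma euclid_norm_L2_set: "x \<in> carrier_vec p \<Longrightarrow> euclid_norm x = L2_set (\<lambda>i. x $ i) {..<p}"
  by (simp add: euclid_norm_def L2_set_def scalar_prod_self_sum)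

lemma euclid_norm_smult: "euclid_norm (c \<cdot>\<^sub>v x) = \<bar>c\<bar> * euclid_norm x"
proof -
  have "(c \<cdot>\<^sub>v x) \<bullet> (c \<cdot>\<^sub>v x) = c\<^sup>2 * (x \<bullet> x)" by (simp add: power2_eq_square)
  then show ?thesis by (simp add: euclid_norm_def real_sqrt_mult)
qed

lemma euclid_norm_add:
  assumes "x \<in> carrier_vec p" "y \<in> carrier_vec p"
  shows "euclid_norm (x + y) \<le> euclid_norm x + euclid_norm y"
proof -
  have "euclid_norm (x + y) = L2_set (\<lambda>i. x $ i + y $ i) {..<p}"
    using assms by (auto simp: euclid_norm_L2_set[where p = p] intro!: L2_set_cong)
  with L2_set_triangle_ineq[of "\<lambda>i. x $ i" "\<lambda>i. y $ i" "{..<p}"] show ?thesis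
    using assms by (simp add: euclid_norm_L2_set[where p = p])
qed

lemma euclid_norm_le_add_minus:
  assumes "x \<in> carrier_vec p" "y \<in> carrier_vec p"
  shows "euclid_norm x \<le> euclid_norm (x - y) + euclid_norm y"
proof -
  have "x = (x - y) + y" using assms by (intro eq_vecI) auto
  then show ?thesis using euclid_norm_add[of "x - y" p y] assms by simp
qed

definition unit_sphere :: "nat \<Rightarrow> rvec set" where
  "unit_sphere p = {e \<in> carrier_vec p. e \<bullet> e = 1}"

definition normalized :: "rvec \<Rightarrow> rvec" where
  "normalized x = (1 / euclid_norm x) \<cdot>\<^sub>v x"

lemma unit_sphereD:
  assumes "e \<in> unit_sphere p"
  shows "e \<in> carrier_vec p" "e \<bullet> e = 1" "euclid_norm e = 1" "e \<noteq> 0\<^sub>v p"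
  using assms by (auto simp: unit_sphere_def euclid_norm_def)

lemma unit_sphereI: "e \<in> carrier_vec p \<Longrightarrow> euclid_norm e = 1 \<Longrightarrow> e \<in> unit_sphere p"
  using euclid_norm_square[of e] by (simp add: unit_sphere_def)

lemma unit_vec_in_unit_sphere: "i < p \<Longrightarrow> unit_vec p i \<in> unit_sphere p"
  by (simp add: unit_sphere_def)

lemma normalized_carrier [simp]: "x \<in> carrier_vec p \<Longrightarrow> normalized x \<in> carrier_vec p"
  by (simp add: normalized_def)

lemma normalized_in_unit_sphere:
  assumes "x \<in> carrier_vec p" "x \<noteq> 0\<^sub>v p"
  shows "normalized x \<in> unit_sphere p"
  using assms euclid_norm_pos[OF assms] by (intro unit_sphereI) (auto simp: normalized_def euclid_norm_smult)

lemma smult_normalized: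
  assumes "x \<in> carrier_vec p"
  shows "euclid_norm x \<cdot>\<^sub>v normalized x = x"
proof (cases "x = 0\<^sub>v p")
  case True
  then show ?thesis by (intro eq_vecI) (auto simp: normalized_def)
next
  case False
  then show ?thesis using euclid_norm_pos[OF assms] by (intro eq_vecI) (auto simp: normalized_def)
qed

lemma scalar_prod_normalized:
  assumes "v \<in> carrier_vec p" "x \<in> carrier_vec p"
  shows "v \<bullet> x = euclid_norm x * (v \<bullet> normalized x)"
proof -
  have "v \<bullet> x = v \<bullet> (euclid_norm x \<cdot>\<^sub>v normalized x)" by (simp only: smult_normalized[OF assms(2)])
  also have "\<dots> = euclid_norm x * (v \<bullet> normalized x)" using assms by simp
  finally show ?thesis .
qed

section \<open>The operator norm\<close>

text \<open>For symmetric matrices, this says that the operator norm is at most \<open>d\<close>.\<close>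

definition form_bound :: "nat \<Rightarrow> rmat \<Rightarrow> real \<Rightarrow> bool" where
  "form_bound p A d \<longleftrightarrow> (\<forall>x \<in> carrier_vec p. \<bar>x \<bullet> (A *\<^sub>v x)\<bar> \<le> d * (x \<bullet> x))"

lemma form_boundI:
  "(\<And>x. x \<in> carrier_vec p \<Longrightarrow> \<bar>x \<bullet> (A *\<^sub>v x)\<bar> \<le> d * (x \<bullet> x)) \<Longrightarrow> form_bound p A d"
  by (simp add: form_bound_def)

lemma form_boundD: "form_bound p A d \<Longrightarrow> x \<in> carrier_vec p \<Longrightarrow> \<bar>x \<bullet> (A *\<^sub>v x)\<bar> \<le> d * (x \<bullet> x)"
  by (simp add: form_bound_def)

lemma form_bound_mono: "form_bound p A a \<Longrightarrow> a \<le> b \<Longrightarrow> form_bound p A b"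
  unfolding form_bound_def by (auto intro: order_trans[OF _ mult_right_mono] scalar_prod_self_nonneg)

lemma form_bound_self_nonneg: "form_bound p A d \<Longrightarrow> x \<in> carrier_vec p \<Longrightarrow> 0 \<le> d * (x \<bullet> x)"
  using form_boundD abs_ge_zero order_trans by blast

lemma form_bound_norm_nonneg:
  assumes "form_bound p A d" "x \<in> carrier_vec p"
  shows "0 \<le> d * euclid_norm x"
  using form_bound_self_nonneg[OF assms]
  by (simp add: zero_le_mult_iff euclid_norm_def scalar_prod_self_nonneg)

lemma form_bound_if_unit_sphere:
  assumes A: "A \<in> carrier_mat p p" and unit: "\<And>e. e \<in> unit_sphere p \<Longrightarrow> \<bar>e \<bullet> (A *\<^sub>v e)\<bar> \<le> d"
  shows "form_bound p A d"
proof (rule form_boundI)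
  fix x :: rvec assume x: "x \<in> carrier_vec p"
  show "\<bar>x \<bullet> (A *\<^sub>v x)\<bar> \<le> d * (x \<bullet> x)"
  proof (cases "x = 0\<^sub>v p")
    case True
    then show ?thesis using A by simp
  next
    case False
    let ?r = "euclid_norm x" and ?e = "normalized x"
    have "x \<bullet> (A *\<^sub>v x) = (?r \<cdot>\<^sub>v ?e) \<bullet> (A *\<^sub>v (?r \<cdot>\<^sub>v ?e))"
      using smult_normalized[OF x] by simp
    also have "\<dots> = ?r\<^sup>2 * (?e \<bullet> (A *\<^sub>v ?e))"
      using x A by (simp add: mult_mat_vec[OF A] power2_eq_square)
    finally have "\<bar>x \<bullet> (A *\<^sub>v x)\<bar> = ?r\<^sup>2 * \<bar>?e \<bullet> (A *\<^sub>v ?e)\<bar>" by (simp add: abs_mult)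
    also have "\<dots> \<le> ?r\<^sup>2 * d"
      by (intro mult_left_mono unit normalized_in_unit_sphere x False) simp
    finally show ?thesis by (simp add: euclid_norm_square mult.commute)
  qed
qed

lemma form_bound_exists:
  assumes A: "A \<in> carrier_mat p p"
  shows "\<exists>d>0. form_bound p A d"
proof -
  define d where "d = (\<Sum>i<p. \<Sum>j<p. \<bar>A $$ (i, j)\<bar>)"
  have "form_bound p A (d + 1)"
  proof (rule form_bound_if_unit_sphere[OF A])
    fix e assume "e \<in> unit_sphere p"
    note e = unit_sphereD[OF this]
    have "\<bar>e $ i\<bar> \<le> 1" if "i < p" for i
      using abs_scalar_prod_le[of "unit_vec p i" p e] that e by (simp add: euclid_norm_def)
    then have "\<bar>e $ i * A $$ (i, j) * e $ j\<bar> \<le> \<bar>A $$ (i, j)\<bar>" if "i < p" "j < p" for i j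
      using that mult_mono[of "\<bar>e $ i\<bar>" 1 "\<bar>e $ j\<bar>" 1] mult_left_mono[of "\<bar>e $ i\<bar> * \<bar>e $ j\<bar>" 1 "\<bar>A $$ (i, j)\<bar>"]
      by (simp add: abs_mult mult_ac)
    then have "\<bar>e \<bullet> (A *\<^sub>v e)\<bar> \<le> d"
      unfolding form_entries[OF A e(1) e(1)] d_def
      by (intro order_trans[OF sum_abs] sum_mono order_trans[OF sum_abs]) auto
    then show "\<bar>e \<bullet> (A *\<^sub>v e)\<bar> \<le> d + 1" by simp
  qed
  moreover have "0 \<le> d" by (simp add: d_def sum_nonneg)
  ultimately show ?thesis by (intro exI[of _ "d + 1"]) simp
qed

lemma form_bound_bilinear:
  assumes A: "symmetric p A" and d: "form_bound p A d"
    and x: "x \<in> carrier_vec p" and y: "y \<in> carrier_vec p"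
  shows "\<bar>x \<bullet> (A *\<^sub>v y)\<bar> \<le> d * euclid_norm x * euclid_norm y"
proof -
  have bound: "\<bar>x \<bullet> (A *\<^sub>v x) + 2 * s * (x \<bullet> (A *\<^sub>v y)) + s\<^sup>2 * (y \<bullet> (A *\<^sub>v y))\<bar> \<le>
      d * (x \<bullet> x + 2 * s * (x \<bullet> y) + s\<^sup>2 * (y \<bullet> y))" for s
    using form_boundD[OF d, of "x + s \<cdot>\<^sub>v y"] form_add_smult_vec[OF A x y] form_add_smult_vec[OF symmetric_one x y] x y
    by simp
  have polarization: "4 * s * (x \<bullet> (A *\<^sub>v y)) \<le> d * (2 * (x \<bullet> x) + 2 * s\<^sup>2 * (y \<bullet> y))" for s
    using bound[of s] bound[of "- s"] unfolding abs_le_iff by (simp add: algebra_simps)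
  have "(- (x \<bullet> (A *\<^sub>v y)))\<^sup>2 \<le> (d * (x \<bullet> x)) * (d * (y \<bullet> y))"
  proof (rule quadratic_nonneg_discriminant)
    show "0 \<le> d * (y \<bullet> y)" by (rule form_bound_self_nonneg[OF d y])
    show "0 \<le> d * (x \<bullet> x) + 2 * s * (- (x \<bullet> (A *\<^sub>v y))) + s\<^sup>2 * (d * (y \<bullet> y))" for s
      using polarization[of s] by (simp add: algebra_simps)
  qed
  also have "\<dots> = (d * euclid_norm x * euclid_norm y)\<^sup>2"
    by (simp add: power_mult_distrib euclid_norm_square power2_eq_square[of d])
  finally have "\<bar>x \<bullet> (A *\<^sub>v y)\<bar> \<le> \<bar>d * euclid_norm x * euclid_norm y\<bar>"
    by (simp add: abs_le_square_iff)
  also have "\<dots> = d * euclid_norm x * euclid_norm y"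
    using form_bound_norm_nonneg[OF d x] by simp
  finally show ?thesis .
qed

lemma form_bound_norm_mult_vec:
  assumes A: "symmetric p A" and d: "form_bound p A d" and y: "y \<in> carrier_vec p"
  shows "euclid_norm (A *\<^sub>v y) \<le> d * euclid_norm y"
proof -
  have Ay: "A *\<^sub>v y \<in> carrier_vec p" using A y by auto
  have "(euclid_norm (A *\<^sub>v y))\<^sup>2 \<le> d * euclid_norm (A *\<^sub>v y) * euclid_norm y"
    using form_bound_bilinear[OF A d Ay y] by (simp add: euclid_norm_square)
  then have "euclid_norm (A *\<^sub>v y) * euclid_norm (A *\<^sub>v y) \<le> euclid_norm (A *\<^sub>v y) * (d * euclid_norm y)"
    by (simp add: power2_eq_square mult_ac)
  then show ?thesis
    using form_bound_norm_nonneg[OF d y] euclid_norm_nonneg[of "A *\<^sub>v y"]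
    by (cases "euclid_norm (A *\<^sub>v y) = 0") auto
qed

lemma form_bound_entry:
  assumes "symmetric p A" "form_bound p A d" "i < p" "j < p"
  shows "\<bar>A $$ (i, j)\<bar> \<le> d"
  using form_bound_bilinear[OF assms(1,2), of "unit_vec p i" "unit_vec p j"] assms
  by (simp add: form_unit_vec[OF symmetric_carrier] unit_sphereD(3)[OF unit_vec_in_unit_sphere])

lemma form_bound_add:
  assumes "A \<in> carrier_mat p p" "B \<in> carrier_mat p p" and "form_bound p A a" "form_bound p B b"
  shows "form_bound p (A + B) (a + b)"
proof (rule form_boundI)
  fix x :: rvec assume x: "x \<in> carrier_vec p"
  with form_boundD[OF assms(3) x] form_boundD[OF assms(4) x]
  show "\<bar>x \<bullet> ((A + B) *\<^sub>v x)\<bar> \<le> (a + b) * (x \<bullet> x)"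
    using assms(1,2) by (simp add: form_add[where p = p] distrib_right)
qed

lemma form_bound_smult:
  assumes "A \<in> carrier_mat p p" "form_bound p A a"
  shows "form_bound p (c \<cdot>\<^sub>m A) (\<bar>c\<bar> * a)"
  using assms by (auto simp: form_bound_def form_smult[where p = p] abs_mult mult.assoc intro!: mult_left_mono)

lemma form_bound_triangle:
  assumes "A \<in> carrier_mat p p" "B \<in> carrier_mat p p" "C \<in> carrier_mat p p"
    and "form_bound p (A - B) a" "form_bound p (B - C) b"
  shows "form_bound p (A - C) (a + b)"
proof (rule form_boundI)
  fix x :: rvec assume x: "x \<in> carrier_vec p"
  with form_boundD[OF assms(4) x] form_boundD[OF assms(5) x]
  show "\<bar>x \<bullet> ((A - C) *\<^sub>v x)\<bar> \<le> (a + b) * (x \<bullet> x)"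
    using assms(1-3) by (simp add: form_minus[where p = p] distrib_right)
qed

lemma form_bound_minus_commute:
  assumes "A \<in> carrier_mat p p" "B \<in> carrier_mat p p"
  shows "form_bound p (A - B) a \<longleftrightarrow> form_bound p (B - A) a"
  using assms by (simp add: form_bound_def form_minus[where p = p] abs_minus_commute)

lemma form_bound_square:
  assumes A: "symmetric p A" and d: "form_bound p A d"
  shows "form_bound p (A * A) (d\<^sup>2)"
proof (rule form_boundI)
  fix x :: rvec assume x: "x \<in> carrier_vec p"
  have "(A *\<^sub>v x) \<bullet> (A *\<^sub>v x) \<le> (d * euclid_norm x)\<^sup>2"
    unfolding euclid_norm_square[symmetric] by (intro power_mono form_bound_norm_mult_vec[OF A d x]) simp
  then show "\<bar>x \<bullet> ((A * A) *\<^sub>v x)\<bar> \<le> d\<^sup>2 * (x \<bullet> x)"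
    by (simp add: form_square[OF A x] scalar_prod_self_nonneg power_mult_distrib euclid_norm_square)
qed

lemma form_bound_square_diff:
  assumes A: "symmetric p A" "form_bound p A d" and B: "symmetric p B" "form_bound p B d"
    and diff: "form_bound p (A - B) \<eta>"
  shows "form_bound p (A * A - B * B) (2 * d * \<eta>)"
proof (rule form_boundI)
  fix x :: rvec assume x: "x \<in> carrier_vec p"
  let ?n = "euclid_norm x"
  note carrier = symmetric_carrier[OF A(1)] symmetric_carrier[OF B(1)]
  have Ax: "A *\<^sub>v x \<in> carrier_vec p" and Bx: "B *\<^sub>v x \<in> carrier_vec p"
    using carrier x by auto
  have "x \<bullet> ((A * A - B * B) *\<^sub>v x) = (A *\<^sub>v x) \<bullet> (A *\<^sub>v x) - (B *\<^sub>v x) \<bullet> (B *\<^sub>v x)"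
    using carrier x form_square[OF A(1) x] form_square[OF B(1) x] by (simp add: form_minus[where p = p])
  also have "\<dots> = (A *\<^sub>v x - B *\<^sub>v x) \<bullet> (A *\<^sub>v x + B *\<^sub>v x)"
    using Ax Bx comm_scalar_prod[OF Ax Bx]
    by (simp add: minus_scalar_prod_distrib[where n = p] scalar_prod_add_distrib[where n = p])
  also have "\<bar>\<dots>\<bar> \<le> euclid_norm (A *\<^sub>v x - B *\<^sub>v x) * euclid_norm (A *\<^sub>v x + B *\<^sub>v x)"
    by (rule abs_scalar_prod_le[where p = p]) (use Ax Bx in auto)
  also have "\<dots> \<le> (\<eta> * ?n) * (d * ?n + d * ?n)"
  proof (rule mult_mono)
    show "euclid_norm (A *\<^sub>v x - B *\<^sub>v x) \<le> \<eta> * ?n"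
      using form_bound_norm_mult_vec[OF symmetric_minus[OF A(1) B(1)] diff x]
        minus_mult_distrib_mat_vec[OF carrier x] by simp
    show "0 \<le> \<eta> * ?n" by (rule form_bound_norm_nonneg[OF diff x])
    show "euclid_norm (A *\<^sub>v x + B *\<^sub>v x) \<le> d * ?n + d * ?n"
      using euclid_norm_add[OF Ax Bx] form_bound_norm_mult_vec[OF A x] form_bound_norm_mult_vec[OF B x] by linarith
  qed simp
  also have "\<dots> = 2 * d * \<eta> * (x \<bullet> x)"
    by (simp add: euclid_norm_square[symmetric] power2_eq_square algebra_simps)
  finally show "\<bar>x \<bullet> ((A * A - B * B) *\<^sub>v x)\<bar> \<le> 2 * d * \<eta> * (x \<bullet> x)" .
qed

definition form_norm :: "nat \<Rightarrow> rmat \<Rightarrow> real" where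
  "form_norm p A = Inf {d. 0 \<le> d \<and> form_bound p A d}"

lemma form_norm_le: "0 \<le> d \<Longrightarrow> form_bound p A d \<Longrightarrow> form_norm p A \<le> d"
  unfolding form_norm_def by (intro cInf_lower bdd_belowI[of _ 0]) auto

lemma form_norm_nonneg:
  assumes "A \<in> carrier_mat p p"
  shows "0 \<le> form_norm p A"
  unfolding form_norm_def using form_bound_exists[OF assms] by (intro cInf_greatest) (auto intro: less_imp_le)

lemma form_bound_form_norm:
  assumes "A \<in> carrier_mat p p"
  shows "form_bound p A (form_norm p A)"
proof (rule form_bound_if_unit_sphere[OF assms])
  fix e assume "e \<in> unit_sphere p"
  then show "\<bar>e \<bullet> (A *\<^sub>v e)\<bar> \<le> form_norm p A"
    unfolding form_norm_def using form_bound_exists[OF assms]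
    by (intro cInf_greatest) (auto simp: unit_sphere_def form_bound_def intro: less_imp_le)
qed

text \<open>The library's metric spaces require a distance that is symmetric and nonnegative on the whole type.\<close>

definition form_dist :: "nat \<Rightarrow> rmat \<Rightarrow> rmat \<Rightarrow> real" where
  "form_dist p A B = (if A \<in> carrier_mat p p \<and> B \<in> carrier_mat p p then form_norm p (A - B) else 0)"

lemma form_bound_form_dist:
  assumes "A \<in> carrier_mat p p" "B \<in> carrier_mat p p"
  shows "form_bound p (A - B) (form_dist p A B)"
  using assms form_bound_form_norm[of "A - B" p] by (simp add: form_dist_def)

lemma form_dist_nonneg: "0 \<le> form_dist p A B"
  by (simp add: form_dist_def form_norm_nonneg)

lemma form_dist_le: "0 \<le> d \<Longrightarrow> form_bound p (A - B) d \<Longrightarrow> form_dist p A B \<le> d"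
  by (simp add: form_dist_def form_norm_le)

lemma Metric_space_form_dist: "Metric_space (Collect (symmetric p)) (form_dist p)"
proof
  fix A B C :: rmat
  show "0 \<le> form_dist p A B" by (rule form_dist_nonneg)
  show "form_dist p A B = form_dist p B A"
    by (auto simp: form_dist_def form_norm_def form_bound_minus_commute[of A p B])
  assume "A \<in> Collect (symmetric p)" "B \<in> Collect (symmetric p)"
  then have A: "symmetric p A" and B: "symmetric p B" by auto
  note A_carrier = symmetric_carrier[OF A] and B_carrier = symmetric_carrier[OF B]
  show "form_dist p A B = 0 \<longleftrightarrow> A = B"
  proof
    assume "form_dist p A B = 0"
    then have "form_bound p (A - B) 0" using form_bound_form_dist[OF A_carrier B_carrier] by simp
    then have "\<bar>(A - B) $$ (i, j)\<bar> \<le> 0" if "i < p" "j < p" for i j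
      using form_bound_entry[OF symmetric_minus[OF A B]] that by blast
    then show "A = B" using A_carrier B_carrier by (intro eq_matI) auto
  next
    assume "A = B"
    then show "form_dist p A B = 0"
      using form_dist_le[of 0 p A B] form_dist_nonneg[of p A B] A_carrier
      by (auto simp: form_bound_def form_zero)
  qed
  assume "C \<in> Collect (symmetric p)"
  then have C_carrier: "C \<in> carrier_mat p p" by auto
  show "form_dist p A C \<le> form_dist p A B + form_dist p B C"
    by (intro form_dist_le add_nonneg_nonneg form_dist_nonneg
        form_bound_triangle[OF A_carrier B_carrier C_carrier] form_bound_form_dist A_carrier B_carrier C_carrier)
qed

definition entrywise_tendsto :: "nat \<Rightarrow> (nat \<Rightarrow> rmat) \<Rightarrow> rmat \<Rightarrow> bool" where
  "entrywise_tendsto p X A \<longleftrightarrow> A \<in> carrier_mat p p \<and> (\<forall>i<p. \<forall>j<p. (\<lambda>k. X k $$ (i, j)) \<longlonglongrightarrow> A $$ (i, j))"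

definition entrywise_closed :: "nat \<Rightarrow> rmat set \<Rightarrow> bool" where
  "entrywise_closed p \<S> \<longleftrightarrow> (\<forall>X A. range X \<subseteq> \<S> \<longrightarrow> entrywise_tendsto p X A \<longrightarrow> A \<in> \<S>)"

lemma entrywise_tendsto_carrier: "entrywise_tendsto p X A \<Longrightarrow> A \<in> carrier_mat p p"
  by (simp add: entrywise_tendsto_def)

lemma entrywise_tendsto_index:
  "entrywise_tendsto p X A \<Longrightarrow> i < p \<Longrightarrow> j < p \<Longrightarrow> (\<lambda>k. X k $$ (i, j)) \<longlonglongrightarrow> A $$ (i, j)"
  by (simp add: entrywise_tendsto_def)

lemma entrywise_closed_Int:
  assumes "entrywise_closed p \<S>" "entrywise_closed p \<T>"
  shows "entrywise_closed p (\<S> \<inter> \<T>)"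
  using assms unfolding entrywise_closed_def by (meson Int_iff le_inf_iff)

lemma entrywise_tendsto_symmetric:
  assumes X: "\<And>k. symmetric p (X k)" and lim: "entrywise_tendsto p X A"
  shows "symmetric p A"
proof (rule symmetricI[OF entrywise_tendsto_carrier[OF lim]])
  fix i j assume "i < p" "j < p"
  then show "A $$ (i, j) = A $$ (j, i)"
    using LIMSEQ_unique[OF entrywise_tendsto_index[OF lim, of i j]] entrywise_tendsto_index[OF lim, of j i]
      symmetric_index[OF X, of i j] by simp
qed

lemma entrywise_tendsto_form:
  assumes X: "\<And>k. X k \<in> carrier_mat p p" and lim: "entrywise_tendsto p X A"
    and x: "x \<in> carrier_vec p" and y: "y \<in> carrier_vec p"
  shows "(\<lambda>k. x \<bullet> (X k *\<^sub>v y)) \<longlonglongrightarrow> x \<bullet> (A *\<^sub>v y)"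
  unfolding form_entries[OF entrywise_tendsto_carrier[OF lim] x y] form_entries[OF X x y]
  by (auto intro!: tendsto_sum tendsto_mult tendsto_const entrywise_tendsto_index[OF lim])

lemma entrywise_tendsto_form_bound:
  assumes X: "\<And>k. X k \<in> carrier_mat p p" and lim: "entrywise_tendsto p X A" and B: "B \<in> carrier_mat p p"
    and bound: "\<And>k. k \<ge> N \<Longrightarrow> form_bound p (X k - B) d"
  shows "form_bound p (A - B) d"
proof (rule form_boundI)
  fix x :: rvec assume x: "x \<in> carrier_vec p"
  have "(\<lambda>k. \<bar>x \<bullet> (X k *\<^sub>v x) - x \<bullet> (B *\<^sub>v x)\<bar>) \<longlonglongrightarrow> \<bar>x \<bullet> (A *\<^sub>v x) - x \<bullet> (B *\<^sub>v x)\<bar>"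
    by (intro tendsto_intros entrywise_tendsto_form[OF X lim x x])
  moreover have "\<bar>x \<bullet> (X k *\<^sub>v x) - x \<bullet> (B *\<^sub>v x)\<bar> \<le> d * (x \<bullet> x)" if "k \<ge> N" for k
    using form_boundD[OF bound[OF that] x] X B x by (simp add: form_minus[where p = p])
  ultimately have "\<bar>x \<bullet> (A *\<^sub>v x) - x \<bullet> (B *\<^sub>v x)\<bar> \<le> d * (x \<bullet> x)"
    by (intro LIMSEQ_le_const2) auto
  then show "\<bar>x \<bullet> ((A - B) *\<^sub>v x)\<bar> \<le> d * (x \<bullet> x)"
    using entrywise_tendsto_carrier[OF lim] B x by (simp add: form_minus[where p = p])
qed

lemma entrywise_tendsto_if_form_bound_Cauchy:
  assumes X: "\<And>k. symmetric p (X k)"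
    and Cauchy: "\<And>d. 0 < d \<Longrightarrow> \<exists>N. \<forall>k\<ge>N. \<forall>l\<ge>N. form_bound p (X k - X l) d"
  shows "\<exists>A. entrywise_tendsto p X A"
proof -
  have "convergent (\<lambda>k. X k $$ (i, j))" if ij: "i < p" "j < p" for i j
  proof (intro Cauchy_convergent metric_CauchyI)
    fix e :: real assume "0 < e"
    then obtain N where N: "\<And>k l. k \<ge> N \<Longrightarrow> l \<ge> N \<Longrightarrow> form_bound p (X k - X l) (e / 2)"
      using Cauchy[of "e / 2"] by auto
    have "dist (X k $$ (i, j)) (X l $$ (i, j)) < e" if "k \<ge> N" "l \<ge> N" for k l
    proof -
      have "\<bar>(X k - X l) $$ (i, j)\<bar> \<le> e / 2"
        by (rule form_bound_entry[OF symmetric_minus[OF X X] N[OF that] ij])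
      moreover have "(X k - X l) $$ (i, j) = X k $$ (i, j) - X l $$ (i, j)"
        using ij carrier_matD[OF symmetric_carrier[OF X]] by simp
      ultimately show ?thesis using \<open>0 < e\<close> by (simp add: dist_real_def)
    qed
    then show "\<exists>N. \<forall>k\<ge>N. \<forall>l\<ge>N. dist (X k $$ (i, j)) (X l $$ (i, j)) < e" by blast
  qed
  then have "entrywise_tendsto p X (Matrix.mat p p (\<lambda>ij. lim (\<lambda>k. X k $$ ij)))"
    by (simp add: entrywise_tendsto_def convergent_LIMSEQ_iff)
  then show ?thesis ..
qed

lemma mcomplete_form_dist:
  assumes sym: "\<S> \<subseteq> Collect (symmetric p)" and closed: "entrywise_closed p \<S>"
  shows "Metric_space.mcomplete \<S> (form_dist p)"
proof -
  interpret Metric_space \<S> "form_dist p"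
    by (rule Metric_space.subspace[OF Metric_space_form_dist sym])
  have "\<exists>A. limitin mtopology X A sequentially" if X: "MCauchy X" for X
  proof -
    have X_in: "X k \<in> \<S>" and X_sym: "symmetric p (X k)" for k using X sym by (auto simp: MCauchy_def)
    note X_carrier = symmetric_carrier[OF X_sym]
    have Cauchy: "\<exists>N. \<forall>k\<ge>N. \<forall>l\<ge>N. form_bound p (X k - X l) d" if "0 < d" for d
    proof -
      obtain N where "\<And>k l. k \<ge> N \<Longrightarrow> l \<ge> N \<Longrightarrow> form_dist p (X k) (X l) < d"
        using X \<open>0 < d\<close> unfolding MCauchy_def by blast
      then show ?thesis
        using form_bound_mono[OF form_bound_form_dist[OF X_carrier X_carrier] less_imp_le] by blast
    qed
    obtain A where A: "entrywise_tendsto p X A"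
      using entrywise_tendsto_if_form_bound_Cauchy[OF X_sym Cauchy] by blast
    note A_carrier = entrywise_tendsto_carrier[OF A]
    have "\<exists>N. \<forall>k\<ge>N. form_dist p (X k) A < d" if d_pos: "0 < d" for d
    proof -
      obtain N where N: "\<And>k l. k \<ge> N \<Longrightarrow> l \<ge> N \<Longrightarrow> form_bound p (X k - X l) (d / 2)"
        using Cauchy[OF half_gt_zero[OF d_pos]] by blast
      have "form_dist p (X k) A \<le> d / 2" if "k \<ge> N" for k
        using entrywise_tendsto_form_bound[OF X_carrier A X_carrier N[OF _ that]] d_pos
        by (intro form_dist_le) (auto simp: form_bound_minus_commute[OF X_carrier A_carrier])
      then have "form_dist p (X k) A < d" if "k \<ge> N" for k using that d_pos by force
      then show ?thesis by blast
    qed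
    moreover have "A \<in> \<S>" using closed A X_in unfolding entrywise_closed_def by blast
    ultimately show ?thesis using X_in by (auto simp: limit_metric_sequentially)
  qed
  then show ?thesis by (simp add: mcomplete_def)
qed

lemma matrix_contraction_fixpoint:
  fixes f :: "rmat \<Rightarrow> rmat" and \<S> :: "rmat set"
  assumes sym: "\<S> \<subseteq> Collect (symmetric p)" and closed: "entrywise_closed p \<S>" and nonempty: "\<S> \<noteq> {}"
    and maps: "\<And>A. A \<in> \<S> \<Longrightarrow> f A \<in> \<S>" and \<rho>: "0 \<le> \<rho>" "\<rho> < 1"
    and contraction: "\<And>A B \<eta>. A \<in> \<S> \<Longrightarrow> B \<in> \<S> \<Longrightarrow> 0 \<le> \<eta> \<Longrightarrow> form_bound p (A - B) \<eta> \<Longrightarrow>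
      form_bound p (f A - f B) (\<rho> * \<eta>)"
  obtains A where "A \<in> \<S>" "f A = A"
proof -
  interpret Metric_space \<S> "form_dist p"
    by (rule Metric_space.subspace[OF Metric_space_form_dist sym])
  show ?thesis
  proof (rule Banach_fixedpoint_thm[OF mcomplete_form_dist[OF sym closed] nonempty _ \<rho>(2) _ that])
    show "form_dist p (f A) (f B) \<le> \<rho> * form_dist p A B" if "A \<in> \<S>" "B \<in> \<S>" for A B
      using that \<rho>(1) sym
      by (intro form_dist_le mult_nonneg_nonneg contraction form_bound_form_dist) auto
  qed (use maps in auto)
qed

definition form_ball :: "nat \<Rightarrow> rmat \<Rightarrow> real \<Rightarrow> rmat set" where
  "form_ball p C d = {A. symmetric p A \<and> form_bound p (A - C) d}"

lemma form_ballD: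
  assumes "A \<in> form_ball p C d"
  shows "symmetric p A" "A \<in> carrier_mat p p" "form_bound p (A - C) d"
  using assms by (auto simp: form_ball_def)

lemma form_ball_zero_iff: "A \<in> form_ball p (0\<^sub>m p p) d \<longleftrightarrow> symmetric p A \<and> form_bound p A d"
  by (auto simp: form_ball_def form_bound_def form_minus[OF symmetric_carrier] form_zero)

lemma center_in_form_ball: "symmetric p C \<Longrightarrow> 0 \<le> d \<Longrightarrow> C \<in> form_ball p C d"
  by (auto simp: form_ball_def form_bound_def form_minus[OF symmetric_carrier symmetric_carrier]
      scalar_prod_self_nonneg)

lemma entrywise_closed_form_ball:
  assumes "C \<in> carrier_mat p p"
  shows "entrywise_closed p (form_ball p C d)"
  unfolding entrywise_closed_def
proof (intro allI impI)
  fix X A assume X: "range X \<subseteq> form_ball p C d" and lim: "entrywise_tendsto p X A"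
  then have "X k \<in> form_ball p C d" for k by blast
  note X = form_ballD[OF this]
  show "A \<in> form_ball p C d"
    using entrywise_tendsto_symmetric[OF X(1) lim] entrywise_tendsto_form_bound[OF X(2) lim assms X(3)]
    by (simp add: form_ball_def)
qed

section \<open>Inverses and square roots of positive definite matrices\<close>

lemma mat_inv_eqI:
  assumes A: "A \<in> carrier_mat p p" and B: "B \<in> carrier_mat p p" and AB: "A * B = 1\<^sub>m p"
  shows "mat_inv A = B"
proof -
  have BA: "B * A = 1\<^sub>m p"
    using mat_mult_left_right_inverse[OF A B AB] .
  have "A \<in> Units (ring_mat TYPE(real) p ())"
    using A B AB BA unfolding Units_def ring_mat_def by auto
  then obtain C where C: "mat_inverse A = Some C"
    using mat_inverse(1)[OF A, where b = "()"] by (cases "mat_inverse A") auto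
  with mat_inverse(2)[OF A C] have "A * C = 1\<^sub>m p" "C \<in> carrier_mat p p" by auto
  then have "C = B" using assoc_mult_mat[OF B A, of C p] A B BA by simp
  with C show ?thesis by (simp add: mat_inv_def)
qed

lemma mat_inv_one: "mat_inv (1\<^sub>m p) = 1\<^sub>m p"
  by (rule mat_inv_eqI[where p = p]) auto

lemma pos_def_mat_inv_mult:
  assumes A: "pos_def p A"
  shows "mat_inv A \<in> carrier_mat p p" "A * mat_inv A = 1\<^sub>m p" "mat_inv A * A = 1\<^sub>m p"
proof -
  note A_carrier = pos_def_carrier[OF A]
  have "det A \<noteq> 0"
  proof
    assume "det A = 0"
    then obtain v where "v \<in> carrier_vec p" "v \<noteq> 0\<^sub>v p" "A *\<^sub>v v = 0\<^sub>v p"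
      using det_0_iff_vec_prod_zero_field[OF A_carrier] by blast
    with pos_def_pos[OF A, of v] show False by simp
  qed
  from det_non_zero_imp_unit[OF A_carrier this, where b = "()"]
  obtain B where B: "mat_inverse A = Some B"
    using mat_inverse(1)[OF A_carrier, where b = "()"] by (cases "mat_inverse A") auto
  with mat_inverse(2)[OF A_carrier B]
  show "mat_inv A \<in> carrier_mat p p" "A * mat_inv A = 1\<^sub>m p" "mat_inv A * A = 1\<^sub>m p"
    by (auto simp: mat_inv_def)
qed

lemma pos_def_mat_inv_vec:
  assumes A: "pos_def p A" and x: "x \<in> carrier_vec p"
  shows "mat_inv A *\<^sub>v x \<in> carrier_vec p" "A *\<^sub>v (mat_inv A *\<^sub>v x) = x" "mat_inv A *\<^sub>v (A *\<^sub>v x) = x"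
  using assoc_mult_mat_vec[OF pos_def_carrier[OF A] pos_def_mat_inv_mult(1)[OF A] x]
    assoc_mult_mat_vec[OF pos_def_mat_inv_mult(1)[OF A] pos_def_carrier[OF A] x]
    pos_def_mat_inv_mult[OF A] x by simp_all

lemma pos_def_mat_inv:
  assumes A: "pos_def p A"
  shows "pos_def p (mat_inv A)"
proof (rule pos_defI)
  note A_carrier = pos_def_carrier[OF A] and inv = pos_def_mat_inv_mult[OF A]
  have "A * transpose_mat (mat_inv A) = 1\<^sub>m p"
    using arg_cong[OF inv(3), of transpose_mat] transpose_mult[OF inv(1) A_carrier] A by (simp add: pos_def_def)
  then show "symmetric p (mat_inv A)"
    using mat_inv_eqI[of A p "transpose_mat (mat_inv A)"] inv A_carrier by (simp add: symmetric_def)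
  fix x :: rvec assume x: "x \<in> carrier_vec p" "x \<noteq> 0\<^sub>v p"
  let ?y = "mat_inv A *\<^sub>v x"
  note y = pos_def_mat_inv_vec[OF A x(1)]
  have "?y \<noteq> 0\<^sub>v p" using y(2) x(2) mult_mat_zero_vec[OF A_carrier] by auto
  then have "0 < ?y \<bullet> (A *\<^sub>v ?y)" by (rule pos_def_pos[OF A y(1)])
  then show "0 < x \<bullet> ?y" using y(2) comm_scalar_prod[OF x(1) y(1)] by simp
qed

lemma mat_inv_mat_inv: "pos_def p A \<Longrightarrow> mat_inv (mat_inv A) = A"
  by (rule mat_inv_eqI[where p = p]) (simp_all add: pos_def_mat_inv_mult pos_def_carrier)

lemma mat_inv_smult:
  assumes A: "pos_def p A" and s: "s \<noteq> 0"
  shows "mat_inv (s \<cdot>\<^sub>m A) = (1 / s) \<cdot>\<^sub>m mat_inv A"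
proof (rule mat_inv_eqI[where p = p])
  note A_carrier = pos_def_carrier[OF A] and inv = pos_def_mat_inv_mult[OF A]
  have "s \<cdot>\<^sub>m A * ((1 / s) \<cdot>\<^sub>m mat_inv A) = (s * (1 / s)) \<cdot>\<^sub>m (A * mat_inv A)"
    using A_carrier inv(1) by (intro eq_matI) (auto simp: scalar_prod_smult_distrib)
  then show "s \<cdot>\<^sub>m A * ((1 / s) \<cdot>\<^sub>m mat_inv A) = 1\<^sub>m p"
    using s inv(2) by (simp add: smult_carrier_mat) (intro eq_matI; simp)
qed (use pos_def_carrier[OF A] pos_def_mat_inv_mult[OF A] in auto)

lemma form_conjugate:
  assumes R: "symmetric p R" and A: "A \<in> carrier_mat p p" and x: "x \<in> carrier_vec p" and y: "y \<in> carrier_vec p"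
  shows "x \<bullet> ((R * A * R) *\<^sub>v y) = (R *\<^sub>v x) \<bullet> (A *\<^sub>v (R *\<^sub>v y))"
  using mult_mat3_vec[OF _ A _ y, of R R] form_symmetric[OF R x, of "A *\<^sub>v (R *\<^sub>v y)"]
    symmetric_carrier[OF R] A x y by simp

lemma symmetric_conjugate:
  assumes R: "symmetric p R" and A: "symmetric p A"
  shows "symmetric p (R * A * R)"
proof (rule symmetricI)
  note R_carrier = symmetric_carrier[OF R] and A_carrier = symmetric_carrier[OF A]
  show conj_carrier: "R * A * R \<in> carrier_mat p p" using R_carrier A_carrier by simp
  fix i j assume ij: "i < p" "j < p"
  let ?e = "\<lambda>k. unit_vec p k :: rvec"
  have "?e i \<bullet> ((R * A * R) *\<^sub>v ?e j) = ?e j \<bullet> ((R * A * R) *\<^sub>v ?e i)"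
    using form_commute[OF A, of "R *\<^sub>v ?e i" "R *\<^sub>v ?e j"] R_carrier by (simp add: form_conjugate[OF R A_carrier])
  then show "(R * A * R) $$ (i, j) = (R * A * R) $$ (j, i)"
    using form_unit_vec[OF conj_carrier ij] form_unit_vec[OF conj_carrier ij(2,1)] by simp
qed

lemma pos_def_mult_vec_nonzero:
  assumes "pos_def p R" "x \<in> carrier_vec p" "x \<noteq> 0\<^sub>v p"
  shows "R *\<^sub>v x \<noteq> 0\<^sub>v p"
  using pos_def_pos[OF assms] assms(2) by auto

lemma pos_def_conjugate:
  assumes R: "pos_def p R" and A: "pos_def p A"
  shows "pos_def p (R * A * R)"
proof (rule pos_defI)
  show "symmetric p (R * A * R)" by (intro symmetric_conjugate pos_def_symmetric R A)
  fix x :: rvec assume x: "x \<in> carrier_vec p" "x \<noteq> 0\<^sub>v p"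
  then show "0 < x \<bullet> ((R * A * R) *\<^sub>v x)"
    using pos_def_pos[OF A _ pos_def_mult_vec_nonzero[OF R x]] pos_def_carrier[OF R]
    unfolding form_conjugate[OF pos_def_symmetric[OF R] pos_def_carrier[OF A] x(1) x(1)] by simp
qed

lemma mat_inv_conjugate:
  assumes R: "pos_def p R" and A: "pos_def p A"
  shows "mat_inv (R * A * R) = mat_inv R * mat_inv A * mat_inv R"
proof (rule mat_inv_eqI[where p = p])
  note carriers = pos_def_carrier[OF R] pos_def_carrier[OF A] pos_def_mat_inv_mult(1)[OF R] pos_def_mat_inv_mult(1)[OF A]
  show "R * A * R * (mat_inv R * mat_inv A * mat_inv R) = 1\<^sub>m p"
  proof (rule mat_eq_vecI[where p = p])
    fix x :: rvec assume x: "x \<in> carrier_vec p"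
    let ?y = "mat_inv R *\<^sub>v (mat_inv A *\<^sub>v (mat_inv R *\<^sub>v x))"
    have y: "?y \<in> carrier_vec p" using carriers x by simp
    have "(R * A * R * (mat_inv R * mat_inv A * mat_inv R)) *\<^sub>v x = (R * A * R) *\<^sub>v ?y"
      unfolding mult_mat3_vec[OF carriers(3,4,3) x, symmetric] using carriers x by (intro assoc_mult_mat_vec) auto
    also have "\<dots> = x"
      unfolding mult_mat3_vec[OF carriers(1,2,1) y]
      using carriers x pos_def_mat_inv_vec[OF R] pos_def_mat_inv_vec[OF A] by simp
    finally show "(R * A * R * (mat_inv R * mat_inv A * mat_inv R)) *\<^sub>v x = 1\<^sub>m p *\<^sub>v x" using x by simp
  qed (use carriers in auto)
qed (use pos_def_carrier[OF R] pos_def_carrier[OF A] pos_def_mat_inv_mult(1)[OF R] pos_def_mat_inv_mult(1)[OF A] in auto)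

lemma mat_inv_scaled_conjugate:
  assumes R: "pos_def p R" and A: "pos_def p A" and s: "s \<noteq> 0"
  shows "mat_inv (s \<cdot>\<^sub>m (R * A * R)) = (1 / s) \<cdot>\<^sub>m (mat_inv R * mat_inv A * mat_inv R)"
  using mat_inv_smult[OF pos_def_conjugate[OF R A] s] mat_inv_conjugate[OF R A] by simp

lemma loewner_le_mat_inv:
  assumes A: "pos_def p A" and B: "pos_def p B" and AB: "loewner_le p A B"
  shows "loewner_le p (mat_inv B) (mat_inv A)"
  unfolding loewner_le_def
proof
  fix x :: rvec assume x: "x \<in> carrier_vec p"
  let ?y = "mat_inv A *\<^sub>v x" and ?z = "mat_inv B *\<^sub>v x"
  note y = pos_def_mat_inv_vec(1,2)[OF A x] and z = pos_def_mat_inv_vec(1,2)[OF B x]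
  have xz: "0 \<le> x \<bullet> ?z" and xy: "0 \<le> x \<bullet> ?y"
    using psd_nonneg[OF pos_def_psd[OF pos_def_mat_inv] x] A B by auto
  have "x \<bullet> ?z = ?y \<bullet> (A *\<^sub>v ?z)"
    using form_symmetric[OF pos_def_symmetric[OF A] y(1) z(1)] y(2) by simp
  then have "(x \<bullet> ?z)\<^sup>2 \<le> (?y \<bullet> (A *\<^sub>v ?y)) * (?z \<bullet> (A *\<^sub>v ?z))"
    using psd_Cauchy_Schwarz[OF pos_def_psd[OF A] y(1) z(1)] by simp
  also have "\<dots> \<le> (x \<bullet> ?y) * (x \<bullet> ?z)"
    using loewner_leD[OF AB z(1)] y z xy comm_scalar_prod[OF x y(1)] comm_scalar_prod[OF x z(1)]
    by (simp add: mult_left_mono)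
  finally show "x \<bullet> ?z \<le> x \<bullet> ?y"
    using xz xy by (cases "x \<bullet> ?z = 0") (auto simp: power2_eq_square)
qed

lemma pos_def_lower_bound:
  assumes A: "pos_def p A"
  shows "\<exists>c>0. \<forall>x \<in> carrier_vec p. c * (x \<bullet> x) \<le> x \<bullet> (A *\<^sub>v x)"
proof -
  note inv = pos_def_mat_inv[OF A]
  obtain d where d: "d > 0" "form_bound p (mat_inv A) d"
    using form_bound_exists[OF pos_def_carrier[OF inv]] by blast
  have scaled_one: "pos_def p (d \<cdot>\<^sub>m 1\<^sub>m p)" by (rule pos_def_smult[OF pos_def_one d(1)])
  have "loewner_le p (mat_inv A) (d \<cdot>\<^sub>m 1\<^sub>m p)"
    using form_boundD[OF d(2)] by (auto simp: loewner_le_def abs_le_iff form_smult[where p = p])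
  from loewner_le_mat_inv[OF inv scaled_one this]
  have "loewner_le p ((1 / d) \<cdot>\<^sub>m 1\<^sub>m p) A"
    using d(1) by (simp add: mat_inv_mat_inv[OF A] mat_inv_smult[OF pos_def_one] mat_inv_one)
  then show ?thesis
    using d(1) by (intro exI[of _ "1 / d"]) (auto simp: loewner_le_def form_smult[where p = p])
qed

text \<open>The square root of \<open>1 - B\<close> is \<open>1 - Y\<close>, where \<open>Y\<close> is the fixed point of \<open>Y \<mapsto> (B + Y\<^sup>2) / 2\<close>.\<close>

lemma half_sum_square_fixpoint:
  assumes B: "symmetric p B" and b: "form_bound p B b" "0 \<le> b" "b < 1"
  shows "\<exists>Y. symmetric p Y \<and> form_bound p Y (1 - sqrt (1 - b)) \<and> (1 / 2) \<cdot>\<^sub>m (B + Y * Y) = Y"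
proof -
  define y where "y = 1 - sqrt (1 - b)"
  have y: "0 \<le> y" "y < 1" using b by (auto simp: y_def)
  have y_fixpoint: "(b + y\<^sup>2) / 2 = y" using b by (simp add: y_def power2_diff)
  define f where "f Y = (1 / 2) \<cdot>\<^sub>m (B + Y * Y)" for Y
  define \<S> where "\<S> = form_ball p (0\<^sub>m p p) y"
  have \<S>: "symmetric p Y" "form_bound p Y y" "Y * Y \<in> carrier_mat p p" if "Y \<in> \<S>" for Y
    using that by (auto simp: \<S>_def form_ball_zero_iff)
  note B_carrier = symmetric_carrier[OF B]
  obtain Y where "Y \<in> \<S>" "f Y = Y"
  proof (rule matrix_contraction_fixpoint[of \<S> p f y])
    show "\<S> \<subseteq> Collect (symmetric p)" using \<S> by auto
    show "entrywise_closed p \<S>" unfolding \<S>_def by (rule entrywise_closed_form_ball) simp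
    show "\<S> \<noteq> {}" using center_in_form_ball[OF symmetric_zero y(1)] by (auto simp: \<S>_def)
    show "f Y \<in> \<S>" if "Y \<in> \<S>" for Y
      unfolding \<S>_def form_ball_zero_iff
    proof
      note Y = \<S>[OF that]
      show "symmetric p (f Y)" unfolding f_def by (intro symmetric_smult symmetric_add B symmetric_square Y)
      have "form_bound p (f Y) (\<bar>1 / 2\<bar> * (b + y\<^sup>2))"
        unfolding f_def using B_carrier Y(3)
        by (intro form_bound_smult form_bound_add b(1) form_bound_square Y) auto
      then show "form_bound p (f Y) y" using y_fixpoint by simp
    qed
    show "form_bound p (f Y - f Z) (y * \<eta>)"
      if "Y \<in> \<S>" "Z \<in> \<S>" and diff: "form_bound p (Y - Z) \<eta>" for Y Z \<eta>
    proof -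
      note Y = \<S>[OF that(1)] and Z = \<S>[OF that(2)]
      have "f Y - f Z = (1 / 2) \<cdot>\<^sub>m (Y * Y - Z * Z)"
        using B_carrier symmetric_carrier[OF Y(1)] symmetric_carrier[OF Z(1)]
        by (intro eq_matI) (auto simp: f_def field_simps simp del: index_mult_mat(1))
      then show ?thesis
        using form_bound_smult[OF _ form_bound_square_diff[OF Y(1,2) Z(1,2) diff], of "1 / 2"] Y(3) Z(3) by simp
    qed
  qed (use y in auto)
  then show ?thesis using \<S>[of Y] by (auto simp: f_def y_def)
qed

lemma sqrt_one_minus_exists:
  assumes B: "symmetric p B" and b: "form_bound p B b" "0 \<le> b" "b < 1"
  shows "\<exists>R. pos_def p R \<and> R * R = 1\<^sub>m p - B"
proof -
  obtain Y where Y: "symmetric p Y" "form_bound p Y (1 - sqrt (1 - b))" "(1 / 2) \<cdot>\<^sub>m (B + Y * Y) = Y"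
    using half_sum_square_fixpoint[OF assms] by blast
  note Y_carrier = symmetric_carrier[OF Y(1)] and B_carrier = symmetric_carrier[OF B]
  let ?R = "1\<^sub>m p - Y"
  have "pos_def p ?R"
  proof (rule pos_defI)
    show "symmetric p ?R" by (intro symmetric_minus symmetric_one Y)
    fix x :: rvec assume x: "x \<in> carrier_vec p" "x \<noteq> 0\<^sub>v p"
    have "x \<bullet> (Y *\<^sub>v x) \<le> (1 - sqrt (1 - b)) * (x \<bullet> x)" using form_boundD[OF Y(2) x(1)] by (simp add: abs_le_iff)
    also have "\<dots> < 1 * (x \<bullet> x)" using b scalar_prod_self_pos[OF x] by (intro mult_strict_right_mono) auto
    finally show "0 < x \<bullet> (?R *\<^sub>v x)" using x Y_carrier by (simp add: form_minus[where p = p])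
  qed
  moreover have "?R * ?R = 1\<^sub>m p - B"
  proof (rule eq_matI)
    have expand: "?R * ?R = ?R - (Y - Y * Y)"
      using minus_mult_distrib_mat[of "1\<^sub>m p" p p Y ?R p] mult_minus_distrib_mat[of Y p p "1\<^sub>m p" p Y] Y_carrier
      by simp
    fix i j assume "i < dim_row (1\<^sub>m p - B)" "j < dim_col (1\<^sub>m p - B)"
    then have ij: "i < p" "j < p" using B_carrier by auto
    then have "Y $$ (i, j) = (B $$ (i, j) + (Y * Y) $$ (i, j)) / 2"
      using arg_cong[OF Y(3), of "\<lambda>A. A $$ (i, j)"] B_carrier Y_carrier by simp
    then show "(?R * ?R) $$ (i, j) = (1\<^sub>m p - B) $$ (i, j)"
      using ij Y_carrier B_carrier by (simp add: expand del: index_mult_mat(1))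
  qed (use Y_carrier B_carrier in auto)
  ultimately show ?thesis by blast
qed

lemma pos_def_scaled_near_one:
  assumes A: "pos_def p A"
  shows "\<exists>m b. 0 < m \<and> 0 \<le> b \<and> b < 1 \<and> form_bound p (1\<^sub>m p - (1 / m) \<cdot>\<^sub>m A) b"
proof -
  note A_carrier = pos_def_carrier[OF A]
  obtain m where m: "m > 0" "form_bound p A m" using form_bound_exists[OF A_carrier] by blast
  obtain c where c: "c > 0" "\<And>x. x \<in> carrier_vec p \<Longrightarrow> c * (x \<bullet> x) \<le> x \<bullet> (A *\<^sub>v x)"
    using pos_def_lower_bound[OF A] by blast
  define b where "b = 1 - min c m / m"
  have "form_bound p (1\<^sub>m p - (1 / m) \<cdot>\<^sub>m A) b"
  proof (rule form_boundI)
    fix x :: rvec assume x: "x \<in> carrier_vec p"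
    have "x \<bullet> (A *\<^sub>v x) \<le> m * (x \<bullet> x)" using form_boundD[OF m(2) x] by (simp add: abs_le_iff)
    moreover have "min c m * (x \<bullet> x) \<le> c * (x \<bullet> x)" by (intro mult_right_mono scalar_prod_self_nonneg) simp
    moreover note c(2)[OF x]
    moreover have "0 \<le> b * (x \<bullet> x)" using m c scalar_prod_self_nonneg by (simp add: b_def)
    ultimately show "\<bar>x \<bullet> ((1\<^sub>m p - (1 / m) \<cdot>\<^sub>m A) *\<^sub>v x)\<bar> \<le> b * (x \<bullet> x)"
      using x A_carrier m(1) by (simp add: b_def form_minus[where p = p] form_smult[where p = p] field_simps)
  qed
  then show ?thesis using m c by (intro exI[of _ m] exI[of _ b]) (auto simp: b_def)
qed

lemma pos_def_sqrt_exists: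
  assumes A: "pos_def p A"
  shows "\<exists>R. pos_def p R \<and> R * R = A"
proof -
  note A_carrier = pos_def_carrier[OF A]
  obtain m b where m: "0 < m" and b: "form_bound p (1\<^sub>m p - (1 / m) \<cdot>\<^sub>m A) b" "0 \<le> b" "b < 1"
    using pos_def_scaled_near_one[OF A] by blast
  have "symmetric p (1\<^sub>m p - (1 / m) \<cdot>\<^sub>m A)"
    by (intro symmetric_minus symmetric_one symmetric_smult pos_def_symmetric A)
  then obtain Q where Q: "pos_def p Q" "Q * Q = 1\<^sub>m p - (1\<^sub>m p - (1 / m) \<cdot>\<^sub>m A)"
    using sqrt_one_minus_exists b by blast
  note Q_carrier = pos_def_carrier[OF Q(1)]
  have "(sqrt m \<cdot>\<^sub>m Q) * (sqrt m \<cdot>\<^sub>m Q) = m \<cdot>\<^sub>m (Q * Q)"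
    using Q_carrier m by (intro eq_matI) auto
  also have "\<dots> = A"
    unfolding Q(2) using A_carrier m by (intro eq_matI) auto
  finally show ?thesis using pos_def_smult[OF Q(1), of "sqrt m"] m by auto
qed

section \<open>Traces\<close>

lemma mat_trace_comm:
  assumes "A \<in> carrier_mat p p" "B \<in> carrier_mat p p"
  shows "mat_trace (A * B) = mat_trace (B * A)"
  using assms unfolding mat_trace_def scalar_prod_def
  by (auto simp: scalar_prod_def mult.commute atLeast0LessThan intro: sum.swap)

lemma mat_trace_add:
  "A \<in> carrier_mat p p \<Longrightarrow> B \<in> carrier_mat p p \<Longrightarrow> mat_trace (A + B) = mat_trace A + mat_trace B"
  by (simp add: mat_trace_def sum.distrib)

lemma mat_trace_minus:
  "A \<in> carrier_mat p p \<Longrightarrow> B \<in> carrier_mat p p \<Longrightarrow> mat_trace (A - B) = mat_trace A - mat_trace B"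
  by (simp add: mat_trace_def sum_subtractf)

lemma mat_trace_smult: "A \<in> carrier_mat p p \<Longrightarrow> mat_trace (c \<cdot>\<^sub>m A) = c * mat_trace A"
  by (simp add: mat_trace_def sum_distrib_left)

lemma mat_trace_one: "mat_trace (1\<^sub>m p) = real p"
  by (simp add: mat_trace_def)

lemma entrywise_closed_trace: "entrywise_closed p {S. S \<in> carrier_mat p p \<and> mat_trace S = r}"
  unfolding entrywise_closed_def
proof (intro allI impI)
  fix X S assume X: "range X \<subseteq> {S. S \<in> carrier_mat p p \<and> mat_trace S = r}" and lim: "entrywise_tendsto p X S"
  have "(\<Sum>i<p. X k $$ (i, i)) = r" for k
    using X by (auto simp: mat_trace_def image_subset_iff)
  moreover have "(\<lambda>k. \<Sum>i<p. X k $$ (i, i)) \<longlonglongrightarrow> (\<Sum>i<p. S $$ (i, i))"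
    by (intro tendsto_sum entrywise_tendsto_index[OF lim]) auto
  ultimately have "(\<Sum>i<p. S $$ (i, i)) = r" by (simp add: LIMSEQ_const_iff)
  then show "S \<in> {S. S \<in> carrier_mat p p \<and> mat_trace S = r}"
    using entrywise_tendsto_carrier[OF lim] by (auto simp: mat_trace_def)
qed

lemma mat_trace_form: "A \<in> carrier_mat p p \<Longrightarrow> mat_trace A = (\<Sum>j<p. unit_vec p j \<bullet> (A *\<^sub>v unit_vec p j))"
  by (simp add: mat_trace_def)

lemma mat_trace_conjugate:
  assumes "symmetric p X" "A \<in> carrier_mat p p"
  shows "mat_trace (X * A * X) = (\<Sum>j<p. (X *\<^sub>v unit_vec p j) \<bullet> (A *\<^sub>v (X *\<^sub>v unit_vec p j)))"
proof -
  have "X * A * X \<in> carrier_mat p p" using assms symmetric_carrier[OF assms(1)] by simp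
  then show ?thesis by (simp only: mat_trace_form form_conjugate[OF assms] unit_vec_carrier)
qed

lemma mat_trace_conjugate_nonneg:
  assumes X: "symmetric p X" and A: "psd p A"
  shows "0 \<le> mat_trace (X * A * X)"
  unfolding mat_trace_conjugate[OF X symmetric_carrier[OF psd_symmetric[OF A]]]
  using X by (intro sum_nonneg psd_nonneg[OF A]) auto

lemma mat_trace_conjugate_eq_0D:
  assumes X: "symmetric p X" and A: "pos_def p A" and trace: "mat_trace (X * A * X) = 0"
  shows "X = 0\<^sub>m p p"
proof (rule eq_matI)
  fix i j assume "i < dim_row (0\<^sub>m p p :: rmat)" "j < dim_col (0\<^sub>m p p :: rmat)"
  then have ij: "i < p" "j < p" by auto
  let ?x = "\<lambda>j. X *\<^sub>v unit_vec p j"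
  have x: "?x j \<in> carrier_vec p" for j using X by auto
  have "(\<Sum>j<p. ?x j \<bullet> (A *\<^sub>v ?x j)) = 0"
    using trace mat_trace_conjugate[OF X pos_def_carrier[OF A]] by simp
  then have "?x j \<bullet> (A *\<^sub>v ?x j) = 0"
    using ij psd_nonneg[OF pos_def_psd[OF A] x] by (subst (asm) sum_nonneg_eq_0_iff) auto
  then have "?x j = 0\<^sub>v p"
    using pos_def_pos[OF A x] by (metis less_irrefl)
  then show "X $$ (i, j) = 0\<^sub>m p p $$ (i, j)"
    using form_unit_vec[OF symmetric_carrier[OF X] ij] ij by simp
qed (use X in auto)

lemma pos_def_sqrt_unique:
  assumes R: "pos_def p R" and Q: "pos_def p Q" and eq: "R * R = Q * Q"
  shows "R = Q"
proof -
  define X where "X = R - Q"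
  note R_carrier = pos_def_carrier[OF R] and Q_carrier = pos_def_carrier[OF Q]
  have X: "symmetric p X" unfolding X_def using R Q by (intro symmetric_minus) auto
  note X_carrier = symmetric_carrier[OF X]
  have "R * X + X * Q = (R * R - R * Q) + (R * Q - Q * Q)"
    using R_carrier Q_carrier
    by (simp add: X_def minus_mult_distrib_mat[where nr = p and n = p] mult_minus_distrib_mat[where n = p and nc = p])
  also have "\<dots> = 0\<^sub>m p p" using R_carrier Q_carrier eq by (intro eq_matI) (auto simp del: index_mult_mat(1))
  finally have sylvester: "R * X + X * Q = 0\<^sub>m p p" .
  have "mat_trace (X * R * X) + mat_trace (X * Q * X) = mat_trace (X * (R * X)) + mat_trace (X * (X * Q))"
    using X_carrier R_carrier Q_carrier mat_trace_comm[of "X * Q" p X]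
    by (simp add: assoc_mult_mat[where n\<^sub>1 = p and n\<^sub>2 = p and n\<^sub>3 = p and n\<^sub>4 = p])
  also have "\<dots> = mat_trace (X * (R * X + X * Q))"
    using X_carrier R_carrier Q_carrier by (subst mult_add_distrib_mat[where nr = p and n = p and nc = p])
      (auto simp: mat_trace_add[where p = p])
  also have "\<dots> = 0" using X_carrier by (simp add: sylvester mat_trace_def)
  finally have "mat_trace (X * R * X) + mat_trace (X * Q * X) = 0" .
  then have "mat_trace (X * R * X) = 0"
    using mat_trace_conjugate_nonneg[OF X pos_def_psd[OF R]] mat_trace_conjugate_nonneg[OF X pos_def_psd[OF Q]]
    by linarith
  then have "X = 0\<^sub>m p p" by (rule mat_trace_conjugate_eq_0D[OF X R])
  then show ?thesis unfolding X_def by (rule mat_minus_eq_0D[OF R_carrier Q_carrier])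
qed

lemma mat_sqrt_pos_def:
  assumes "pos_def p A"
  shows "pos_def p (mat_sqrt A)" "mat_sqrt A * mat_sqrt A = A"
proof -
  have p: "dim_row A = p" using pos_def_carrier[OF assms] by auto
  obtain R where R: "pos_def p R \<and> R * R = A" using pos_def_sqrt_exists[OF assms] by blast
  have "pos_def p (mat_sqrt A) \<and> mat_sqrt A * mat_sqrt A = A"
    unfolding mat_sqrt_def p by (rule theI[where a = R]) (use R pos_def_sqrt_unique[of p _ R] in auto)
  then show "pos_def p (mat_sqrt A)" "mat_sqrt A * mat_sqrt A = A" by auto
qed

lemma mat_trace_pos:
  assumes A: "pos_def p A" and p: "1 \<le> p"
  shows "0 < mat_trace A"
proof -
  have "0 < unit_vec p j \<bullet> (A *\<^sub>v unit_vec p j)" if "j < p" for j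
    using pos_def_pos[OF A] unit_sphereD[OF unit_vec_in_unit_sphere[OF that]] by blast
  then show ?thesis
    unfolding mat_trace_form[OF pos_def_carrier[OF A]] using p by (intro sum_pos) (auto simp: lessThan_empty_iff)
qed

lemma mat_trace_mult_pos_def_nonneg:
  assumes A: "psd p A" and B: "pos_def p B"
  shows "0 \<le> mat_trace (A * B)"
proof -
  let ?R = "mat_sqrt B"
  note R = mat_sqrt_pos_def[OF B]
  note A_carrier = symmetric_carrier[OF psd_symmetric[OF A]] and R_carrier = pos_def_carrier[OF R(1)]
  have "mat_trace (A * B) = mat_trace (A * ?R * ?R)"
    using A_carrier R_carrier R(2) assoc_mult_mat[OF A_carrier R_carrier R_carrier] by simp
  also have "\<dots> = mat_trace (?R * A * ?R)"
    using A_carrier R_carrier mat_trace_comm[of "A * ?R" p ?R] assoc_mult_mat[OF R_carrier A_carrier R_carrier] by simp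
  finally show ?thesis using mat_trace_conjugate_nonneg[OF pos_def_symmetric[OF R(1)] A] by simp
qed

lemma mat_trace_mult_nonneg:
  assumes A: "psd p A" and B: "psd p B"
  shows "0 \<le> mat_trace (A * B)"
proof (rule field_le_epsilon)
  fix e :: real assume e: "0 < e"
  note A_carrier = symmetric_carrier[OF psd_symmetric[OF A]] and B_carrier = symmetric_carrier[OF psd_symmetric[OF B]]
  define \<delta> where "\<delta> = e / (\<bar>mat_trace A\<bar> + 1)"
  have \<delta>: "0 < \<delta>" using e by (simp add: \<delta>_def add_nonneg_pos)
  have "pos_def p (B + \<delta> \<cdot>\<^sub>m 1\<^sub>m p)"
  proof (rule pos_defI)
    show "symmetric p (B + \<delta> \<cdot>\<^sub>m 1\<^sub>m p)" by (intro symmetric_add psd_symmetric B symmetric_smult symmetric_one)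
    show "0 < x \<bullet> ((B + \<delta> \<cdot>\<^sub>m 1\<^sub>m p) *\<^sub>v x)" if "x \<in> carrier_vec p" "x \<noteq> 0\<^sub>v p" for x
      using that psd_nonneg[OF B that(1)] scalar_prod_self_pos[OF that] B_carrier \<delta>
      by (simp add: form_add[where p = p] form_smult[where p = p] add_nonneg_pos)
  qed
  then have "0 \<le> mat_trace (A * (B + \<delta> \<cdot>\<^sub>m 1\<^sub>m p))" by (rule mat_trace_mult_pos_def_nonneg[OF A])
  also have "\<dots> = mat_trace (A * B) + \<delta> * mat_trace A"
    using A_carrier B_carrier
    by (simp add: mult_add_distrib_mat[where n = p and nc = p] mult_smult_distrib[where n = p and nc = p]
        mat_trace_add[where p = p] mat_trace_smult[where p = p])
  also have "\<delta> * mat_trace A \<le> \<delta> * (\<bar>mat_trace A\<bar> + 1)" using \<delta> by (intro mult_left_mono) auto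
  also have "\<dots> = e" by (simp add: \<delta>_def add_nonneg_pos less_imp_neq[symmetric])
  finally show "0 \<le> mat_trace (A * B) + e" by simp
qed

lemma mat_trace_mult_mono:
  assumes A: "symmetric p A" and B: "symmetric p B" and AB: "loewner_le p A B" and C: "psd p C"
  shows "mat_trace (A * C) \<le> mat_trace (B * C)"
  using mat_trace_mult_nonneg[OF psd_minus_if_loewner_le[OF A B AB] C]
    symmetric_carrier[OF A] symmetric_carrier[OF B] symmetric_carrier[OF psd_symmetric[OF C]]
  by (simp add: minus_mult_distrib_mat[where nr = p and n = p] mat_trace_minus[where p = p])

lemma mat_trace_mult_form_bound:
  assumes A: "symmetric p A" and d: "form_bound p A d" and B: "psd p B"
  shows "\<bar>mat_trace (A * B)\<bar> \<le> d * mat_trace B"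
proof -
  note B_carrier = symmetric_carrier[OF psd_symmetric[OF B]]
  have scaled: "mat_trace ((k \<cdot>\<^sub>m 1\<^sub>m p) * B) = k * mat_trace B" for k
    using B_carrier mult_smult_assoc_mat[OF one_carrier_mat B_carrier, of k] by (simp add: mat_trace_smult[where p = p])
  have "loewner_le p A (d \<cdot>\<^sub>m 1\<^sub>m p)" "loewner_le p ((- d) \<cdot>\<^sub>m 1\<^sub>m p) A"
    using form_boundD[OF d] by (auto simp: loewner_le_def abs_le_iff form_smult[where p = p] minus_le_iff)
  then have "mat_trace (A * B) \<le> d * mat_trace B" "- d * mat_trace B \<le> mat_trace (A * B)"
    using mat_trace_mult_mono[OF A symmetric_smult[OF symmetric_one] _ B]
      mat_trace_mult_mono[OF symmetric_smult[OF symmetric_one] A _ B] by (metis scaled)+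
  then show ?thesis by (simp add: abs_le_iff)
qed

lemma frobenius_norm_le:
  assumes A: "A \<in> carrier_mat p p" and b: "0 \<le> b"
    and columns: "\<And>e. e \<in> unit_sphere p \<Longrightarrow> euclid_norm (A *\<^sub>v e) \<le> b"
  shows "frobenius_norm A \<le> b * sqrt (real p)"
proof -
  have "(\<Sum>i<p. (A $$ (i, j))\<^sup>2) \<le> b\<^sup>2" if j: "j < p" for j
  proof -
    let ?Ae = "A *\<^sub>v unit_vec p j"
    have "?Ae \<bullet> ?Ae \<le> b\<^sup>2"
      unfolding euclid_norm_square[symmetric] by (intro power_mono columns unit_vec_in_unit_sphere j) simp
    moreover have "?Ae \<bullet> ?Ae = (\<Sum>i<p. (A $$ (i, j))\<^sup>2)"
      using A j by (subst scalar_prod_self_sum[where p = p]) auto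
    ultimately show ?thesis by simp
  qed
  then have "(\<Sum>j<p. \<Sum>i<p. (A $$ (i, j))\<^sup>2) \<le> (\<Sum>j<p. b\<^sup>2)" by (intro sum_mono) auto
  also have "(\<Sum>j<p. \<Sum>i<p. (A $$ (i, j))\<^sup>2) = (\<Sum>i<p. \<Sum>j<p. (A $$ (i, j))\<^sup>2)" by (rule sum.swap)
  finally have "(\<Sum>i<p. \<Sum>j<p. (A $$ (i, j))\<^sup>2) \<le> real p * b\<^sup>2" by simp
  then have "frobenius_norm A \<le> sqrt (real p * b\<^sup>2)"
    using A by (auto simp: frobenius_norm_def)
  also have "\<dots> = b * sqrt (real p)" using b by (simp add: real_sqrt_mult)
  finally show ?thesis .
qed

section \<open>Weighted scatter matrices and Tyler's map\<close>

definition scatter :: "nat \<Rightarrow> nat \<Rightarrow> (nat \<Rightarrow> rvec) \<Rightarrow> (nat \<Rightarrow> real) \<Rightarrow> rmat" where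
  "scatter p n x w = Matrix.mat p p (\<lambda>(a, b). real p / real n * (\<Sum>i<n. x i $ a * x i $ b * w i))"

definition tyler_map :: "nat \<Rightarrow> nat \<Rightarrow> (nat \<Rightarrow> rvec) \<Rightarrow> rmat \<Rightarrow> rmat" where
  "tyler_map p n x S = scatter p n x (\<lambda>i. 1 / (x i \<bullet> (mat_inv S *\<^sub>v x i)))"

lemma tyler_solution_iff:
  "tyler_solution p n x S \<longleftrightarrow> pos_def p S \<and> mat_trace S = real p \<and> tyler_map p n x S = S"
  by (auto simp: tyler_solution_def tyler_map_def scatter_def)

lemma scatter_carrier [simp]: "scatter p n x w \<in> carrier_mat p p"
  by (simp add: scatter_def)

lemma scatter_symmetric: "symmetric p (scatter p n x w)"
  by (rule symmetricI) (auto simp: scatter_def mult.commute)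

lemma tyler_map_symmetric: "symmetric p (tyler_map p n x S)"
  by (simp add: tyler_map_def scatter_symmetric)

lemma scatter_minus: "scatter p n x w - scatter p n x w' = scatter p n x (\<lambda>i. w i - w' i)"
  by (intro eq_matI) (auto simp: scatter_def right_diff_distrib sum_subtractf)

lemma scatter_cong: "(\<And>i. i < n \<Longrightarrow> w i = w' i) \<Longrightarrow> scatter p n x w = scatter p n x w'"
  by (intro eq_matI) (auto simp: scatter_def intro!: sum.cong)

lemma scatter_smult_vec:
  assumes "\<And>i. i < n \<Longrightarrow> x i \<in> carrier_vec p"
  shows "scatter p n (\<lambda>i. u i \<cdot>\<^sub>v x i) w = scatter p n x (\<lambda>i. (u i)\<^sup>2 * w i)"
  using carrier_vecD[OF assms]
  by (intro eq_matI) (auto simp: scatter_def power2_eq_square mult_ac intro!: sum.cong)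

lemma scatter_smult_weight: "scatter p n x (\<lambda>i. k * w i) = k \<cdot>\<^sub>m scatter p n x w"
  by (intro eq_matI) (auto simp: scatter_def sum_distrib_left mult_ac)

lemma scatter_form:
  assumes x: "\<And>i. i < n \<Longrightarrow> x i \<in> carrier_vec p" and y: "y \<in> carrier_vec p" and z: "z \<in> carrier_vec p"
  shows "y \<bullet> (scatter p n x w *\<^sub>v z) = real p / real n * (\<Sum>i<n. w i * (x i \<bullet> y) * (x i \<bullet> z))"
proof -
  have "y \<bullet> (scatter p n x w *\<^sub>v z) =
      real p / real n * (\<Sum>a<p. \<Sum>b<p. \<Sum>i<n. w i * (x i $ a * y $ a) * (x i $ b * z $ b))"
    unfolding form_entries[OF scatter_carrier y z] sum_distrib_left
    by (intro sum.cong refl) (simp add: scatter_def sum_distrib_left sum_distrib_right mult_ac)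
  also have "(\<Sum>a<p. \<Sum>b<p. \<Sum>i<n. w i * (x i $ a * y $ a) * (x i $ b * z $ b)) =
      (\<Sum>a<p. \<Sum>i<n. \<Sum>b<p. w i * (x i $ a * y $ a) * (x i $ b * z $ b))"
    by (intro sum.cong refl sum.swap)
  also have "\<dots> = (\<Sum>i<n. \<Sum>a<p. \<Sum>b<p. w i * (x i $ a * y $ a) * (x i $ b * z $ b))"
    by (rule sum.swap)
  also have "\<dots> = (\<Sum>i<n. w i * (x i \<bullet> y) * (x i \<bullet> z))"
    by (simp add: scalar_prod_sum[OF y] scalar_prod_sum[OF z] sum_distrib_left sum_distrib_right mult_ac)
  finally show ?thesis .
qed

lemma scatter_quadratic_form:
  assumes "\<And>i. i < n \<Longrightarrow> x i \<in> carrier_vec p" "y \<in> carrier_vec p"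
  shows "y \<bullet> (scatter p n x w *\<^sub>v y) = real p / real n * (\<Sum>i<n. w i * (x i \<bullet> y)\<^sup>2)"
  using scatter_form[where n = n and x = x, OF assms(1,2,2), where w = w] by (simp add: power2_eq_square mult.assoc)

lemma mat_trace_scatter_mult:
  assumes x: "\<And>i. i < n \<Longrightarrow> x i \<in> carrier_vec p" and A: "symmetric p A"
  shows "mat_trace (scatter p n x w * A) = real p / real n * (\<Sum>i<n. w i * (x i \<bullet> (A *\<^sub>v x i)))"
proof -
  let ?M = "scatter p n x w" and ?e = "\<lambda>j. unit_vec p j :: rvec"
  note A_carrier = symmetric_carrier[OF A]
  have entry: "?e j \<bullet> ((?M * A) *\<^sub>v ?e j) = real p / real n * (\<Sum>i<n. w i * (x i $ j * (A *\<^sub>v x i) $ j))"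
    if j: "j < p" for j
  proof -
    have xAe: "x i \<bullet> ?e j = x i $ j" "x i \<bullet> (A *\<^sub>v ?e j) = (A *\<^sub>v x i) $ j" if "i < n" for i
      using j A_carrier x[OF that] form_symmetric[OF A x[OF that], of "?e j"] by simp_all
    have "?e j \<bullet> ((?M * A) *\<^sub>v ?e j) = ?e j \<bullet> (?M *\<^sub>v (A *\<^sub>v ?e j))"
      by (subst assoc_mult_mat_vec[OF scatter_carrier A_carrier]) auto
    also have "\<dots> = real p / real n * (\<Sum>i<n. w i * (x i \<bullet> ?e j) * (x i \<bullet> (A *\<^sub>v ?e j)))"
      by (rule scatter_form) (use x A_carrier in auto)
    also have "\<dots> = real p / real n * (\<Sum>i<n. w i * (x i $ j * (A *\<^sub>v x i) $ j))"
      by (intro arg_cong[where f = "\<lambda>s. real p / real n * s"] sum.cong refl) (simp only: xAe lessThan_iff mult.assoc)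
    finally show ?thesis .
  qed
  have "mat_trace (?M * A) = (\<Sum>j<p. real p / real n * (\<Sum>i<n. w i * (x i $ j * (A *\<^sub>v x i) $ j)))"
    unfolding mat_trace_form[OF mult_carrier_mat[OF scatter_carrier A_carrier]]
    by (intro sum.cong refl entry) simp
  also have "\<dots> = real p / real n * (\<Sum>i<n. \<Sum>j<p. w i * (x i $ j * (A *\<^sub>v x i) $ j))"
    by (subst sum.swap) (simp add: sum_distrib_left)
  also have "(\<Sum>i<n. \<Sum>j<p. w i * (x i $ j * (A *\<^sub>v x i) $ j)) = (\<Sum>i<n. w i * (x i \<bullet> (A *\<^sub>v x i)))"
    using x A_carrier by (intro sum.cong refl) (simp add: scalar_prod_sum[where p = p] sum_distrib_left)
  finally show ?thesis .
qed

lemma mat_trace_scatter: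
  assumes "\<And>i. i < n \<Longrightarrow> x i \<in> carrier_vec p"
  shows "mat_trace (scatter p n x w) = real p / real n * (\<Sum>i<n. w i * (x i \<bullet> x i))"
  using mat_trace_scatter_mult[where n = n and x = x, OF assms symmetric_one, where w = w] assms
  by (simp add: right_mult_one_mat[OF scatter_carrier])

lemma scatter_conjugate:
  assumes x: "\<And>i. i < n \<Longrightarrow> x i \<in> carrier_vec p" and R: "symmetric p R"
  shows "R * scatter p n x w * R = scatter p n (\<lambda>i. R *\<^sub>v x i) w"
proof (rule eq_matI)
  note R_carrier = symmetric_carrier[OF R]
  let ?M = "scatter p n x w"
  fix a b assume "a < dim_row (scatter p n (\<lambda>i. R *\<^sub>v x i) w)" "b < dim_col (scatter p n (\<lambda>i. R *\<^sub>v x i) w)"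
  then have ab: "a < p" "b < p" by (auto simp: scatter_def)
  let ?e = "\<lambda>k. unit_vec p k :: rvec"
  have Re: "R *\<^sub>v ?e k \<in> carrier_vec p" for k using R_carrier by auto
  have xRe: "x i \<bullet> (R *\<^sub>v ?e k) = (R *\<^sub>v x i) $ k" if "i < n" "k < p" for i k
    using form_symmetric[OF R x[OF that(1)], of "?e k"] that R_carrier x[OF that(1)] by simp
  have "(R * ?M * R) $$ (a, b) = ?e a \<bullet> ((R * ?M * R) *\<^sub>v ?e b)"
    by (rule form_unit_vec[symmetric]) (use R_carrier ab in auto)
  also have "\<dots> = (R *\<^sub>v ?e a) \<bullet> (?M *\<^sub>v (R *\<^sub>v ?e b))"
    by (rule form_conjugate[OF R]) auto
  also have "\<dots> = real p / real n * (\<Sum>i<n. w i * (x i \<bullet> (R *\<^sub>v ?e a)) * (x i \<bullet> (R *\<^sub>v ?e b)))"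
    by (rule scatter_form) (use x Re in auto)
  also have "\<dots> = scatter p n (\<lambda>i. R *\<^sub>v x i) w $$ (a, b)"
    using ab xRe by (simp add: scatter_def mult_ac)
  finally show "(R * ?M * R) $$ (a, b) = scatter p n (\<lambda>i. R *\<^sub>v x i) w $$ (a, b)" .
qed (use symmetric_carrier[OF R] in \<open>auto simp: scatter_def\<close>)

lemma tyler_map_equivariant:
  assumes R: "pos_def p R" and S: "pos_def p S" and s: "s \<noteq> 0"
    and x: "\<And>i. i < n \<Longrightarrow> x i \<in> carrier_vec p" and u: "\<And>i. i < n \<Longrightarrow> u i \<noteq> 0"
  shows "tyler_map p n (\<lambda>i. u i \<cdot>\<^sub>v (R *\<^sub>v x i)) (s \<cdot>\<^sub>m (R * S * R)) = s \<cdot>\<^sub>m (R * tyler_map p n x S * R)"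
proof -
  note R_carrier = pos_def_carrier[OF R] and inv_R = pos_def_mat_inv[OF R] and inv_S = pos_def_mat_inv[OF S]
  let ?z = "\<lambda>i. u i \<cdot>\<^sub>v (R *\<^sub>v x i)" and ?K = "mat_inv R * mat_inv S * mat_inv R"
  have K_carrier: "?K \<in> carrier_mat p p" using pos_def_carrier[OF inv_R] pos_def_carrier[OF inv_S] by simp
  note inv = mat_inv_scaled_conjugate[OF R S s]
  have form: "?z i \<bullet> (mat_inv (s \<cdot>\<^sub>m (R * S * R)) *\<^sub>v ?z i) = (1 / s) * ((u i)\<^sup>2 * (x i \<bullet> (mat_inv S *\<^sub>v x i)))"
    if i: "i < n" for i
  proof -
    have Rx: "R *\<^sub>v x i \<in> carrier_vec p" using R_carrier x[OF i] by simp
    have "(R *\<^sub>v x i) \<bullet> (?K *\<^sub>v (R *\<^sub>v x i)) = x i \<bullet> (mat_inv S *\<^sub>v x i)"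
      using form_conjugate[OF pos_def_symmetric[OF inv_R] pos_def_carrier[OF inv_S] Rx Rx]
        pos_def_mat_inv_vec(3)[OF R x[OF i]] by simp
    then show ?thesis
      using Rx K_carrier
      by (simp add: inv form_smult[where p = p] mult_mat_vec[OF K_carrier Rx] power2_eq_square del: assoc_mult_mat)
  qed
  have "tyler_map p n ?z (s \<cdot>\<^sub>m (R * S * R)) =
      scatter p n (\<lambda>i. R *\<^sub>v x i) (\<lambda>i. (u i)\<^sup>2 * (1 / ((1 / s) * ((u i)\<^sup>2 * (x i \<bullet> (mat_inv S *\<^sub>v x i))))))"
    unfolding tyler_map_def by (subst scatter_smult_vec) (use x R_carrier form in \<open>auto intro!: scatter_cong\<close>)
  also have "\<dots> = scatter p n (\<lambda>i. R *\<^sub>v x i) (\<lambda>i. s * (1 / (x i \<bullet> (mat_inv S *\<^sub>v x i))))"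
    using u s by (intro scatter_cong) simp
  also have "\<dots> = s \<cdot>\<^sub>m (R * tyler_map p n x S * R)"
    unfolding tyler_map_def scatter_smult_weight
    by (subst scatter_conjugate[OF x pos_def_symmetric[OF R]]) auto
  finally show ?thesis .
qed

section \<open>Matrices near the identity\<close>

lemma form_ball_one_lower:
  assumes S: "S \<in> form_ball p (1\<^sub>m p) d" and x: "x \<in> carrier_vec p"
  shows "(1 - d) * (x \<bullet> x) \<le> x \<bullet> (S *\<^sub>v x)"
  using form_boundD[OF form_ballD(3)[OF S] x] form_ballD(2)[OF S] x
  by (simp add: scalar_prod_minus_distrib[where n = p] abs_le_iff algebra_simps)

lemma form_ball_one_pos_def:
  assumes S: "S \<in> form_ball p (1\<^sub>m p) d" and d: "d < 1"
  shows "pos_def p S"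
proof (rule pos_defI)
  show "symmetric p S" by (rule form_ballD(1)[OF S])
  fix x :: rvec assume x: "x \<in> carrier_vec p" "x \<noteq> 0\<^sub>v p"
  have "0 < (1 - d) * (x \<bullet> x)" using d scalar_prod_self_pos[OF x] by simp
  with form_ball_one_lower[OF S x(1)] show "0 < x \<bullet> (S *\<^sub>v x)" by linarith
qed

lemma form_ball_one_mat_inv:
  assumes S: "S \<in> form_ball p (1\<^sub>m p) d" and d: "0 \<le> d" "d < 1" and v: "v \<in> unit_sphere p"
  shows "euclid_norm (mat_inv S *\<^sub>v v) \<le> 1 / (1 - d)"
    and "euclid_norm (v - mat_inv S *\<^sub>v v) \<le> d / (1 - d)"
    and "(1 - 2 * d) / (1 - d) \<le> v \<bullet> (mat_inv S *\<^sub>v v)"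
proof -
  let ?y = "mat_inv S *\<^sub>v v"
  note v = unit_sphereD[OF v] and S_carrier = form_ballD(2)[OF S]
  note y = pos_def_mat_inv_vec[OF form_ball_one_pos_def[OF S d(2)] v(1)]
  have "(1 - d) * (euclid_norm ?y)\<^sup>2 \<le> ?y \<bullet> v"
    using form_ball_one_lower[OF S y(1)] y by (simp add: euclid_norm_square)
  also have "\<dots> \<le> euclid_norm ?y * 1" using abs_scalar_prod_le[OF y(1) v(1)] v(3) by simp
  finally have "euclid_norm ?y * ((1 - d) * euclid_norm ?y) \<le> euclid_norm ?y * 1"
    by (simp add: power2_eq_square mult_ac)
  then have "(1 - d) * euclid_norm ?y \<le> 1"
    using euclid_norm_nonneg[of ?y] by (cases "euclid_norm ?y = 0") (auto dest: mult_left_le_imp_le)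
  then show norm_y: "euclid_norm ?y \<le> 1 / (1 - d)" using d by (simp add: field_simps)
  have "v - ?y = (S - 1\<^sub>m p) *\<^sub>v ?y"
    using minus_mult_distrib_mat_vec[OF S_carrier one_carrier_mat y(1)] y by simp
  then have "euclid_norm (v - ?y) \<le> d * euclid_norm ?y"
    using form_bound_norm_mult_vec[OF symmetric_minus[OF form_ballD(1)[OF S] symmetric_one] form_ballD(3)[OF S] y(1)]
    by simp
  also have "\<dots> \<le> d * (1 / (1 - d))" using norm_y d by (intro mult_left_mono) auto
  finally show norm_diff: "euclid_norm (v - ?y) \<le> d / (1 - d)" by simp
  have "v \<bullet> (v - ?y) = 1 - v \<bullet> ?y" using v y by (simp add: scalar_prod_minus_distrib[where n = p])
  moreover have "v \<bullet> (v - ?y) \<le> euclid_norm (v - ?y)"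
    using abs_scalar_prod_le[OF v(1), of "v - ?y"] v y by simp
  ultimately have "1 - d / (1 - d) \<le> v \<bullet> ?y" using norm_diff by linarith
  then show "(1 - 2 * d) / (1 - d) \<le> v \<bullet> ?y" using d by (simp add: field_simps)
qed

lemma inverse_form_diff:
  assumes S: "pos_def p S" and S': "pos_def p S'" and v: "v \<in> carrier_vec p" "v \<noteq> 0\<^sub>v p"
  defines "u \<equiv> \<lambda>S. (1 / (v \<bullet> (mat_inv S *\<^sub>v v))) \<cdot>\<^sub>v (mat_inv S *\<^sub>v v)"
  shows "1 / (v \<bullet> (mat_inv S *\<^sub>v v)) - 1 / (v \<bullet> (mat_inv S' *\<^sub>v v)) = u S' \<bullet> ((S - S') *\<^sub>v u S)"
proof -
  let ?y = "mat_inv S *\<^sub>v v" and ?y' = "mat_inv S' *\<^sub>v v"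
  note y = pos_def_mat_inv_vec(1,2)[OF S v(1)] and y' = pos_def_mat_inv_vec(1,2)[OF S' v(1)]
  note carriers = pos_def_carrier[OF S] pos_def_carrier[OF S']
  have diff_carrier: "S - S' \<in> carrier_mat p p" using carriers by simp
  have pos: "0 < v \<bullet> ?y" "0 < v \<bullet> ?y'"
    using pos_def_pos[OF pos_def_mat_inv[OF S] v] pos_def_pos[OF pos_def_mat_inv[OF S'] v] by auto
  have "?y' \<bullet> ((S - S') *\<^sub>v ?y) = v \<bullet> ?y' - v \<bullet> ?y"
    using y y' carriers form_symmetric[OF pos_def_symmetric[OF S'] y'(1) y(1)] comm_scalar_prod[OF v(1) y'(1)]
    by (simp add: form_minus[where p = p])
  moreover have "u S' \<bullet> ((S - S') *\<^sub>v u S) = (1 / (v \<bullet> ?y')) * ((1 / (v \<bullet> ?y)) * (?y' \<bullet> ((S - S') *\<^sub>v ?y)))"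
    using y(1) y'(1) diff_carrier by (simp add: u_def mult_mat_vec[OF diff_carrier y(1)])
  ultimately show ?thesis using pos by (simp add: field_simps)
qed

lemma form_ball_one_normalized_mat_inv:
  assumes S: "S \<in> form_ball p (1\<^sub>m p) d" and d: "0 \<le> d" "d \<le> 1 / 4" and v: "v \<in> unit_sphere p"
  shows "euclid_norm ((1 / (v \<bullet> (mat_inv S *\<^sub>v v))) \<cdot>\<^sub>v (mat_inv S *\<^sub>v v) - v) \<le> 2 * d"
proof -
  let ?y = "mat_inv S *\<^sub>v v" and ?q = "v \<bullet> (mat_inv S *\<^sub>v v)"
  have d1: "d < 1" using d by simp
  note near = form_ball_one_mat_inv[OF S d(1) d1 v] and v = unit_sphereD[OF v]
  note y = pos_def_mat_inv_vec(1)[OF form_ball_one_pos_def[OF S d1] v(1)]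
  have "0 < (1 - 2 * d) / (1 - d)" using d by simp
  with near(3) have q: "0 < ?q" by linarith
  note bilinear = scalar_prod_minus_distrib[where n = p] minus_scalar_prod_distrib[where n = p] comm_scalar_prod[OF y v(1)]
  have "(?y - ?q \<cdot>\<^sub>v v) \<bullet> (?y - ?q \<cdot>\<^sub>v v) + (?q - 1)\<^sup>2 = (v - ?y) \<bullet> (v - ?y)"
    using v y by (simp add: bilinear power2_eq_square algebra_simps)
  then have "(?y - ?q \<cdot>\<^sub>v v) \<bullet> (?y - ?q \<cdot>\<^sub>v v) \<le> (v - ?y) \<bullet> (v - ?y)"
    using zero_le_power2[of "?q - 1"] by linarith
  then have projection: "euclid_norm (?y - ?q \<cdot>\<^sub>v v) \<le> d / (1 - d)"
    using near(2) by (simp add: euclid_norm_def) (meson order_trans real_sqrt_le_mono)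
  have "(1 / ?q) \<cdot>\<^sub>v ?y - v = (1 / ?q) \<cdot>\<^sub>v (?y - ?q \<cdot>\<^sub>v v)"
    using q v carrier_matD[OF pos_def_mat_inv_mult(1)[OF form_ball_one_pos_def[OF S d1]]]
    by (intro eq_vecI) (auto simp: field_simps)
  then have "euclid_norm ((1 / ?q) \<cdot>\<^sub>v ?y - v) = 1 / ?q * euclid_norm (?y - ?q \<cdot>\<^sub>v v)"
    using q by (simp add: euclid_norm_smult)
  also have "\<dots> \<le> (1 - d) / (1 - 2 * d) * (d / (1 - d))"
    using near(3) q d projection by (intro mult_mono) (auto simp: field_simps)
  also have "\<dots> = d / (1 - 2 * d)" using d by simp
  also have "\<dots> \<le> 2 * d"
    using d mult_left_mono[of d "1 / 4" d] by (simp add: field_simps power2_eq_square)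
  finally show ?thesis .
qed

lemma inverse_form_expansion:
  assumes S: "S \<in> form_ball p (1\<^sub>m p) d" and S': "S' \<in> form_ball p (1\<^sub>m p) d"
    and d: "0 \<le> d" "d \<le> 1 / 4" and \<eta>: "form_bound p (S - S') \<eta>" "0 \<le> \<eta>" and v: "v \<in> unit_sphere p"
  shows "\<bar>1 / (v \<bullet> (mat_inv S *\<^sub>v v)) - 1 / (v \<bullet> (mat_inv S' *\<^sub>v v)) - v \<bullet> ((S - S') *\<^sub>v v)\<bar> \<le> 5 * d * \<eta>"
proof -
  define u where "u S = (1 / (v \<bullet> (mat_inv S *\<^sub>v v))) \<cdot>\<^sub>v (mat_inv S *\<^sub>v v)" for S
  let ?E = "S - S'"
  note E = symmetric_minus[OF form_ballD(1)[OF S] form_ballD(1)[OF S']]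
  note E_carrier = symmetric_carrier[OF E]
  have pd: "pos_def p S" "pos_def p S'"
    using form_ball_one_pos_def[OF S] form_ball_one_pos_def[OF S'] d by auto
  have near: "euclid_norm (u S - v) \<le> 2 * d" "euclid_norm (u S' - v) \<le> 2 * d"
    using form_ball_one_normalized_mat_inv[OF S d v] form_ball_one_normalized_mat_inv[OF S' d v] by (auto simp: u_def)
  note v = unit_sphereD[OF v]
  have u: "u S \<in> carrier_vec p" "u S' \<in> carrier_vec p"
    using pos_def_mat_inv_vec(1)[OF pd(1) v(1)] pos_def_mat_inv_vec(1)[OF pd(2) v(1)] by (auto simp: u_def)
  then have uv: "u S - v \<in> carrier_vec p" "u S' - v \<in> carrier_vec p" using v by auto
  have "1 / (v \<bullet> (mat_inv S *\<^sub>v v)) - 1 / (v \<bullet> (mat_inv S' *\<^sub>v v)) = u S' \<bullet> (?E *\<^sub>v u S)"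
    unfolding u_def by (rule inverse_form_diff[OF pd v(1,4)])
  moreover have "u S' \<bullet> (?E *\<^sub>v u S) - v \<bullet> (?E *\<^sub>v v) = (u S' - v) \<bullet> (?E *\<^sub>v u S) + v \<bullet> (?E *\<^sub>v (u S - v))"
    using u v E_carrier
    by (simp add: mult_minus_distrib_mat_vec[OF E_carrier] scalar_prod_minus_distrib[where n = p]
        minus_scalar_prod_distrib[where n = p])
  moreover have "\<bar>(u S' - v) \<bullet> (?E *\<^sub>v u S)\<bar> \<le> \<eta> * (2 * d) * (3 / 2)"
  proof -
    have "euclid_norm (u S) \<le> 3 / 2"
      using euclid_norm_le_add_minus[OF u(1) v(1)] near(1) v(3) d by simp
    then have "\<eta> * euclid_norm (u S' - v) * euclid_norm (u S) \<le> \<eta> * (2 * d) * (3 / 2)"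
      using near(2) \<eta>(2) d by (intro mult_mono) auto
    then show ?thesis using form_bound_bilinear[OF E \<eta>(1) uv(2) u(1)] by linarith
  qed
  moreover have "\<bar>v \<bullet> (?E *\<^sub>v (u S - v))\<bar> \<le> \<eta> * (2 * d)"
    using form_bound_bilinear[OF E \<eta>(1) v(1) uv(1)] v(3) mult_left_mono[OF near(1) \<eta>(2)] by simp
  ultimately show ?thesis by (simp add: abs_le_iff algebra_simps)
qed

section \<open>A fixed point of Tyler's map near the identity\<close>

lemma mat_trace_tyler_map_mat_inv:
  assumes S: "pos_def p S" and n: "0 < n" and x: "\<And>i. i < n \<Longrightarrow> x i \<in> carrier_vec p"
    and nonzero: "\<And>i. i < n \<Longrightarrow> x i \<noteq> 0\<^sub>v p"
  shows "mat_trace (tyler_map p n x S * mat_inv S) = real p"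
proof -
  note inv = pos_def_mat_inv[OF S]
  let ?q = "\<lambda>i. x i \<bullet> (mat_inv S *\<^sub>v x i)"
  have "mat_trace (tyler_map p n x S * mat_inv S) = real p / real n * (\<Sum>i<n. 1 / ?q i * ?q i)"
    unfolding tyler_map_def by (rule mat_trace_scatter_mult[OF x pos_def_symmetric[OF inv]])
  also have "(\<Sum>i<n. 1 / ?q i * ?q i) = (\<Sum>i<n. 1)"
    using pos_def_pos[OF inv x nonzero] by (intro sum.cong refl) (simp add: less_imp_neq[symmetric])
  finally show ?thesis using n by simp
qed

lemma tyler_map_shift_eq_0:
  assumes S: "pos_def p S" and p: "1 \<le> p" and n: "0 < n" and x: "\<And>i. i < n \<Longrightarrow> x i \<in> carrier_vec p"
    and nonzero: "\<And>i. i < n \<Longrightarrow> x i \<noteq> 0\<^sub>v p" and shift: "tyler_map p n x S = S + \<tau> \<cdot>\<^sub>m 1\<^sub>m p"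
  shows "\<tau> = 0"
proof -
  note S_carrier = pos_def_carrier[OF S] and inv = pos_def_mat_inv_mult[OF S]
  have "tyler_map p n x S * mat_inv S = 1\<^sub>m p + \<tau> \<cdot>\<^sub>m mat_inv S"
    unfolding shift using inv S_carrier add_mult_distrib_mat[OF S_carrier _ inv(1), of "\<tau> \<cdot>\<^sub>m 1\<^sub>m p"]
      mult_smult_assoc_mat[OF one_carrier_mat inv(1), of \<tau>] by simp
  then have "real p = real p + \<tau> * mat_trace (mat_inv S)"
    using inv(1) mat_trace_tyler_map_mat_inv[where n = n and x = x, OF S n x nonzero]
    by (simp add: mat_trace_add[where p = p] mat_trace_smult[where p = p] mat_trace_one)
  then show ?thesis using mat_trace_pos[OF pos_def_mat_inv[OF S] p] by simp
qed

definition two_hyperplanes_cover :: "nat \<Rightarrow> nat \<Rightarrow> (nat \<Rightarrow> rvec) \<Rightarrow> bool" where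
  "two_hyperplanes_cover p n x \<longleftrightarrow> (\<exists>e f. e \<in> carrier_vec p \<and> e \<noteq> 0\<^sub>v p \<and> f \<in> carrier_vec p \<and> f \<noteq> 0\<^sub>v p \<and>
     (\<forall>i<n. x i \<bullet> e = 0 \<or> x i \<bullet> f = 0))"

locale well_spread_sample =
  fixes p n :: nat and v :: "nat \<Rightarrow> rvec" and c t :: real
  assumes p: "1 \<le> p" and n: "0 < n" and c: "0 < c" "c \<le> 1"
    and unit: "\<And>i. i < n \<Longrightarrow> v i \<in> unit_sphere p"
    and isotropic: "form_bound p (scatter p n v (\<lambda>_. 1) - 1\<^sub>m p) t"
    and spread: "\<And>e f. e \<in> carrier_vec p \<Longrightarrow> f \<in> carrier_vec p \<Longrightarrow>
      c / real p * (e \<bullet> e) * (f \<bullet> f) \<le> real p / real n * (\<Sum>i<n. (v i \<bullet> e)\<^sup>2 * (v i \<bullet> f)\<^sup>2)"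
begin

abbreviation M :: rmat where
  "M \<equiv> scatter p n v (\<lambda>_. 1)"

abbreviation T :: "rmat \<Rightarrow> rmat" where
  "T \<equiv> tyler_map p n v"

definition recentred :: "rmat \<Rightarrow> rmat" where
  "recentred S = T S - (mat_trace (T S) / real p - 1) \<cdot>\<^sub>m 1\<^sub>m p"

lemmas sample_carrier = unit_sphereD(1)[OF unit]

lemma not_two_hyperplanes_cover: "\<not> two_hyperplanes_cover p n v"
proof
  assume "two_hyperplanes_cover p n v"
  then obtain e f where e: "e \<in> carrier_vec p" "e \<noteq> 0\<^sub>v p" and f: "f \<in> carrier_vec p" "f \<noteq> 0\<^sub>v p"
    and cover: "\<And>i. i < n \<Longrightarrow> v i \<bullet> e = 0 \<or> v i \<bullet> f = 0"
    by (auto simp: two_hyperplanes_cover_def)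
  have "0 < c / real p * (e \<bullet> e) * (f \<bullet> f)"
    using scalar_prod_self_pos[OF e] scalar_prod_self_pos[OF f] c p by simp
  also have "\<dots> \<le> real p / real n * (\<Sum>i<n. (v i \<bullet> e)\<^sup>2 * (v i \<bullet> f)\<^sup>2)" by (rule spread[OF e(1) f(1)])
  also have "\<dots> = 0" using cover by (auto intro!: sum.neutral)
  finally show False by simp
qed

lemma isotropy_nonneg: "0 \<le> t"
  using form_bound_self_nonneg[OF isotropic, of "unit_vec p 0"] p by simp

lemma mat_trace_sample_scatter: "mat_trace (scatter p n v w) = real p / real n * (\<Sum>i<n. w i)"
  using mat_trace_scatter[where n = n and x = v, OF sample_carrier, where w = w] unit_sphereD(2)[OF unit] by simp

lemma sample_scatter_form:
  "f \<in> carrier_vec p \<Longrightarrow> f \<bullet> (scatter p n v w *\<^sub>v f) = real p / real n * (\<Sum>i<n. w i * (v i \<bullet> f)\<^sup>2)"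
  by (rule scatter_quadratic_form) (auto intro: sample_carrier)

lemma mat_trace_sample_scatter_mult:
  "symmetric p A \<Longrightarrow> mat_trace (scatter p n v w * A) = real p / real n * (\<Sum>i<n. w i * (v i \<bullet> (A *\<^sub>v v i)))"
  by (rule mat_trace_scatter_mult) (auto intro: sample_carrier)

lemma isotropic_trace:
  assumes B: "psd p B"
  shows "(1 - t) * mat_trace B \<le> real p / real n * (\<Sum>i<n. v i \<bullet> (B *\<^sub>v v i))"
proof -
  note B_carrier = symmetric_carrier[OF psd_symmetric[OF B]]
  have "\<bar>mat_trace ((M - 1\<^sub>m p) * B)\<bar> \<le> t * mat_trace B"
    by (rule mat_trace_mult_form_bound[OF symmetric_minus[OF scatter_symmetric symmetric_one] isotropic B])
  moreover have "mat_trace ((M - 1\<^sub>m p) * B) = mat_trace (M * B) - mat_trace B"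
    using minus_mult_distrib_mat[OF scatter_carrier one_carrier_mat B_carrier] B_carrier
      mat_trace_minus[OF mult_carrier_mat[OF scatter_carrier B_carrier] B_carrier] by simp
  moreover have "mat_trace (M * B) = real p / real n * (\<Sum>i<n. v i \<bullet> (B *\<^sub>v v i))"
    by (simp add: mat_trace_sample_scatter_mult[OF psd_symmetric[OF B]])
  ultimately show ?thesis by (simp add: algebra_simps abs_le_iff)
qed

lemma spread_trace:
  assumes B: "psd p B" and f: "f \<in> carrier_vec p"
  shows "c / real p * (f \<bullet> f) * mat_trace B \<le> real p / real n * (\<Sum>i<n. (v i \<bullet> f)\<^sup>2 * (v i \<bullet> (B *\<^sub>v v i)))"
proof -
  note B_carrier = symmetric_carrier[OF psd_symmetric[OF B]]
  let ?k = "c / real p * (f \<bullet> f)" and ?F = "scatter p n v (\<lambda>i. (v i \<bullet> f)\<^sup>2)"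
  have "loewner_le p (?k \<cdot>\<^sub>m 1\<^sub>m p) ?F"
    unfolding loewner_le_def
  proof
    fix e :: rvec assume e: "e \<in> carrier_vec p"
    show "e \<bullet> ((?k \<cdot>\<^sub>m 1\<^sub>m p) *\<^sub>v e) \<le> e \<bullet> (?F *\<^sub>v e)"
      using spread[OF f e] e by (simp add: sample_scatter_form form_smult[where p = p])
  qed
  then have "mat_trace ((?k \<cdot>\<^sub>m 1\<^sub>m p) * B) \<le> mat_trace (?F * B)"
    by (rule mat_trace_mult_mono[OF symmetric_smult[OF symmetric_one] scatter_symmetric _ B])
  moreover have "mat_trace ((?k \<cdot>\<^sub>m 1\<^sub>m p) * B) = ?k * mat_trace B"
    using B_carrier mult_smult_assoc_mat[OF one_carrier_mat B_carrier, of ?k] by (simp add: mat_trace_smult[where p = p])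
  ultimately show ?thesis by (simp add: mat_trace_sample_scatter_mult[OF psd_symmetric[OF B]])
qed

text \<open>
  Both estimates use the first order expansion of \<open>T S - T S'\<close>, with \<open>S - S'\<close> written as \<open>\<eta> I - B\<close>
  for a positive semidefinite \<open>B\<close> of trace \<open>\<eta> p\<close>.
\<close>

lemma tyler_map_diff_upper:
  assumes S: "S \<in> form_ball p (1\<^sub>m p) d" and S': "S' \<in> form_ball p (1\<^sub>m p) d" and trace: "mat_trace S = mat_trace S'"
    and d: "0 \<le> d" "d \<le> 1 / 4" and \<eta>: "form_bound p (S - S') \<eta>" "0 \<le> \<eta>"
  shows "mat_trace (T S - T S') \<le> \<eta> * (t + 5 * d) * real p"
    and "f \<in> carrier_vec p \<Longrightarrow> f \<bullet> ((T S - T S') *\<^sub>v f) \<le> \<eta> * ((1 + 5 * d) * (1 + t) - c) * (f \<bullet> f)"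
proof -
  define B where "B = \<eta> \<cdot>\<^sub>m 1\<^sub>m p - (S - S')"
  define w where "w i = 1 / (v i \<bullet> (mat_inv S *\<^sub>v v i)) - 1 / (v i \<bullet> (mat_inv S' *\<^sub>v v i))" for i
  note carriers = form_ballD(2)[OF S] form_ballD(2)[OF S']
  have diff_carrier: "S - S' \<in> carrier_mat p p" using carriers by simp
  have "loewner_le p (S - S') (\<eta> \<cdot>\<^sub>m 1\<^sub>m p)"
    using form_boundD[OF \<eta>(1)] by (auto simp: loewner_le_def abs_le_iff form_smult[where p = p])
  then have B: "psd p B"
    unfolding B_def by (intro psd_minus_if_loewner_le symmetric_minus symmetric_smult symmetric_one form_ballD(1)[OF S] form_ballD(1)[OF S'])
  have trace_B: "mat_trace B = \<eta> * real p"
    using carriers trace by (simp add: B_def mat_trace_minus[where p = p] mat_trace_smult[where p = p] mat_trace_one)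
  have weight: "w i \<le> \<eta> * (1 + 5 * d) - v i \<bullet> (B *\<^sub>v v i)" if "i < n" for i
    using inverse_form_expansion[OF S S' d \<eta> unit[OF that]] unit_sphereD[OF unit[OF that]] diff_carrier
    by (simp add: w_def B_def form_minus[where p = p] form_smult[where p = p] abs_le_iff algebra_simps)
  have diff: "T S - T S' = scatter p n v w"
    unfolding tyler_map_def scatter_minus w_def ..
  have "mat_trace (T S - T S') \<le> real p / real n * (\<Sum>i<n. \<eta> * (1 + 5 * d) - v i \<bullet> (B *\<^sub>v v i))"
    unfolding diff mat_trace_sample_scatter using weight by (intro mult_left_mono sum_mono) auto
  also have "\<dots> = \<eta> * (1 + 5 * d) * real p - real p / real n * (\<Sum>i<n. v i \<bullet> (B *\<^sub>v v i))"
    using n by (simp add: sum_subtractf field_simps)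
  also have "\<dots> \<le> \<eta> * (t + 5 * d) * real p"
    using isotropic_trace[OF B] by (simp add: trace_B algebra_simps)
  finally show "mat_trace (T S - T S') \<le> \<eta> * (t + 5 * d) * real p" .
  assume f: "f \<in> carrier_vec p"
  have "f \<bullet> ((T S - T S') *\<^sub>v f) \<le>
      real p / real n * (\<Sum>i<n. (\<eta> * (1 + 5 * d) - v i \<bullet> (B *\<^sub>v v i)) * (v i \<bullet> f)\<^sup>2)"
    unfolding diff sample_scatter_form[OF f]
    using weight by (intro mult_left_mono sum_mono mult_right_mono) auto
  also have "\<dots> = \<eta> * (1 + 5 * d) * (f \<bullet> (M *\<^sub>v f)) - real p / real n * (\<Sum>i<n. (v i \<bullet> f)\<^sup>2 * (v i \<bullet> (B *\<^sub>v v i)))"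
    unfolding sample_scatter_form[OF f]
    by (simp add: left_diff_distrib sum_subtractf sum_distrib_left right_diff_distrib mult_ac)
  also have "\<dots> \<le> \<eta> * (1 + 5 * d) * ((1 + t) * (f \<bullet> f)) - c / real p * (f \<bullet> f) * mat_trace B"
    using form_boundD[OF isotropic f] spread_trace[OF B f] f \<eta>(2) d
    by (intro diff_mono mult_left_mono) (auto simp: form_minus[where p = p] abs_le_iff algebra_simps)
  also have "\<dots> = \<eta> * ((1 + 5 * d) * (1 + t) - c) * (f \<bullet> f)"
    using p by (simp add: trace_B field_simps)
  finally show "f \<bullet> ((T S - T S') *\<^sub>v f) \<le> \<eta> * ((1 + 5 * d) * (1 + t) - c) * (f \<bullet> f)" .
qed

lemma recentred_symmetric: "symmetric p (recentred S)"
  unfolding recentred_def by (intro symmetric_minus symmetric_smult symmetric_one tyler_map_symmetric)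

lemma recentred_trace: "mat_trace (recentred S) = real p"
  using symmetric_carrier[OF tyler_map_symmetric] p
  by (simp add: recentred_def mat_trace_minus[where p = p] mat_trace_smult[where p = p] mat_trace_one field_simps)

lemma recentred_one: "recentred (1\<^sub>m p) = M"
proof -
  have "T (1\<^sub>m p) = M"
    unfolding tyler_map_def mat_inv_one by (rule scatter_cong) (use unit_sphereD[OF unit] in simp)
  moreover have "mat_trace M = real p" using n by (simp add: mat_trace_sample_scatter)
  ultimately show ?thesis using p carrier_matD[OF scatter_carrier] by (intro eq_matI) (auto simp: recentred_def)
qed

lemma recentred_diff_upper:
  assumes S: "S \<in> form_ball p (1\<^sub>m p) d" and S': "S' \<in> form_ball p (1\<^sub>m p) d" and trace: "mat_trace S = mat_trace S'"
    and d: "0 \<le> d" "d \<le> c / 80" and t: "t \<le> c / 160" and \<eta>: "form_bound p (S - S') \<eta>" "0 \<le> \<eta>"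
    and f: "f \<in> carrier_vec p"
  shows "f \<bullet> ((recentred S - recentred S') *\<^sub>v f) \<le> (1 - c / 2) * \<eta> * (f \<bullet> f)"
proof -
  note T_carrier = symmetric_carrier[OF tyler_map_symmetric]
  have d4: "d \<le> 1 / 4" using d c by linarith
  have \<eta>': "form_bound p (S' - S) \<eta>"
    using \<eta>(1) form_bound_minus_commute[OF form_ballD(2)[OF S] form_ballD(2)[OF S']] by simp
  have trace_shift: "mat_trace (T S' - T S) / real p \<le> \<eta> * (t + 5 * d)"
    using tyler_map_diff_upper(1)[OF S' S trace[symmetric] d(1) d4 \<eta>' \<eta>(2)] p by (simp add: pos_divide_le_eq)
  have "f \<bullet> ((recentred S - recentred S') *\<^sub>v f) =
      f \<bullet> ((T S - T S') *\<^sub>v f) + (mat_trace (T S' - T S) / real p) * (f \<bullet> f)"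
    using f T_carrier[of p n v S] T_carrier[of p n v S']
    by (simp add: recentred_def form_minus[where p = p] form_smult[where p = p] mat_trace_minus[where p = p]
        left_diff_distrib diff_divide_distrib)
  also have "\<dots> \<le> \<eta> * ((1 + 5 * d) * (1 + t) - c) * (f \<bullet> f) + \<eta> * (t + 5 * d) * (f \<bullet> f)"
    by (intro add_mono tyler_map_diff_upper(2)[OF S S' trace d(1) d4 \<eta> f] mult_right_mono trace_shift scalar_prod_self_nonneg)
  also have "\<dots> = \<eta> * (f \<bullet> f) * ((1 + 5 * d) * (1 + t) - c + t + 5 * d)"
    by (simp add: algebra_simps)
  also have "\<dots> \<le> \<eta> * (f \<bullet> f) * (1 - c / 2)"
  proof (intro mult_left_mono)
    have "d * t \<le> 1 * t" using d4 isotropy_nonneg by (intro mult_right_mono) auto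
    moreover have "(1 + 5 * d) * (1 + t) - c + t + 5 * d = 1 - c + 2 * t + 10 * d + 5 * (d * t)"
      by (simp add: algebra_simps)
    ultimately show "(1 + 5 * d) * (1 + t) - c + t + 5 * d \<le> 1 - c / 2"
      using d t c by linarith
    show "0 \<le> \<eta> * (f \<bullet> f)" using \<eta>(2) scalar_prod_self_nonneg[of f] by simp
  qed
  finally show ?thesis by (simp add: mult_ac)
qed

lemma recentred_contraction:
  assumes S: "S \<in> form_ball p (1\<^sub>m p) d" and S': "S' \<in> form_ball p (1\<^sub>m p) d" and trace: "mat_trace S = mat_trace S'"
    and d: "0 \<le> d" "d \<le> c / 80" and t: "t \<le> c / 160" and \<eta>: "form_bound p (S - S') \<eta>" "0 \<le> \<eta>"
  shows "form_bound p (recentred S - recentred S') ((1 - c / 2) * \<eta>)"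
proof (rule form_boundI)
  fix f :: rvec assume f: "f \<in> carrier_vec p"
  have "form_bound p (S' - S) \<eta>"
    using \<eta>(1) form_bound_minus_commute[OF form_ballD(2)[OF S] form_ballD(2)[OF S']] by simp
  then show "\<bar>f \<bullet> ((recentred S - recentred S') *\<^sub>v f)\<bar> \<le> (1 - c / 2) * \<eta> * (f \<bullet> f)"
    using recentred_diff_upper[OF S S' trace d t \<eta> f] recentred_diff_upper[OF S' S trace[symmetric] d t _ \<eta>(2) f]
      f symmetric_carrier[OF recentred_symmetric]
    by (simp add: form_minus[where p = p] abs_le_iff)
qed

lemma recentred_in_form_ball:
  assumes S: "S \<in> form_ball p (1\<^sub>m p) d" "mat_trace S = real p"
    and d: "0 \<le> d" "d \<le> c / 80" and t: "t \<le> c / 160" "t \<le> c * d / 2"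
  shows "recentred S \<in> form_ball p (1\<^sub>m p) d"
proof -
  note carrier = symmetric_carrier[OF recentred_symmetric]
  have "form_bound p (recentred S - recentred (1\<^sub>m p)) ((1 - c / 2) * d)"
    by (rule recentred_contraction[OF S(1) center_in_form_ball[OF symmetric_one d(1)] _ d t(1) form_ballD(3)[OF S(1)] d(1)])
      (simp add: S(2) mat_trace_one)
  moreover have "form_bound p (recentred (1\<^sub>m p) - 1\<^sub>m p) t"
    using isotropic by (simp add: recentred_one)
  ultimately have "form_bound p (recentred S - 1\<^sub>m p) ((1 - c / 2) * d + t)"
    by (rule form_bound_triangle[OF carrier carrier one_carrier_mat])
  then have "form_bound p (recentred S - 1\<^sub>m p) d"
    by (rule form_bound_mono) (use t(2) in \<open>simp add: algebra_simps\<close>)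
  then show ?thesis by (simp add: form_ball_def recentred_symmetric)
qed

lemma tyler_map_fixed_point_if_recentred:
  assumes S: "pos_def p S" and fixed: "recentred S = S"
  shows "T S = S"
proof -
  define \<tau> where "\<tau> = mat_trace (T S) / real p - 1"
  have "T S = recentred S + \<tau> \<cdot>\<^sub>m 1\<^sub>m p"
    using symmetric_carrier[OF tyler_map_symmetric, of p n v S] by (intro eq_matI) (auto simp: recentred_def \<tau>_def)
  then have shift: "T S = S + \<tau> \<cdot>\<^sub>m 1\<^sub>m p" by (simp only: fixed)
  have "\<tau> = 0"
    by (rule tyler_map_shift_eq_0[OF S p n _ _ shift]) (use unit_sphereD[OF unit] in auto)
  with shift show ?thesis using pos_def_carrier[OF S] by (intro eq_matI) auto
qed

lemma tyler_map_fixed_point: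
  assumes d: "0 < d" "d \<le> c / 80" and t: "t \<le> c * d / 2"
  obtains S where "S \<in> form_ball p (1\<^sub>m p) d" "pos_def p S" "T S = S"
proof -
  define \<S> where "\<S> = form_ball p (1\<^sub>m p) d \<inter> {S. S \<in> carrier_mat p p \<and> mat_trace S = real p}"
  have in_\<S>: "S \<in> \<S> \<longleftrightarrow> S \<in> form_ball p (1\<^sub>m p) d \<and> mat_trace S = real p" for S
    using form_ballD(2)[of S p "1\<^sub>m p" d] by (auto simp: \<S>_def)
  have "c * d \<le> 1 * d" using c d by (intro mult_right_mono) auto
  then have t160: "t \<le> c / 160" using d t by linarith
  have "1\<^sub>m p \<in> \<S>" using d by (simp add: in_\<S> center_in_form_ball symmetric_one mat_trace_one)
  then have nonempty: "\<S> \<noteq> {}" by blast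
  obtain S where S: "S \<in> \<S>" "recentred S = S"
  proof (rule matrix_contraction_fixpoint[of \<S> p recentred "1 - c / 2"])
    show "\<S> \<subseteq> Collect (symmetric p)" by (auto simp: in_\<S> form_ball_def)
    show "entrywise_closed p \<S>"
      unfolding \<S>_def by (intro entrywise_closed_Int entrywise_closed_form_ball entrywise_closed_trace one_carrier_mat)
    show "form_bound p (recentred A - recentred B) ((1 - c / 2) * \<eta>)"
      if "A \<in> \<S>" "B \<in> \<S>" "0 \<le> \<eta>" "form_bound p (A - B) \<eta>" for A B \<eta>
      using that d by (intro recentred_contraction[where d = d] t160) (auto simp: in_\<S>)
    show "recentred S \<in> \<S>" if "S \<in> \<S>" for S
      using recentred_in_form_ball[of S d] that d t t160 by (auto simp: in_\<S> recentred_trace)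
  qed (use c nonempty in auto)
  have ball: "S \<in> form_ball p (1\<^sub>m p) d" using S(1) by (simp add: in_\<S>)
  have pd: "pos_def p S" using form_ball_one_pos_def[OF ball] d c by simp
  show ?thesis by (rule that[OF ball pd tyler_map_fixed_point_if_recentred[OF pd S(2)]])
qed

end

section \<open>Uniqueness\<close>

lemma loewner_le_smult_iff:
  assumes "A \<in> carrier_mat p p"
  shows "loewner_le p B (l \<cdot>\<^sub>m A) \<longleftrightarrow> (\<forall>y\<in>carrier_vec p. y \<bullet> (B *\<^sub>v y) \<le> l * (y \<bullet> (A *\<^sub>v y)))"
  using assms by (simp add: loewner_le_def form_smult[where p = p])

lemma loewner_le_smult_exists:
  assumes A: "pos_def p A" and B: "B \<in> carrier_mat p p"
  shows "\<exists>l. loewner_le p B (l \<cdot>\<^sub>m A)"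
proof -
  obtain c where c: "c > 0" "\<And>y. y \<in> carrier_vec p \<Longrightarrow> c * (y \<bullet> y) \<le> y \<bullet> (A *\<^sub>v y)"
    using pos_def_lower_bound[OF A] by blast
  obtain b where b: "b > 0" "form_bound p B b" using form_bound_exists[OF B] by blast
  have "y \<bullet> (B *\<^sub>v y) \<le> b / c * (y \<bullet> (A *\<^sub>v y))" if y: "y \<in> carrier_vec p" for y
  proof -
    have "y \<bullet> (B *\<^sub>v y) \<le> b * (y \<bullet> y)" using form_boundD[OF b(2) y] by (simp add: abs_le_iff)
    also have "\<dots> \<le> b / c * (y \<bullet> (A *\<^sub>v y))" using c(2)[OF y] c(1) b(1) by (simp add: field_simps)
    finally show ?thesis .
  qed
  then have "loewner_le p B ((b / c) \<cdot>\<^sub>m A)" by (simp add: loewner_le_smult_iff[OF pos_def_carrier[OF A]])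
  then show ?thesis ..
qed

lemma least_loewner_multiple:
  assumes A: "pos_def p A" and B: "B \<in> carrier_mat p p" and p: "1 \<le> p"
  obtains l where "loewner_le p B (l \<cdot>\<^sub>m A)" "\<And>k. loewner_le p B (k \<cdot>\<^sub>m A) \<Longrightarrow> l \<le> k"
proof -
  note A_carrier = pos_def_carrier[OF A]
  define L where "L = {l. loewner_le p B (l \<cdot>\<^sub>m A)}"
  have nonempty: "L \<noteq> {}" using loewner_le_smult_exists[OF A B] by (simp add: L_def)
  define q where "q y = (y \<bullet> (B *\<^sub>v y)) / (y \<bullet> (A *\<^sub>v y))" for y
  have q_le_iff: "q y \<le> l \<longleftrightarrow> y \<bullet> (B *\<^sub>v y) \<le> l * (y \<bullet> (A *\<^sub>v y))" if "y \<in> carrier_vec p" "y \<noteq> 0\<^sub>v p" for y l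
    using pos_def_pos[OF A that] by (simp add: q_def pos_divide_le_eq)
  have q_le: "q y \<le> l" if "l \<in> L" "y \<in> carrier_vec p" "y \<noteq> 0\<^sub>v p" for y l
    using that by (simp add: q_le_iff L_def loewner_le_smult_iff[OF A_carrier])
  have bdd: "bdd_below L"
    using q_le[of _ "unit_vec p 0"] unit_sphereD[OF unit_vec_in_unit_sphere[of 0 p]] p by (intro bdd_belowI) auto
  have "y \<bullet> (B *\<^sub>v y) \<le> Inf L * (y \<bullet> (A *\<^sub>v y))" if y: "y \<in> carrier_vec p" for y
  proof (cases "y = 0\<^sub>v p")
    case True
    then show ?thesis using A_carrier B by simp
  next
    case False
    have "q y \<le> Inf L" by (intro cInf_greatest nonempty q_le y False)
    then show ?thesis by (simp add: q_le_iff[OF y False])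
  qed
  then have "loewner_le p B (Inf L \<cdot>\<^sub>m A)" by (simp add: loewner_le_smult_iff[OF A_carrier])
  moreover have "Inf L \<le> k" if "loewner_le p B (k \<cdot>\<^sub>m A)" for k
    using that by (intro cInf_lower bdd) (simp add: L_def)
  ultimately show ?thesis by (rule that)
qed

lemma smaller_loewner_multiple_if_pos_def_minus:
  assumes A: "A \<in> carrier_mat p p" and B: "B \<in> carrier_mat p p" and diff: "pos_def p (l \<cdot>\<^sub>m A - B)"
  shows "\<exists>k<l. loewner_le p B (k \<cdot>\<^sub>m A)"
proof -
  obtain a where a: "a > 0" "form_bound p A a" using form_bound_exists[OF A] by blast
  obtain \<delta> where \<delta>: "\<delta> > 0" "\<And>y. y \<in> carrier_vec p \<Longrightarrow> \<delta> * (y \<bullet> y) \<le> y \<bullet> ((l \<cdot>\<^sub>m A - B) *\<^sub>v y)"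
    using pos_def_lower_bound[OF diff] by blast
  have "y \<bullet> (B *\<^sub>v y) \<le> (l - \<delta> / a) * (y \<bullet> (A *\<^sub>v y))" if y: "y \<in> carrier_vec p" for y
  proof -
    have "y \<bullet> (A *\<^sub>v y) \<le> a * (y \<bullet> y)" using form_boundD[OF a(2) y] by (simp add: abs_le_iff)
    then have "\<delta> / a * (y \<bullet> (A *\<^sub>v y)) \<le> \<delta> * (y \<bullet> y)" using \<delta>(1) a(1) by (simp add: field_simps)
    then show ?thesis
      using \<delta>(2)[OF y] y A B by (simp add: form_minus[where p = p] form_smult[where p = p] left_diff_distrib)
  qed
  then have "loewner_le p B ((l - \<delta> / a) \<cdot>\<^sub>m A)" by (simp add: loewner_le_smult_iff[OF A])
  moreover have "l - \<delta> / a < l" using \<delta>(1) a(1) by simp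
  ultimately show ?thesis by blast
qed

text \<open>\<open>l\<close> is the largest generalized eigenvalue of the pair \<open>(B, A)\<close>, and \<open>e\<close> an eigenvector.\<close>

lemma loewner_le_touching:
  assumes A: "pos_def p A" and B: "symmetric p B" and p: "1 \<le> p"
  obtains l e where "loewner_le p B (l \<cdot>\<^sub>m A)" "e \<in> carrier_vec p" "e \<noteq> 0\<^sub>v p" "e \<bullet> (B *\<^sub>v e) = l * (e \<bullet> (A *\<^sub>v e))"
proof -
  note A_carrier = pos_def_carrier[OF A] and B_carrier = symmetric_carrier[OF B]
  obtain l where l: "loewner_le p B (l \<cdot>\<^sub>m A)" "\<And>k. loewner_le p B (k \<cdot>\<^sub>m A) \<Longrightarrow> l \<le> k"
    using least_loewner_multiple[OF A B_carrier p] by blast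
  have "\<not> pos_def p (l \<cdot>\<^sub>m A - B)"
    using smaller_loewner_multiple_if_pos_def_minus[OF A_carrier B_carrier] l(2) by (meson not_less)
  then obtain e where e: "e \<in> carrier_vec p" "e \<noteq> 0\<^sub>v p" "e \<bullet> ((l \<cdot>\<^sub>m A - B) *\<^sub>v e) \<le> 0"
    using pos_defI[OF symmetric_minus[OF symmetric_smult[OF pos_def_symmetric[OF A]] B], of l]
    by (meson not_less)
  have "e \<bullet> (B *\<^sub>v e) = l * (e \<bullet> (A *\<^sub>v e))"
    using loewner_leD[OF l(1) e(1)] e A_carrier B_carrier
    by (intro antisym) (auto simp: form_minus[where p = p] form_smult[where p = p])
  then show ?thesis by (rule that[OF l(1) e(1,2)])
qed

lemma tyler_map_touching:
  assumes S: "pos_def p S" and S': "pos_def p S'" and l: "0 < l" and le: "loewner_le p S' (l \<cdot>\<^sub>m S)"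
    and x: "\<And>i. i < n \<Longrightarrow> x i \<in> carrier_vec p" and e: "e \<in> carrier_vec p"
    and touching: "e \<bullet> (tyler_map p n x S' *\<^sub>v e) = l * (e \<bullet> (tyler_map p n x S *\<^sub>v e))"
    and p: "1 \<le> p" and i: "i < n" "x i \<bullet> e \<noteq> 0"
  shows "x i \<bullet> (mat_inv (l \<cdot>\<^sub>m S) *\<^sub>v x i) = x i \<bullet> (mat_inv S' *\<^sub>v x i)"
proof -
  let ?a = "\<lambda>i. x i \<bullet> (mat_inv (l \<cdot>\<^sub>m S) *\<^sub>v x i)" and ?b = "\<lambda>i. x i \<bullet> (mat_inv S' *\<^sub>v x i)"
  let ?gap = "\<lambda>i. (1 / ?a i - 1 / ?b i) * (x i \<bullet> e)\<^sup>2"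
  note lS = pos_def_smult[OF S l]
  have pos: "0 < ?a i" "0 < ?b i" if "i < n" "x i \<noteq> 0\<^sub>v p" for i
    using pos_def_pos[OF pos_def_mat_inv[OF lS] x[OF that(1)] that(2)]
      pos_def_pos[OF pos_def_mat_inv[OF S'] x[OF that(1)] that(2)] by auto
  have gap_nonneg: "0 \<le> ?gap i" if "i < n" for i
  proof (cases "x i = 0\<^sub>v p")
    case True
    then show ?thesis using e by simp
  next
    case False
    then have "0 \<le> 1 / ?a i - 1 / ?b i"
      using pos[OF that] loewner_leD[OF loewner_le_mat_inv[OF S' lS le] x[OF that]] by (simp add: frac_le)
    then show ?thesis by simp
  qed
  have scaled: "l * (e \<bullet> (tyler_map p n x S *\<^sub>v e)) = real p / real n * (\<Sum>i<n. 1 / ?a i * (x i \<bullet> e)\<^sup>2)"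
  proof -
    have "l * (1 / (x i \<bullet> (mat_inv S *\<^sub>v x i))) = 1 / ?a i" if "i < n" for i
      using l x[OF that] mat_inv_smult[OF S] pos_def_mat_inv_mult(1)[OF S] by (simp add: form_smult[where p = p])
    then have "l \<cdot>\<^sub>m tyler_map p n x S = scatter p n x (\<lambda>i. 1 / ?a i)"
      unfolding tyler_map_def scatter_smult_weight[symmetric] by (rule scatter_cong)
    then have "e \<bullet> ((l \<cdot>\<^sub>m tyler_map p n x S) *\<^sub>v e) = real p / real n * (\<Sum>i<n. 1 / ?a i * (x i \<bullet> e)\<^sup>2)"
      using x e by (simp add: scatter_quadratic_form)
    then show ?thesis using e by (simp add: tyler_map_def form_smult[where p = p])
  qed
  have "real p / real n * (\<Sum>i<n. ?gap i) = l * (e \<bullet> (tyler_map p n x S *\<^sub>v e)) - e \<bullet> (tyler_map p n x S' *\<^sub>v e)"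
    unfolding scaled using x e
    by (simp add: tyler_map_def scatter_quadratic_form left_diff_distrib sum_subtractf right_diff_distrib)
  then have "(\<Sum>i<n. ?gap i) = 0" using touching p i by simp
  then have "?gap i = 0" using gap_nonneg i(1) by (subst (asm) sum_nonneg_eq_0_iff) auto
  moreover have "x i \<noteq> 0\<^sub>v p" using i(2) e by auto
  ultimately show ?thesis using pos[OF i(1)] i(2) by simp
qed

lemma symmetric_eq_0_if_vanishes_off_hyperplane:
  assumes N: "symmetric p N" and x: "\<And>i. i < n \<Longrightarrow> x i \<in> carrier_vec p"
    and e: "e \<in> carrier_vec p" "e \<noteq> 0\<^sub>v p" and not_covered: "\<not> two_hyperplanes_cover p n x"
    and kernel: "\<And>i. i < n \<Longrightarrow> x i \<bullet> e \<noteq> 0 \<Longrightarrow> N *\<^sub>v x i = 0\<^sub>v p"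
  shows "N = 0\<^sub>m p p"
proof (rule mat_eq_vecI)
  fix g :: rvec assume g: "g \<in> carrier_vec p"
  have Ng: "N *\<^sub>v g \<in> carrier_vec p" using N g by auto
  have "x i \<bullet> (N *\<^sub>v g) = 0" if "i < n" "x i \<bullet> e \<noteq> 0" for i
    using form_symmetric[OF N x[OF that(1)] g] kernel[OF that] g by simp
  then have "N *\<^sub>v g = 0\<^sub>v p"
    using not_covered e Ng unfolding two_hyperplanes_cover_def by blast
  then show "N *\<^sub>v g = 0\<^sub>m p p *\<^sub>v g" using g by (intro eq_vecI) auto
qed (use N in auto)

text \<open>
  Take the least \<open>l\<close> with \<open>S' \<le> l S\<close> and a vector \<open>e\<close> where equality holds. Comparing the two
  equations along \<open>e\<close> forces every sample that is not orthogonal to \<open>e\<close> into the kernel of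
  \<open>N = S'\<^sup>-\<^sup>1 - (l S)\<^sup>-\<^sup>1 \<ge> 0\<close>, so \<open>N = 0\<close>.
\<close>

lemma tyler_solution_unique:
  assumes p: "1 \<le> p" and x: "\<And>i. i < n \<Longrightarrow> x i \<in> carrier_vec p"
    and not_covered: "\<not> two_hyperplanes_cover p n x"
    and solution: "tyler_solution p n x S" and solution': "tyler_solution p n x S'"
  shows "S = S'"
proof -
  have S: "pos_def p S" "mat_trace S = real p" "tyler_map p n x S = S"
    and S': "pos_def p S'" "mat_trace S' = real p" "tyler_map p n x S' = S'"
    using solution solution' by (auto simp: tyler_solution_iff)
  obtain l e where le: "loewner_le p S' (l \<cdot>\<^sub>m S)" and e: "e \<in> carrier_vec p" "e \<noteq> 0\<^sub>v p"
    and touching: "e \<bullet> (S' *\<^sub>v e) = l * (e \<bullet> (S *\<^sub>v e))"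
    using loewner_le_touching[OF S(1) pos_def_symmetric[OF S'(1)] p] by blast
  have l: "0 < l"
    using touching pos_def_pos[OF S(1) e] pos_def_pos[OF S'(1) e] by (simp add: zero_less_mult_iff)
  note lS = pos_def_smult[OF S(1) l]
  note inv = pos_def_mat_inv[OF lS] and inv' = pos_def_mat_inv[OF S'(1)]
  let ?N = "mat_inv S' - mat_inv (l \<cdot>\<^sub>m S)"
  have N: "psd p ?N"
    by (intro psd_minus_if_loewner_le pos_def_symmetric inv inv' loewner_le_mat_inv[OF S'(1) lS le])
  have "?N = 0\<^sub>m p p"
  proof (rule symmetric_eq_0_if_vanishes_off_hyperplane[OF psd_symmetric[OF N] x e not_covered])
    fix i assume i: "i < n" "x i \<bullet> e \<noteq> 0"
    have "x i \<bullet> (mat_inv (l \<cdot>\<^sub>m S) *\<^sub>v x i) = x i \<bullet> (mat_inv S' *\<^sub>v x i)"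
      by (rule tyler_map_touching[where x = x and i = i, OF S(1) S'(1) l le x e(1) _ p i]) (simp_all add: S(3) S'(3) touching)
    then show "?N *\<^sub>v x i = 0\<^sub>v p"
      using x[OF i(1)] pos_def_carrier[OF inv] pos_def_carrier[OF inv']
      by (intro psd_mult_vec_eq_0[OF N]) (simp_all add: form_minus[where p = p])
  qed
  then have "mat_inv S' = mat_inv (l \<cdot>\<^sub>m S)"
    by (rule mat_minus_eq_0D[OF pos_def_carrier[OF inv'] pos_def_carrier[OF inv]])
  then have eq: "S' = l \<cdot>\<^sub>m S" using mat_inv_mat_inv[OF S'(1)] mat_inv_mat_inv[OF lS] by metis
  then have "real p = l * real p" using S(2) S'(2) mat_trace_smult[OF pos_def_carrier[OF S(1)]] by simp
  then have "l = 1" using p by simp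
  then show ?thesis unfolding eq by (intro eq_matI) auto
qed

section \<open>The deterministic estimate\<close>

lemma tyler_map_cong: "(\<And>i. i < n \<Longrightarrow> x i = y i) \<Longrightarrow> tyler_map p n x = tyler_map p n y"
  by (intro ext eq_matI) (auto simp: tyler_map_def scatter_def)

lemma tyler_solution_transform:
  assumes R: "pos_def p R" and S: "pos_def p S" and fixed: "tyler_map p n v S = S" and p: "1 \<le> p"
    and v: "\<And>i. i < n \<Longrightarrow> v i \<in> carrier_vec p" and u: "\<And>i. i < n \<Longrightarrow> u i \<noteq> 0"
    and x: "\<And>i. i < n \<Longrightarrow> x i = u i \<cdot>\<^sub>v (R *\<^sub>v v i)"
  shows "tyler_solution p n x ((real p / mat_trace (R * S * R)) \<cdot>\<^sub>m (R * S * R))"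
proof -
  note RSR = pos_def_conjugate[OF R S]
  have trace: "0 < mat_trace (R * S * R)" by (rule mat_trace_pos[OF RSR p])
  let ?s = "real p / mat_trace (R * S * R)"
  have s: "0 < ?s" using trace p by simp
  have "tyler_map p n x = tyler_map p n (\<lambda>i. u i \<cdot>\<^sub>v (R *\<^sub>v v i))"
    by (rule tyler_map_cong) (rule x)
  then have "tyler_map p n x (?s \<cdot>\<^sub>m (R * S * R)) = ?s \<cdot>\<^sub>m (R * tyler_map p n v S * R)"
    using tyler_map_equivariant[OF R S less_imp_neq[OF s, symmetric], of n v u] v u by simp
  moreover have "mat_trace (?s \<cdot>\<^sub>m (R * S * R)) = real p"
    using mat_trace_smult[OF pos_def_carrier[OF RSR]] trace by simp
  ultimately show ?thesis by (simp only: tyler_solution_iff pos_def_smult[OF RSR s] fixed)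
qed

lemma two_hyperplanes_cover_transform:
  assumes R: "pos_def p R" and v: "\<And>i. i < n \<Longrightarrow> v i \<in> carrier_vec p" and u: "\<And>i. i < n \<Longrightarrow> u i \<noteq> 0"
    and x: "\<And>i. i < n \<Longrightarrow> x i = u i \<cdot>\<^sub>v (R *\<^sub>v v i)" and cover: "two_hyperplanes_cover p n x"
  shows "two_hyperplanes_cover p n v"
proof -
  note R_carrier = pos_def_carrier[OF R]
  have "x i \<bullet> g = u i * (v i \<bullet> (R *\<^sub>v g))" if "i < n" "g \<in> carrier_vec p" for i g
    using x[OF that(1)] form_symmetric[OF pos_def_symmetric[OF R] v[OF that(1)] that(2)] v[OF that(1)] that(2) R_carrier
    by simp
  then have orthogonal_iff: "x i \<bullet> g = 0 \<longleftrightarrow> v i \<bullet> (R *\<^sub>v g) = 0" if "i < n" "g \<in> carrier_vec p" for i g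
    using u that by simp
  from cover obtain e f where e: "e \<in> carrier_vec p" "e \<noteq> 0\<^sub>v p" and f: "f \<in> carrier_vec p" "f \<noteq> 0\<^sub>v p"
    and cover: "\<And>i. i < n \<Longrightarrow> x i \<bullet> e = 0 \<or> x i \<bullet> f = 0"
    by (auto simp: two_hyperplanes_cover_def)
  have "\<forall>i<n. v i \<bullet> (R *\<^sub>v e) = 0 \<or> v i \<bullet> (R *\<^sub>v f) = 0"
    using cover orthogonal_iff e(1) f(1) by blast
  moreover have "R *\<^sub>v e \<in> carrier_vec p" "R *\<^sub>v f \<in> carrier_vec p" using R_carrier e(1) f(1) by auto
  ultimately show ?thesis
    unfolding two_hyperplanes_cover_def
    using pos_def_mult_vec_nonzero[OF R e] pos_def_mult_vec_nonzero[OF R f] by blast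
qed

lemma mat_trace_conjugate_near_one:
  assumes R: "pos_def p R" "mat_trace (R * R) = real p" and S: "S \<in> form_ball p (1\<^sub>m p) d" and p: "1 \<le> p"
  shows "\<bar>mat_trace (R * S * R) / real p - 1\<bar> \<le> d"
proof -
  note R_carrier = pos_def_carrier[OF R(1)] and S_carrier = form_ballD(2)[OF S]
  let ?E = "S - 1\<^sub>m p"
  have "psd p (R * R)"
    using form_square[OF pos_def_symmetric[OF R(1)]] R(1)
    by (auto simp: psd_def scalar_prod_self_nonneg intro: symmetric_square)
  then have "\<bar>mat_trace (?E * (R * R))\<bar> \<le> d * real p"
    using mat_trace_mult_form_bound[OF symmetric_minus[OF form_ballD(1)[OF S] symmetric_one] form_ballD(3)[OF S]] R(2)
    by metis
  moreover have "mat_trace (?E * (R * R)) = mat_trace (S * (R * R)) - mat_trace (R * R)"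
    using S_carrier R_carrier minus_mult_distrib_mat[OF S_carrier one_carrier_mat, of "R * R" p]
    by (simp add: mat_trace_minus[where p = p])
  moreover have "mat_trace (S * (R * R)) = mat_trace (R * S * R)"
    using mat_trace_comm[of R p "S * R"] R_carrier S_carrier
    by (simp add: assoc_mult_mat[where n\<^sub>1 = p and n\<^sub>2 = p and n\<^sub>3 = p and n\<^sub>4 = p])
  ultimately have "\<bar>mat_trace (R * S * R) - real p\<bar> \<le> d * real p" using R(2) by simp
  moreover have "mat_trace (R * S * R) / real p - 1 = (mat_trace (R * S * R) - real p) / real p"
    using p by (simp add: diff_divide_distrib)
  ultimately show ?thesis using p by (simp add: pos_divide_le_eq)
qed

lemma conjugate_mat_inv_conjugate:
  assumes R: "pos_def p R" and S: "pos_def p S" and s: "s \<noteq> 0"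
  shows "R * mat_inv (s \<cdot>\<^sub>m (R * S * R)) * R = (1 / s) \<cdot>\<^sub>m mat_inv S"
proof (rule mat_eq_vecI[where p = p])
  note R_carrier = pos_def_carrier[OF R]
  note carriers = pos_def_mat_inv_mult(1)[OF R] pos_def_mat_inv_mult(1)[OF S]
  let ?K = "mat_inv R * mat_inv S * mat_inv R"
  have K_carrier: "?K \<in> carrier_mat p p" using carriers by simp
  note inv = mat_inv_scaled_conjugate[OF R S s]
  then have inv_carrier: "mat_inv (s \<cdot>\<^sub>m (R * S * R)) \<in> carrier_mat p p" using K_carrier by simp
  then show "R * mat_inv (s \<cdot>\<^sub>m (R * S * R)) * R \<in> carrier_mat p p" using R_carrier by simp
  show "(1 / s) \<cdot>\<^sub>m mat_inv S \<in> carrier_mat p p" using carriers by simp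
  fix y :: rvec assume y: "y \<in> carrier_vec p"
  have Ry: "R *\<^sub>v y \<in> carrier_vec p" and Sy: "mat_inv S *\<^sub>v y \<in> carrier_vec p" using R_carrier carriers y by auto
  have RSy: "mat_inv R *\<^sub>v (mat_inv S *\<^sub>v y) \<in> carrier_vec p" using carriers Sy by simp
  have "mat_inv (s \<cdot>\<^sub>m (R * S * R)) *\<^sub>v (R *\<^sub>v y) = (1 / s) \<cdot>\<^sub>v (mat_inv R *\<^sub>v (mat_inv S *\<^sub>v y))"
    unfolding inv smult_mat_mult_vec[OF K_carrier Ry] mult_mat3_vec[OF carriers(1) carriers(2) carriers(1) Ry]
    by (simp add: pos_def_mat_inv_vec(3)[OF R y])
  then have "R *\<^sub>v (mat_inv (s \<cdot>\<^sub>m (R * S * R)) *\<^sub>v (R *\<^sub>v y)) = (1 / s) \<cdot>\<^sub>v (mat_inv S *\<^sub>v y)"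
    using mult_mat_vec[OF R_carrier RSy] pos_def_mat_inv_vec(2)[OF R Sy] by simp
  then show "(R * mat_inv (s \<cdot>\<^sub>m (R * S * R)) * R) *\<^sub>v y = ((1 / s) \<cdot>\<^sub>m mat_inv S) *\<^sub>v y"
    using mult_mat3_vec[OF R_carrier inv_carrier R_carrier y] smult_mat_mult_vec[OF carriers(2) y] by simp
qed

lemma frobenius_norm_one_minus_scaled_inverse:
  assumes S: "S \<in> form_ball p (1\<^sub>m p) d" and d: "0 \<le> d" "d \<le> 1 / 4" and \<tau>: "\<bar>\<tau> - 1\<bar> \<le> d"
  shows "frobenius_norm (1\<^sub>m p - \<tau> \<cdot>\<^sub>m mat_inv S) \<le> 4 * d * sqrt (real p)"
proof (rule frobenius_norm_le)
  have d1: "d < 1" using d by simp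
  note inv_carrier = pos_def_mat_inv_mult(1)[OF form_ball_one_pos_def[OF S d1]]
  show "1\<^sub>m p - \<tau> \<cdot>\<^sub>m mat_inv S \<in> carrier_mat p p" using inv_carrier by simp
  fix e assume e: "e \<in> unit_sphere p"
  note near = form_ball_one_mat_inv[OF S d(1) d1 e] and e = unit_sphereD(1)[OF e]
  let ?y = "mat_inv S *\<^sub>v e"
  have y: "?y \<in> carrier_vec p" using inv_carrier e by simp
  have "(1\<^sub>m p - \<tau> \<cdot>\<^sub>m mat_inv S) *\<^sub>v e = (e - ?y) + (1 - \<tau>) \<cdot>\<^sub>v ?y"
    using minus_mult_distrib_mat_vec[OF one_carrier_mat _ e, of "\<tau> \<cdot>\<^sub>m mat_inv S"]
      smult_mat_mult_vec[OF inv_carrier e, of \<tau>] inv_carrier e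
    by (intro eq_vecI) (auto simp: algebra_simps)
  then have "euclid_norm ((1\<^sub>m p - \<tau> \<cdot>\<^sub>m mat_inv S) *\<^sub>v e) \<le> euclid_norm (e - ?y) + \<bar>1 - \<tau>\<bar> * euclid_norm ?y"
    using euclid_norm_add[of "e - ?y" p "(1 - \<tau>) \<cdot>\<^sub>v ?y"] e y by (simp add: euclid_norm_smult)
  also have "\<dots> \<le> d / (1 - d) + d * (1 / (1 - d))"
    using near \<tau> d by (intro add_mono mult_mono) auto
  also have "\<dots> \<le> 4 * d"
  proof -
    have "1 / (1 - d) \<le> 2" using d by (simp add: field_simps)
    then have "d * (1 / (1 - d)) \<le> d * 2" using d(1) by (intro mult_left_mono) auto
    then show ?thesis by simp
  qed
  finally show "euclid_norm ((1\<^sub>m p - \<tau> \<cdot>\<^sub>m mat_inv S) *\<^sub>v e) \<le> 4 * d" .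
qed (use d in simp)

lemma tyler_estimate:
  fixes x v :: "nat \<Rightarrow> rvec" and u :: "nat \<Rightarrow> real"
  assumes \<Sigma>: "pos_def p \<Sigma>" "mat_trace \<Sigma> = real p" and sample: "well_spread_sample p n v c t"
    and d: "0 < d" "d \<le> c / 80" and t: "t \<le> c * d / 2"
    and u: "\<And>i. i < n \<Longrightarrow> u i \<noteq> 0" and x: "\<And>i. i < n \<Longrightarrow> x i = u i \<cdot>\<^sub>v (mat_sqrt \<Sigma> *\<^sub>v v i)"
  shows "tyler_exists p n x"
    and "frobenius_norm (1\<^sub>m p - mat_sqrt \<Sigma> * mat_inv (tyler p n x) * mat_sqrt \<Sigma>) \<le> 4 * d * sqrt (real p)"
proof -
  interpret well_spread_sample p n v c t by (rule sample)
  let ?R = "mat_sqrt \<Sigma>"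
  note R = mat_sqrt_pos_def[OF \<Sigma>(1)]
  obtain S where S: "S \<in> form_ball p (1\<^sub>m p) d" "pos_def p S" "T S = S"
    using tyler_map_fixed_point[OF d t] by metis
  define \<tau> where "\<tau> = mat_trace (?R * S * ?R) / real p"
  have \<tau>: "\<bar>\<tau> - 1\<bar> \<le> d" "0 < \<tau>"
    using mat_trace_conjugate_near_one[OF R(1) _ S(1) p] mat_trace_pos[OF pos_def_conjugate[OF R(1) S(2)] p] R(2) \<Sigma>(2) p
    by (auto simp: \<tau>_def)
  have solution: "tyler_solution p n x ((1 / \<tau>) \<cdot>\<^sub>m (?R * S * ?R))"
    using tyler_solution_transform[OF R(1) S(2,3) p sample_carrier u x] by (simp add: \<tau>_def)
  have x_carrier: "x i \<in> carrier_vec p" if "i < n" for i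
    using x[OF that] pos_def_carrier[OF R(1)] sample_carrier[OF that] by simp
  have "\<not> two_hyperplanes_cover p n x"
  proof
    assume "two_hyperplanes_cover p n x"
    from two_hyperplanes_cover_transform[where v = v and u = u, OF R(1) _ _ _ this] show False
      using not_two_hyperplanes_cover by (simp add: sample_carrier u x)
  qed
  then have unique: "S' = (1 / \<tau>) \<cdot>\<^sub>m (?R * S * ?R)" if "tyler_solution p n x S'" for S'
    by (intro tyler_solution_unique[OF p _ _ that solution] x_carrier)
  show "tyler_exists p n x" unfolding tyler_exists_def using solution unique by blast
  have "tyler p n x = (1 / \<tau>) \<cdot>\<^sub>m (?R * S * ?R)" unfolding tyler_def using solution unique by (rule the_equality)
  then have "?R * mat_inv (tyler p n x) * ?R = \<tau> \<cdot>\<^sub>m mat_inv S"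
    using conjugate_mat_inv_conjugate[OF R(1) S(2), of "1 / \<tau>"] \<tau>(2) by simp
  then show "frobenius_norm (1\<^sub>m p - ?R * mat_inv (tyler p n x) * ?R) \<le> 4 * d * sqrt (real p)"
    using frobenius_norm_one_minus_scaled_inverse[OF S(1) _ _ \<tau>(1)] d c by simp
qed

section \<open>Measurability of vector operations\<close>

lemma space_vec_borel [simp]: "space (vec_borel p) = carrier_vec p"
  by (simp add: vec_borel_def)

lemma measurable_vec_borel_index [measurable]:
  assumes "i < p"
  shows "(\<lambda>v. v $ i) \<in> borel_measurable (vec_borel p)"
proof -
  have "(\<lambda>v. \<lambda>i\<in>{..<p}. v $ i) \<in> measurable (vec_borel p) (\<Pi>\<^sub>M i\<in>{..<p}. borel :: real measure)"
    unfolding vec_borel_def by (rule measurable_vimage_algebra1) (auto simp: space_PiM)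
  from measurable_compose[OF this measurable_component_singleton[of i]]
  show ?thesis using assms by simp
qed

lemma measurable_vec_borelI:
  assumes "\<And>x. x \<in> space N \<Longrightarrow> g x \<in> carrier_vec p"
    and "\<And>i. i < p \<Longrightarrow> (\<lambda>x. g x $ i) \<in> borel_measurable N"
  shows "g \<in> measurable N (vec_borel p)"
  unfolding vec_borel_def
  by (rule measurable_vimage_algebra2) (use assms in \<open>auto intro!: measurable_restrict\<close>)

lemma measurable_scalar_prod:
  assumes f: "f \<in> measurable N (vec_borel p)" and g: "g \<in> measurable N (vec_borel p)"
  shows "(\<lambda>x. f x \<bullet> g x) \<in> borel_measurable N"
proof -
  have "(\<lambda>x. \<Sum>i<p. f x $ i * g x $ i) \<in> borel_measurable N"
    by (intro borel_measurable_sum borel_measurable_times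
        measurable_compose[OF f measurable_vec_borel_index] measurable_compose[OF g measurable_vec_borel_index]) auto
  moreover have "(\<lambda>x. f x \<bullet> g x) \<in> borel_measurable N \<longleftrightarrow> (\<lambda>x. \<Sum>i<p. f x $ i * g x $ i) \<in> borel_measurable N"
    using measurable_space[OF g] by (intro measurable_cong scalar_prod_sum) auto
  ultimately show ?thesis by simp
qed

lemma measurable_scalar_prod_self: "(\<lambda>v. v \<bullet> v) \<in> borel_measurable (vec_borel p)"
  by (rule measurable_scalar_prod[where p = p]) auto

lemma measurable_scalar_prod_const:
  assumes "e \<in> carrier_vec p"
  shows "(\<lambda>v. e \<bullet> v) \<in> borel_measurable (vec_borel p)"
  by (rule measurable_scalar_prod[where p = p]) (use assms in \<open>auto intro!: measurable_const\<close>)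

lemma measurable_euclid_norm: "euclid_norm \<in> borel_measurable (vec_borel p)"
  unfolding euclid_norm_def using measurable_scalar_prod_self by measurable

lemma measurable_smult_vec:
  assumes f: "f \<in> borel_measurable N" and g: "g \<in> measurable N (vec_borel p)"
  shows "(\<lambda>x. f x \<cdot>\<^sub>v g x) \<in> measurable N (vec_borel p)"
proof (rule measurable_vec_borelI)
  fix i assume i: "i < p"
  have "(\<lambda>x. f x * g x $ i) \<in> borel_measurable N"
    by (intro borel_measurable_times f measurable_compose[OF g measurable_vec_borel_index[OF i]])
  moreover have "(f x \<cdot>\<^sub>v g x) $ i = f x * g x $ i" if "x \<in> space N" for x
    using measurable_space[OF g that] i by auto
  ultimately show "(\<lambda>x. (f x \<cdot>\<^sub>v g x) $ i) \<in> borel_measurable N"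
    by (subst measurable_cong) auto
qed (use measurable_space[OF g] in auto)

lemma measurable_mult_mat_vec:
  assumes A: "A \<in> carrier_mat p p" and g: "g \<in> measurable N (vec_borel p)"
  shows "(\<lambda>x. A *\<^sub>v g x) \<in> measurable N (vec_borel p)"
proof (rule measurable_vec_borelI)
  fix i assume i: "i < p"
  have "(\<lambda>x. row A i \<bullet> g x) \<in> borel_measurable N"
    by (rule measurable_compose[OF g measurable_scalar_prod_const]) (use A i in auto)
  then show "(\<lambda>x. (A *\<^sub>v g x) $ i) \<in> borel_measurable N" using A i by simp
qed (use A measurable_space[OF g] in auto)

lemma measurable_normalized: "normalized \<in> measurable (vec_borel p) (vec_borel p)"
  unfolding normalized_def
  by (intro measurable_smult_vec borel_measurable_divide borel_measurable_const measurable_euclid_norm) auto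

section \<open>Polar integration\<close>

abbreviation coords_lborel :: "nat \<Rightarrow> (nat \<Rightarrow> real) measure" where
  "coords_lborel p \<equiv> \<Pi>\<^sub>M i\<in>{..<p}. lborel"

definition sumsq :: "nat \<Rightarrow> (nat \<Rightarrow> real) \<Rightarrow> real" where
  "sumsq p x = (\<Sum>i<p. (x i)\<^sup>2)"

definition direction :: "nat \<Rightarrow> (nat \<Rightarrow> real) \<Rightarrow> rvec" where
  "direction p x = normalized (Matrix.vec p x)"

lemma sumsq_nonneg: "0 \<le> sumsq p x"
  by (simp add: sumsq_def sum_nonneg)

lemma euclid_norm_vec: "euclid_norm (Matrix.vec p x) = sqrt (sumsq p x)"
  by (simp add: euclid_norm_def scalar_prod_self_sum[where p = p] sumsq_def)

lemma measurable_sumsq [measurable]: "sumsq p \<in> borel_measurable (coords_lborel p)"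
  unfolding sumsq_def by measurable

lemma measurable_vec: "Matrix.vec p \<in> measurable (coords_lborel p) (vec_borel p)"
  by (rule measurable_vec_borelI) auto

lemma measurable_direction: "direction p \<in> measurable (coords_lborel p) (vec_borel p)"
  unfolding direction_def by (rule measurable_compose[OF measurable_vec measurable_normalized])

lemma direction_carrier [simp]: "direction p x \<in> carrier_vec p"
  by (simp add: direction_def)

lemma sumsq_scale: "sumsq p (\<lambda>i\<in>{..<p}. s * x i) = s\<^sup>2 * sumsq p x"
  by (simp add: sumsq_def power_mult_distrib sum_distrib_left)

lemma direction_scale:
  assumes "0 < s"
  shows "direction p (\<lambda>i\<in>{..<p}. s * x i) = direction p x"
proof -
  have "Matrix.vec p (\<lambda>i\<in>{..<p}. s * x i) = s \<cdot>\<^sub>v Matrix.vec p x"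
    by (intro eq_vecI) auto
  then show ?thesis
    unfolding direction_def normalized_def using assms by (intro eq_vecI) (auto simp: euclid_norm_smult)
qed

lemma scalar_prod_direction:
  assumes e: "e \<in> carrier_vec p"
  shows "(\<Sum>i<p. e $ i * x i)\<^sup>2 = (e \<bullet> direction p x)\<^sup>2 * sumsq p x"
proof -
  have "(\<Sum>i<p. e $ i * x i) = e \<bullet> Matrix.vec p x" by (simp add: scalar_prod_sum[where p = p])
  also have "\<dots> = sqrt (sumsq p x) * (e \<bullet> direction p x)"
    unfolding direction_def euclid_norm_vec[symmetric] by (rule scalar_prod_normalized[OF e]) simp
  finally show ?thesis by (simp add: power_mult_distrib sumsq_nonneg)
qed

lemma emeasure_lborel_vimage_scale:
  assumes "0 < s" "A \<in> sets borel"
  shows "ennreal s * emeasure lborel ((\<lambda>y :: real. s * y) -` A) = emeasure lborel A"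
proof -
  have "emeasure lborel A = emeasure (density (distr lborel borel (\<lambda>y. 0 + s * y)) (\<lambda>_. ennreal \<bar>s\<bar>)) A"
    using lborel_real_affine[of s 0] assms(1) by simp
  also have "\<dots> = ennreal s * emeasure lborel ((\<lambda>y. s * y) -` A)"
    using assms by (simp add: emeasure_density_const emeasure_distr)
  finally show ?thesis by simp
qed

lemma nn_integral_coords_scale:
  assumes s: "0 < s" and F[measurable]: "F \<in> borel_measurable (coords_lborel p)"
  shows "(\<integral>\<^sup>+x. F x \<partial>coords_lborel p) = ennreal (s ^ p) * (\<integral>\<^sup>+x. F (\<lambda>i\<in>{..<p}. s * x i) \<partial>coords_lborel p)"
proof -
  interpret product_sigma_finite "\<lambda>_ :: nat. lborel :: real measure" ..
  define h where "h x = (\<lambda>i\<in>{..<p}. s * x i)" for x :: "nat \<Rightarrow> real"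
  have h[measurable]: "h \<in> measurable (coords_lborel p) (coords_lborel p)"
    unfolding h_def by (intro measurable_restrict) measurable
  define P where "P = density (distr (coords_lborel p) (coords_lborel p) h) (\<lambda>_. ennreal (s ^ p))"
  have "P = coords_lborel p"
  proof (rule PiM_eqI)
    fix A :: "nat \<Rightarrow> real set" assume A: "\<And>i. i \<in> {..<p} \<Longrightarrow> A i \<in> sets lborel"
    let ?B = "\<lambda>i. (\<lambda>y. s * y) -` A i"
    have box: "Pi\<^sub>E {..<p} A \<in> sets (coords_lborel p)" by (intro sets_PiM_I_finite A) auto
    have "h -` Pi\<^sub>E {..<p} A \<inter> space (coords_lborel p) = Pi\<^sub>E {..<p} ?B"
      by (auto simp: h_def space_PiM PiE_iff extensional_def)
    then have "emeasure P (Pi\<^sub>E {..<p} A) = ennreal (s ^ p) * emeasure (coords_lborel p) (Pi\<^sub>E {..<p} ?B)"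
      using box by (simp add: P_def emeasure_density_const emeasure_distr)
    also have "emeasure (coords_lborel p) (Pi\<^sub>E {..<p} ?B) = (\<Prod>i<p. emeasure lborel (?B i))"
      using A by (intro emeasure_PiM) (auto intro!: measurable_sets_borel[where f = "\<lambda>y. s * y" and M = borel])
    also have "ennreal (s ^ p) * \<dots> = (\<Prod>i<p. ennreal s * emeasure lborel (?B i))"
      using s by (simp add: prod.distrib ennreal_power)
    also have "\<dots> = (\<Prod>i<p. emeasure lborel (A i))"
      using A by (intro prod.cong refl emeasure_lborel_vimage_scale s) auto
    finally show "emeasure P (Pi\<^sub>E {..<p} A) = (\<Prod>i\<in>{..<p}. emeasure lborel (A i))" .
  qed (auto simp: P_def)
  then have "(\<integral>\<^sup>+x. F x \<partial>coords_lborel p) = (\<integral>\<^sup>+x. F x \<partial>P)" by simp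
  also have "\<dots> = ennreal (s ^ p) * (\<integral>\<^sup>+x. F (h x) \<partial>coords_lborel p)"
    by (simp add: P_def nn_integral_density nn_integral_distr nn_integral_cmult)
  finally show ?thesis by (simp add: h_def)
qed

definition ball_integral :: "nat \<Rightarrow> (rvec \<Rightarrow> ennreal) \<Rightarrow> real \<Rightarrow> ennreal" where
  "ball_integral p H r = (\<integral>\<^sup>+x. H (direction p x) * indicator {..r} (sumsq p x) \<partial>coords_lborel p)"

lemma ball_integral_scale:
  assumes r: "0 < r" and H[measurable]: "H \<in> borel_measurable (vec_borel p)"
  shows "ball_integral p H r = ennreal (sqrt r ^ p) * ball_integral p H 1"
proof -
  note [measurable] = measurable_direction
  let ?scaled = "\<lambda>x. \<lambda>i\<in>{..<p}. sqrt r * x i"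
  have "ball_integral p H r = ennreal (sqrt r ^ p) *
      (\<integral>\<^sup>+x. H (direction p (?scaled x)) * indicator {..r} (sumsq p (?scaled x)) \<partial>coords_lborel p)"
    unfolding ball_integral_def using r by (intro nn_integral_coords_scale) auto
  also have "(\<integral>\<^sup>+x. H (direction p (?scaled x)) * indicator {..r} (sumsq p (?scaled x)) \<partial>coords_lborel p) =
      ball_integral p H 1"
    unfolding ball_integral_def
  proof (intro nn_integral_cong)
    fix x
    have "r * sumsq p x \<le> r \<longleftrightarrow> sumsq p x \<le> 1" using r mult_le_cancel_left_pos[of r "sumsq p x" 1] by simp
    then show "H (direction p (?scaled x)) * indicator {..r} (sumsq p (?scaled x)) =
        H (direction p x) * indicator {..1} (sumsq p x)"
      using r by (simp add: direction_scale sumsq_scale indicator_def)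
  qed
  finally show ?thesis .
qed

lemma nn_integral_sphere_uniform:
  assumes H[measurable]: "H \<in> borel_measurable (vec_borel p)"
  shows "(\<integral>\<^sup>+v. H v \<partial>sphere_uniform p) = ball_integral p H 1 / ball_integral p (\<lambda>_. 1) 1"
proof -
  let ?B = "{v \<in> carrier_vec p. euclid_norm v \<le> 1}"
  have B: "?B \<in> sets (vec_borel p)"
    using measurable_sets[OF measurable_euclid_norm[of p], of "{..1}"]
    by (simp add: vimage_def Int_def conj_commute)
  have sets_vec_lborel: "sets (vec_lborel p) = sets (vec_borel p)" by (simp add: vec_lborel_def)
  have H_normalized: "(\<lambda>v. H (normalized v)) \<in> borel_measurable (vec_borel p)"
    by (rule measurable_compose[OF measurable_normalized H])
  have indicator_vec: "indicator ?B (Matrix.vec p x) = (indicator {..1} (sumsq p x) :: ennreal)" for x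
    by (auto simp: indicator_def euclid_norm_vec)
  have "(\<integral>\<^sup>+v. H v \<partial>sphere_uniform p) = (\<integral>\<^sup>+v. H (normalized v) \<partial>uniform_measure (vec_lborel p) ?B)"
    unfolding sphere_uniform_def normalized_def[symmetric]
    by (rule nn_integral_distr)
      (use measurable_normalized H in \<open>simp_all add: measurable_cong_sets[OF sets_vec_lborel refl] cong: measurable_cong_sets\<close>)
  also have "\<dots> = (\<integral>\<^sup>+v. H (normalized v) * indicator ?B v \<partial>vec_lborel p) / emeasure (vec_lborel p) ?B"
    by (rule nn_integral_uniform_measure)
      (use H_normalized B in \<open>simp_all add: sets_vec_lborel measurable_cong_sets[OF sets_vec_lborel refl]\<close>)
  also have "(\<integral>\<^sup>+v. H (normalized v) * indicator ?B v \<partial>vec_lborel p) = ball_integral p H 1"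
    unfolding vec_lborel_def ball_integral_def direction_def indicator_vec[symmetric]
    by (rule nn_integral_distr[OF measurable_vec]) (use H_normalized B in measurable)
  also have "emeasure (vec_lborel p) ?B = ball_integral p (\<lambda>_. 1) 1"
    unfolding vec_lborel_def ball_integral_def indicator_vec[symmetric]
    by (subst nn_integral_distr[OF measurable_vec, symmetric]) (use B in auto)
  finally show ?thesis .
qed

text \<open>
  Layer-cake integration: the radial profile is written as a superposition of indicators of balls,
  and each ball is rescaled to the unit ball.
\<close>

lemma nn_integral_direction_layer_cake:
  fixes w :: "real \<Rightarrow> ennreal"
  assumes w[measurable]: "w \<in> borel_measurable borel" and H[measurable]: "H \<in> borel_measurable (vec_borel p)"
    and h: "\<And>r. 0 \<le> r \<Longrightarrow> h r = (\<integral>\<^sup>+\<tau>. w \<tau> * indicator {0<..} \<tau> * indicator {r..} \<tau> \<partial>lborel)"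
  shows "(\<integral>\<^sup>+x. H (direction p x) * h (sumsq p x) \<partial>coords_lborel p) =
    (\<integral>\<^sup>+\<tau>. w \<tau> * indicator {0<..} \<tau> * ennreal (sqrt \<tau> ^ p) \<partial>lborel) * ball_integral p H 1"
proof -
  note [measurable] = measurable_direction
  interpret product_sigma_finite "\<lambda>_ :: nat. lborel :: real measure" ..
  interpret sigma_finite_measure "coords_lborel p" by (rule sigma_finite) simp
  interpret pair_sigma_finite "coords_lborel p" "lborel :: real measure" ..
  let ?w = "\<lambda>\<tau>. w \<tau> * indicator {0<..} \<tau>"
  have flip: "indicator {sumsq p x..} \<tau> = (indicator {0..} (\<tau> - sumsq p x) :: ennreal)"
    "indicator {0..} (\<tau> - sumsq p x) = (indicator {..\<tau>} (sumsq p x) :: ennreal)" for x \<tau>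
    by (auto simp: indicator_def)
  have "(\<integral>\<^sup>+x. H (direction p x) * h (sumsq p x) \<partial>coords_lborel p) =
      (\<integral>\<^sup>+x. (\<integral>\<^sup>+\<tau>. H (direction p x) * (?w \<tau> * indicator {0..} (\<tau> - sumsq p x)) \<partial>lborel) \<partial>coords_lborel p)"
    unfolding h[OF sumsq_nonneg] flip(1) by (intro nn_integral_cong nn_integral_cmult[symmetric]) measurable
  also have "\<dots> = (\<integral>\<^sup>+\<tau>. (\<integral>\<^sup>+x. H (direction p x) * (?w \<tau> * indicator {0..} (\<tau> - sumsq p x)) \<partial>coords_lborel p) \<partial>lborel)"
    by (rule Fubini'[symmetric]) measurable
  also have "\<dots> = (\<integral>\<^sup>+\<tau>. ?w \<tau> * ennreal (sqrt \<tau> ^ p) * ball_integral p H 1 \<partial>lborel)"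
  proof (intro nn_integral_cong)
    fix \<tau> :: real
    have "(\<integral>\<^sup>+x. H (direction p x) * (?w \<tau> * indicator {0..} (\<tau> - sumsq p x)) \<partial>coords_lborel p) = ?w \<tau> * ball_integral p H \<tau>"
      unfolding ball_integral_def flip(2)[symmetric]
      by (subst nn_integral_cmult[symmetric]) (auto simp: mult_ac)
    also have "\<dots> = ?w \<tau> * ennreal (sqrt \<tau> ^ p) * ball_integral p H 1"
      using ball_integral_scale[OF _ H, of \<tau>] by (cases "\<tau> > 0") (simp_all add: mult.assoc)
    finally show "(\<integral>\<^sup>+x. H (direction p x) * (?w \<tau> * indicator {0..} (\<tau> - sumsq p x)) \<partial>coords_lborel p) =
        ?w \<tau> * ennreal (sqrt \<tau> ^ p) * ball_integral p H 1" .
  qed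
  also have "\<dots> = (\<integral>\<^sup>+\<tau>. ?w \<tau> * ennreal (sqrt \<tau> ^ p) \<partial>lborel) * ball_integral p H 1"
    by (rule nn_integral_multc) measurable
  finally show ?thesis .
qed

lemma nn_integral_direction_radial:
  fixes w :: "real \<Rightarrow> ennreal"
  assumes w: "w \<in> borel_measurable borel" and H: "H \<in> borel_measurable (vec_borel p)"
    and h: "\<And>r. 0 \<le> r \<Longrightarrow> h r = (\<integral>\<^sup>+\<tau>. w \<tau> * indicator {0<..} \<tau> * indicator {r..} \<tau> \<partial>lborel)"
    and total: "(\<integral>\<^sup>+x. h (sumsq p x) \<partial>coords_lborel p) = m" "m \<noteq> 0" "m \<noteq> \<top>"
  shows "(\<integral>\<^sup>+x. H (direction p x) * h (sumsq p x) \<partial>coords_lborel p) = m * (\<integral>\<^sup>+v. H v \<partial>sphere_uniform p)"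
proof -
  define C where "C = (\<integral>\<^sup>+\<tau>. w \<tau> * indicator {0<..} \<tau> * ennreal (sqrt \<tau> ^ p) \<partial>lborel)"
  define b where "b = ball_integral p (\<lambda>_. 1) 1"
  have m: "m = C * b"
    using nn_integral_direction_layer_cake[OF w _ h, of "\<lambda>_. 1" p] total(1) by (simp add: C_def b_def)
  have b: "b \<noteq> 0" "b \<noteq> \<top>" using total(2,3) by (auto simp: m ennreal_mult_top)
  have "(\<integral>\<^sup>+x. H (direction p x) * h (sumsq p x) \<partial>coords_lborel p) = C * ball_integral p H 1"
    unfolding C_def by (rule nn_integral_direction_layer_cake[OF w H h])
  also have "ball_integral p H 1 = b * (\<integral>\<^sup>+v. H v \<partial>sphere_uniform p)"
    using b by (simp add: nn_integral_sphere_uniform[OF H] b_def[symmetric] ennreal_times_divide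
        mult_divide_eq_ennreal mult.commute[of b])
  finally show ?thesis by (simp add: m mult.assoc)
qed

section \<open>Gaussian vectors\<close>

abbreviation gauss :: "nat \<Rightarrow> (nat \<Rightarrow> real) measure" where
  "gauss p \<equiv> \<Pi>\<^sub>M i\<in>{..<p}. density lborel std_normal_density"

definition gauss_profile :: "nat \<Rightarrow> real \<Rightarrow> real" where
  "gauss_profile p r = (1 / sqrt (2 * pi)) ^ p * exp (- r / 2)"

lemma measurable_gauss_profile [measurable]: "gauss_profile p \<in> borel_measurable borel"
  unfolding gauss_profile_def by measurable

lemma gauss_profile_sumsq: "gauss_profile p (sumsq p x) = (\<Prod>i<p. std_normal_density (x i))"
  by (simp add: gauss_profile_def std_normal_density_def sumsq_def prod.distrib prod_dividef exp_sum[symmetric]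
      sum_negf sum_divide_distrib power_divide)

lemma gauss_density: "gauss p = density (coords_lborel p) (\<lambda>x. ennreal (gauss_profile p (sumsq p x)))"
  (is "_ = ?D")
proof (rule sym)
  interpret L: product_sigma_finite "\<lambda>_ :: nat. lborel :: real measure" ..
  interpret N: product_sigma_finite "\<lambda>_ :: nat. density lborel std_normal_density"
    by (simp add: product_sigma_finite_def prob_space_imp_sigma_finite prob_space_normal_density)
  show "?D = gauss p"
  proof (rule N.PiM_eqI)
    fix A :: "nat \<Rightarrow> real set" assume "\<And>i. i \<in> {..<p} \<Longrightarrow> A i \<in> sets (density lborel std_normal_density)"
    then have A: "\<And>i. i < p \<Longrightarrow> A i \<in> sets borel" by simp
    then have box: "Pi\<^sub>E {..<p} A \<in> sets (coords_lborel p)" by (intro sets_PiM_I_finite) auto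
    have "emeasure ?D (Pi\<^sub>E {..<p} A) =
        (\<integral>\<^sup>+x. ennreal (gauss_profile p (sumsq p x)) * indicator (Pi\<^sub>E {..<p} A) x \<partial>coords_lborel p)"
      using box by (subst emeasure_density) auto
    also have "\<dots> = (\<integral>\<^sup>+x. (\<Prod>i<p. ennreal (std_normal_density (x i)) * indicator (A i) (x i)) \<partial>coords_lborel p)"
    proof (intro nn_integral_cong)
      fix x assume "x \<in> space (coords_lborel p)"
      then have "indicator (Pi\<^sub>E {..<p} A) x = (\<Prod>i<p. indicator (A i) (x i) :: ennreal)"
        by (auto simp: space_PiM PiE_iff indicator_def prod_zero_iff)
      then show "ennreal (gauss_profile p (sumsq p x)) * indicator (Pi\<^sub>E {..<p} A) x =
          (\<Prod>i<p. ennreal (std_normal_density (x i)) * indicator (A i) (x i))"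
        by (simp add: gauss_profile_sumsq prod.distrib prod_ennreal)
    qed
    also have "\<dots> = (\<Prod>i<p. \<integral>\<^sup>+y. ennreal (std_normal_density y) * indicator (A i) y \<partial>lborel)"
      using A by (intro L.product_nn_integral_prod) auto
    also have "\<dots> = (\<Prod>i<p. emeasure (density lborel std_normal_density) (A i))"
      using A by (intro prod.cong refl) (simp add: emeasure_density)
    finally show "emeasure ?D (Pi\<^sub>E {..<p} A) = (\<Prod>i\<in>{..<p}. emeasure (density lborel std_normal_density) (A i))" .
  qed (auto intro!: sets_PiM_cong)
qed

lemma sets_gauss: "sets (gauss p) = sets (coords_lborel p)"
  by (intro sets_PiM_cong) auto

lemma borel_measurable_gauss: "borel_measurable (gauss p) = borel_measurable (coords_lborel p)"
  by (rule measurable_cong_sets[OF sets_gauss refl])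

lemma prob_space_gauss: "prob_space (gauss p)"
  by (rule prob_space_PiM) (simp add: prob_space_normal_density)

lemma nn_integral_gauss:
  assumes "F \<in> borel_measurable (coords_lborel p)"
  shows "(\<integral>\<^sup>+x. F x \<partial>gauss p) = (\<integral>\<^sup>+x. F x * ennreal (gauss_profile p (sumsq p x)) \<partial>coords_lborel p)"
  unfolding gauss_density using assms by (subst nn_integral_density) (auto simp: mult.commute)

lemma distr_gauss_coordinate:
  assumes "i < p"
  shows "distr (gauss p) (density lborel std_normal_density) (\<lambda>x. x i) = density lborel std_normal_density"
  using assms by (intro distr_PiM_component) (auto simp: prob_space_normal_density)

lemma nn_integral_gauss_sumsq: "(\<integral>\<^sup>+x. ennreal (sumsq p x) \<partial>gauss p) = ennreal (real p)"
proof -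
  have square: "(\<integral>\<^sup>+x. ennreal ((x i)\<^sup>2) \<partial>gauss p) = 1" if i: "i < p" for i
  proof -
    have "(\<integral>\<^sup>+x. ennreal ((x i)\<^sup>2) \<partial>gauss p) = (\<integral>\<^sup>+y. ennreal (y\<^sup>2) \<partial>density lborel std_normal_density)"
      using i by (subst distr_gauss_coordinate[OF i, symmetric], subst nn_integral_distr)
        (auto intro!: measurable_component_singleton)
    also have "\<dots> = (\<integral>\<^sup>+y. ennreal (std_normal_density y * y ^ (2 * 1)) \<partial>lborel)"
      by (subst nn_integral_density) (auto simp: ennreal_mult)
    also have "\<dots> = ennreal 1"
      using std_normal_moment_even[of 1]
      by (subst nn_integral_eq_integral) (auto simp: has_bochner_integral_iff normal_density_nonneg)
    finally show ?thesis by simp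
  qed
  have "(\<integral>\<^sup>+x. ennreal (sumsq p x) \<partial>gauss p) = (\<integral>\<^sup>+x. (\<Sum>i<p. ennreal ((x i)\<^sup>2)) \<partial>gauss p)"
    by (intro nn_integral_cong) (simp add: sumsq_def sum_ennreal)
  also have "\<dots> = (\<Sum>i<p. \<integral>\<^sup>+x. ennreal ((x i)\<^sup>2) \<partial>gauss p)"
    by (rule nn_integral_sum) (unfold borel_measurable_gauss, measurable)
  also have "\<dots> = ennreal (real p)" using square by (simp add: ennreal_of_nat_eq_real_of_nat)
  finally show ?thesis .
qed

lemma exp_layer_cake:
  assumes "0 \<le> k" "0 \<le> r"
  shows "(\<integral>\<^sup>+\<tau>. ennreal (k * exp (- \<tau> / 2) / 2) * indicator {0<..} \<tau> * indicator {r..} \<tau> \<partial>lborel) =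
    ennreal (k * exp (- r / 2))"
proof -
  have "AE \<tau> in lborel. \<tau> \<noteq> (0 :: real)" by (rule AE_lborel_singleton)
  then have "(\<integral>\<^sup>+\<tau>. ennreal (k * exp (- \<tau> / 2) / 2) * indicator {0<..} \<tau> * indicator {r..} \<tau> \<partial>lborel) =
      (\<integral>\<^sup>+\<tau>. ennreal (k * exp (- \<tau> / 2) / 2) * indicator {r..} \<tau> \<partial>lborel)"
    using assms(2) by (intro nn_integral_cong_AE) (auto elim!: eventually_mono simp: indicator_def)
  also have "\<dots> = ennreal (0 - (- (k * exp (- r / 2))))"
  proof (rule nn_integral_FTC_atLeast)
    show "((\<lambda>\<tau> :: real. - (k * exp (- \<tau> / 2))) \<longlongrightarrow> 0) at_top" by real_asymp
  qed (use assms in \<open>auto intro!: derivative_eq_intros\<close>)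
  finally show ?thesis by simp
qed

lemma linear_exp_layer_cake:
  assumes "0 \<le> k" "0 \<le> r"
  shows "(\<integral>\<^sup>+\<tau>. ennreal (k * (\<tau> * exp (- \<tau> / 2)) / 2) * indicator {0<..} \<tau> * indicator {r..} \<tau> \<partial>lborel) =
    ennreal (k * ((r + 2) * exp (- r / 2)))"
proof -
  have "(\<integral>\<^sup>+\<tau>. ennreal (k * (\<tau> * exp (- \<tau> / 2)) / 2) * indicator {0<..} \<tau> * indicator {r..} \<tau> \<partial>lborel) =
      (\<integral>\<^sup>+\<tau>. ennreal (k * (\<tau> * exp (- \<tau> / 2)) / 2) * indicator {r..} \<tau> \<partial>lborel)"
    by (intro nn_integral_cong) (use assms in \<open>auto simp: indicator_def\<close>)
  also have "\<dots> = ennreal (0 - (- (k * ((r + 2) * exp (- r / 2)))))"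
  proof (rule nn_integral_FTC_atLeast)
    fix \<tau> :: real assume "r \<le> \<tau>"
    show "((\<lambda>\<tau>. - (k * ((\<tau> + 2) * exp (- \<tau> / 2)))) has_real_derivative k * (\<tau> * exp (- \<tau> / 2)) / 2) (at \<tau>)"
      by (auto intro!: derivative_eq_intros simp: field_simps)
    show "0 \<le> k * (\<tau> * exp (- \<tau> / 2)) / 2" using \<open>r \<le> \<tau>\<close> assms by simp
  next
    show "((\<lambda>\<tau> :: real. - (k * ((\<tau> + 2) * exp (- \<tau> / 2)))) \<longlongrightarrow> 0) at_top" by real_asymp
  qed measurable
  finally show ?thesis by simp
qed

lemma nn_integral_sphere_uniform_gauss:
  assumes H[measurable]: "H \<in> borel_measurable (vec_borel p)"
  shows "(\<integral>\<^sup>+v. H v \<partial>sphere_uniform p) = (\<integral>\<^sup>+x. H (direction p x) \<partial>gauss p)"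
proof -
  note [measurable] = measurable_direction
  interpret G: prob_space "gauss p" by (rule prob_space_gauss)
  have "(\<integral>\<^sup>+x. ennreal (gauss_profile p (sumsq p x)) \<partial>coords_lborel p) = 1"
    using nn_integral_gauss[of "\<lambda>_. 1" p] G.emeasure_space_1 by simp
  from nn_integral_direction_radial[OF _ H exp_layer_cake[symmetric] this[unfolded gauss_profile_def]]
  have "(\<integral>\<^sup>+x. H (direction p x) * ennreal (gauss_profile p (sumsq p x)) \<partial>coords_lborel p) = (\<integral>\<^sup>+v. H v \<partial>sphere_uniform p)"
    by (simp add: gauss_profile_def)
  then show ?thesis by (simp add: nn_integral_gauss)
qed

text \<open>
  The direction and the squared length are uncorrelated. The summand \<open>2\<close> makes the radial profile
  \<open>(r + 2) exp (- r / 2)\<close> the tail integral of the nonnegative function \<open>\<tau> exp (- \<tau> / 2) / 2\<close>.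
\<close>

lemma nn_integral_gauss_direction_sumsq:
  assumes H[measurable]: "H \<in> borel_measurable (vec_borel p)"
  shows "(\<integral>\<^sup>+x. H (direction p x) * ennreal (sumsq p x + 2) \<partial>gauss p) =
    ennreal (real p + 2) * (\<integral>\<^sup>+x. H (direction p x) \<partial>gauss p)"
proof -
  note [measurable] = measurable_direction
  interpret G: prob_space "gauss p" by (rule prob_space_gauss)
  have profile: "ennreal (r + 2) * ennreal (gauss_profile p r) =
      ennreal ((1 / sqrt (2 * pi)) ^ p * ((r + 2) * exp (- r / 2)))" if "0 \<le> r" for r
    using that by (simp add: gauss_profile_def ennreal_mult[symmetric] mult_ac del: ennreal_plus)
  have "(\<integral>\<^sup>+x. ennreal (sumsq p x + 2) \<partial>gauss p) = (\<integral>\<^sup>+x. ennreal (sumsq p x) + 2 \<partial>gauss p)"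
    using sumsq_nonneg by (intro nn_integral_cong) simp
  also have "\<dots> = (\<integral>\<^sup>+x. ennreal (sumsq p x) \<partial>gauss p) + 2"
    by (subst nn_integral_add) (auto simp: borel_measurable_gauss G.emeasure_space_1)
  also have "\<dots> = ennreal (real p + 2)" by (simp add: nn_integral_gauss_sumsq)
  finally have total: "(\<integral>\<^sup>+x. ennreal ((1 / sqrt (2 * pi)) ^ p * ((sumsq p x + 2) * exp (- sumsq p x / 2))) \<partial>coords_lborel p) =
      ennreal (real p + 2)"
    by (simp add: nn_integral_gauss profile sumsq_nonneg del: ennreal_plus)
  have "(\<integral>\<^sup>+x. H (direction p x) * ennreal (sumsq p x + 2) \<partial>gauss p) =
      (\<integral>\<^sup>+x. H (direction p x) * ennreal ((1 / sqrt (2 * pi)) ^ p * ((sumsq p x + 2) * exp (- sumsq p x / 2))) \<partial>coords_lborel p)"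
    by (simp add: nn_integral_gauss mult.assoc profile sumsq_nonneg del: ennreal_plus)
  also have "\<dots> = ennreal (real p + 2) * (\<integral>\<^sup>+v. H v \<partial>sphere_uniform p)"
    by (rule nn_integral_direction_radial[OF _ H linear_exp_layer_cake[symmetric] total]) auto
  finally show ?thesis by (simp add: nn_integral_sphere_uniform_gauss)
qed

lemma integral_gauss_direction_sumsq:
  fixes k :: "rvec \<Rightarrow> real"
  assumes k[measurable]: "k \<in> borel_measurable (vec_borel p)" and nonneg: "\<And>v. 0 \<le> k v"
    and integrable: "integrable (gauss p) (\<lambda>x. k (direction p x))"
  shows "integrable (gauss p) (\<lambda>x. k (direction p x) * sumsq p x)"
    and "(\<integral>x. k (direction p x) * sumsq p x \<partial>gauss p) = real p * (\<integral>x. k (direction p x) \<partial>gauss p)"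
proof -
  note [measurable] = measurable_direction
  let ?k = "\<lambda>x. k (direction p x)"
  have "(\<integral>\<^sup>+x. ennreal (?k x * (sumsq p x + 2)) \<partial>gauss p) = (\<integral>\<^sup>+x. ennreal (?k x) * ennreal (sumsq p x + 2) \<partial>gauss p)"
    using nonneg sumsq_nonneg by (intro nn_integral_cong ennreal_mult) auto
  also have "\<dots> = ennreal (real p + 2) * (\<integral>\<^sup>+x. ennreal (?k x) \<partial>gauss p)"
    by (rule nn_integral_gauss_direction_sumsq) measurable
  also have "\<dots> = ennreal ((real p + 2) * (\<integral>x. ?k x \<partial>gauss p))"
    using integrable nonneg by (simp add: nn_integral_eq_integral ennreal_mult integral_nonneg del: ennreal_plus)
  finally have "has_bochner_integral (gauss p) (\<lambda>x. ?k x * (sumsq p x + 2)) ((real p + 2) * (\<integral>x. ?k x \<partial>gauss p))"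
    using nonneg sumsq_nonneg
    by (intro has_bochner_integral_nn_integral) (auto simp: borel_measurable_gauss integral_nonneg)
  from has_bochner_integral_diff[OF this has_bochner_integral_mult_right[OF has_bochner_integral_integrable[OF integrable], of 2]]
  have "has_bochner_integral (gauss p) (\<lambda>x. ?k x * sumsq p x) (real p * (\<integral>x. ?k x \<partial>gauss p))"
    by (simp add: algebra_simps)
  then show "integrable (gauss p) (\<lambda>x. ?k x * sumsq p x)"
    and "(\<integral>x. ?k x * sumsq p x \<partial>gauss p) = real p * (\<integral>x. ?k x \<partial>gauss p)"
    by (auto simp: has_bochner_integral_iff)
qed

lemma gauss_coordinate:
  assumes "i < p"
  shows "distributed (gauss p) lborel (\<lambda>x. x i) std_normal_density"
proof -
  have "distr (gauss p) lborel (\<lambda>x. x i) = distr (gauss p) (density lborel std_normal_density) (\<lambda>x. x i)"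
    by (rule distr_cong) auto
  then show ?thesis
    using assms measurable_component_singleton[of i "{..<p}" "\<lambda>_. density lborel std_normal_density"]
    by (auto simp: distributed_def distr_gauss_coordinate)
qed

lemma gauss_indep_vars:
  assumes "0 < p"
  shows "prob_space.indep_vars (gauss p) (\<lambda>_. borel) (\<lambda>i x. x i) {..<p}"
proof -
  interpret G: prob_space "gauss p" by (rule prob_space_gauss)
  let ?N = "density lborel std_normal_density"
  have coordinate: "(\<lambda>x. x i) \<in> borel_measurable (gauss p)" if "i < p" for i
    using gauss_coordinate[OF that] by (auto simp: distributed_def)
  have borel: "distr (gauss p) borel (\<lambda>x. x i) = distr (gauss p) ?N (\<lambda>x. x i)" for i
    by (rule distr_cong) auto
  have "distr (gauss p) (\<Pi>\<^sub>M i\<in>{..<p}. borel) (\<lambda>x. \<lambda>i\<in>{..<p}. x i) = distr (gauss p) (gauss p) (\<lambda>x. x)"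
    by (rule distr_cong) (auto simp: space_PiM restrict_def PiE_iff extensional_def fun_eq_iff intro!: sets_PiM_cong)
  also have "\<dots> = (\<Pi>\<^sub>M i\<in>{..<p}. distr (gauss p) borel (\<lambda>x. x i))"
    unfolding distr_id borel by (rule PiM_cong) (auto simp: distr_gauss_coordinate)
  finally show ?thesis
    using assms coordinate by (subst G.indep_vars_iff_distr_eq_PiM') (auto simp: lessThan_empty_iff)
qed

lemma gauss_linear_distributed:
  assumes e: "e \<in> unit_sphere p"
  shows "distributed (gauss p) lborel (\<lambda>x. \<Sum>i<p. e $ i * x i) std_normal_density"
proof -
  interpret G: prob_space "gauss p" by (rule prob_space_gauss)
  define I where "I = {i \<in> {..<p}. e $ i \<noteq> 0}"
  have "(\<Sum>i\<in>I. (e $ i)\<^sup>2) = (\<Sum>i<p. (e $ i)\<^sup>2)"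
    by (rule sum.mono_neutral_left) (auto simp: I_def)
  also have "\<dots> = 1" using unit_sphereD[OF e] scalar_prod_self_sum[of e p] by simp
  finally have norm_I: "(\<Sum>i\<in>I. (e $ i)\<^sup>2) = 1" .
  then have nonempty: "I \<noteq> {}" by auto
  then have p: "0 < p" by (auto simp: I_def)
  have "G.indep_vars (\<lambda>_. borel) (\<lambda>i x. x i) I"
    by (rule G.indep_vars_subset[OF gauss_indep_vars[OF p]]) (auto simp: I_def)
  then have indep: "G.indep_vars (\<lambda>_. borel) (\<lambda>i x. e $ i * x i) I"
    by (rule G.indep_vars_compose2[where Y = "\<lambda>i y. e $ i * y"]) auto
  have "distributed (gauss p) lborel (\<lambda>x. \<Sum>i\<in>I. e $ i * x i)
      (normal_density (\<Sum>i\<in>I. 0) (sqrt (\<Sum>i\<in>I. \<bar>e $ i\<bar>\<^sup>2)))"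
  proof (rule G.sum_indep_normal[OF _ nonempty indep])
    fix i assume i: "i \<in> I"
    show "0 < \<bar>e $ i\<bar>" using i by (simp add: I_def)
    have "distributed (gauss p) lborel (\<lambda>x. 0 + e $ i * x i) (normal_density (0 + e $ i * 0) (\<bar>e $ i\<bar> * 1))"
      by (rule G.normal_density_affine) (use i gauss_coordinate in \<open>auto simp: I_def\<close>)
    then show "distributed (gauss p) lborel (\<lambda>x. e $ i * x i) (normal_density 0 \<bar>e $ i\<bar>)" by simp
  qed (auto simp: I_def)
  moreover have "(\<lambda>x. \<Sum>i\<in>I. e $ i * x i) = (\<lambda>x. \<Sum>i<p. e $ i * x i)"
    by (intro ext sum.mono_neutral_left) (auto simp: I_def)
  ultimately show ?thesis by (simp add: norm_I)
qed

lemma nn_integral_std_normal_exp_square: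
  assumes l: "l < 1 / 2"
  shows "(\<integral>\<^sup>+y. ennreal (std_normal_density y) * ennreal (exp (l * y\<^sup>2)) \<partial>lborel) = ennreal (1 / sqrt (1 - 2 * l))"
proof -
  define \<sigma> where "\<sigma> = 1 / sqrt (1 - 2 * l)"
  have \<sigma>: "0 < \<sigma>" "\<sigma>\<^sup>2 = 1 / (1 - 2 * l)" using l by (auto simp: \<sigma>_def power_divide)
  have tilted: "std_normal_density y * exp (l * y\<^sup>2) = \<sigma> * normal_density 0 \<sigma> y" for y
  proof -
    have "- (y\<^sup>2) / (2 * \<sigma>\<^sup>2) = - (y\<^sup>2) / 2 + l * y\<^sup>2"
      unfolding \<sigma>(2) using l by (simp add: field_simps)
    then have "exp (- (y\<^sup>2) / (2 * \<sigma>\<^sup>2)) = exp (- (y\<^sup>2) / 2) * exp (l * y\<^sup>2)" by (simp only: exp_add)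
    moreover have "sqrt (2 * pi * \<sigma>\<^sup>2) = sqrt (2 * pi) * \<sigma>" using \<sigma>(1) by (simp only: real_sqrt_mult real_sqrt_abs abs_of_pos)
    ultimately show ?thesis using \<sigma>(1) by (simp add: normal_density_def)
  qed
  have "(\<integral>\<^sup>+y. ennreal (std_normal_density y) * ennreal (exp (l * y\<^sup>2)) \<partial>lborel) =
      (\<integral>\<^sup>+y. ennreal \<sigma> * ennreal (normal_density 0 \<sigma> y) \<partial>lborel)"
    by (intro nn_integral_cong) (use \<sigma>(1) in \<open>simp add: ennreal_mult[symmetric] tilted normal_density_nonneg\<close>)
  also have "\<dots> = ennreal \<sigma> * (\<integral>\<^sup>+y. ennreal (normal_density 0 \<sigma> y) \<partial>lborel)"
    by (rule nn_integral_cmult) simp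
  also have "(\<integral>\<^sup>+y. ennreal (normal_density 0 \<sigma> y) \<partial>lborel) = 1"
    using prob_space.emeasure_space_1[OF prob_space_normal_density[OF \<sigma>(1), of 0]]
    by (simp add: emeasure_density)
  finally show ?thesis by (simp add: \<sigma>_def)
qed

section \<open>Exponential moments on the sphere\<close>

lemma exp_tangent_mixed:
  fixes l h s m :: real
  shows "exp (l * m * h) + l * (exp (l * m * h) * h * s - m * (exp (l * m * h) * h)) \<le> exp (l * (h * s))"
proof -
  have "exp (l * m * h) * (1 + l * h * (s - m)) \<le> exp (l * m * h) * exp (l * h * (s - m))"
    by (intro mult_left_mono exp_ge_add_one_self) simp
  also have "\<dots> = exp (l * (h * s))" by (simp add: exp_add[symmetric] algebra_simps)
  finally show ?thesis by (simp add: algebra_simps)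
qed

lemma has_bochner_integral_gauss_exp_square:
  assumes e: "e \<in> unit_sphere p" and l: "l < 1 / 2"
  shows "has_bochner_integral (gauss p) (\<lambda>x. exp (l * ((e \<bullet> direction p x)\<^sup>2 * sumsq p x))) (1 / sqrt (1 - 2 * l))"
proof -
  note [measurable] = measurable_scalar_prod_const[OF unit_sphereD(1)[OF e]] measurable_direction
  have "(\<integral>\<^sup>+x. ennreal (exp (l * ((e \<bullet> direction p x)\<^sup>2 * sumsq p x))) \<partial>gauss p) =
      (\<integral>\<^sup>+y. ennreal (std_normal_density y) * ennreal (exp (l * y\<^sup>2)) \<partial>lborel)"
    unfolding scalar_prod_direction[OF unit_sphereD(1)[OF e], symmetric]
    by (rule distributed_nn_integral[OF gauss_linear_distributed[OF e], symmetric]) simp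
  also have "\<dots> = ennreal (1 / sqrt (1 - 2 * l))" by (rule nn_integral_std_normal_exp_square[OF l])
  finally show ?thesis
    using l by (intro has_bochner_integral_nn_integral) (simp_all add: borel_measurable_gauss)
qed

lemma integrable_gauss_direction:
  fixes k :: "rvec \<Rightarrow> real"
  assumes k: "k \<in> borel_measurable (vec_borel p)" and bound: "\<And>x. \<bar>k (direction p x)\<bar> \<le> b"
  shows "integrable (gauss p) (\<lambda>x. k (direction p x))"
proof -
  interpret G: prob_space "gauss p" by (rule prob_space_gauss)
  show ?thesis
    using measurable_compose[OF measurable_direction k] bound
    by (intro G.integrable_const_bound[where B = b]) (auto simp: borel_measurable_gauss)
qed

lemma scalar_prod_direction_square_le:
  assumes e: "e \<in> unit_sphere p"
  shows "(e \<bullet> direction p x)\<^sup>2 \<le> 1"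
proof -
  have "euclid_norm (direction p x) \<le> 1" by (simp add: direction_def normalized_def euclid_norm_smult)
  then have "\<bar>e \<bullet> direction p x\<bar> \<le> 1"
    using abs_scalar_prod_le[OF unit_sphereD(1)[OF e], of "direction p x"] unit_sphereD(3)[OF e] by simp
  then show ?thesis by (simp add: abs_square_le_1)
qed

lemma integrable_gauss_exp_direction:
  assumes e: "e \<in> unit_sphere p"
  shows "integrable (gauss p) (\<lambda>x. exp (a * (e \<bullet> direction p x)\<^sup>2))"
    and "integrable (gauss p) (\<lambda>x. exp (a * (e \<bullet> direction p x)\<^sup>2) * (e \<bullet> direction p x)\<^sup>2)"
proof -
  note [measurable] = measurable_scalar_prod_const[OF unit_sphereD(1)[OF e]]
  note square_le = scalar_prod_direction_square_le[OF e]
  have "a * (e \<bullet> direction p x)\<^sup>2 \<le> \<bar>a\<bar> * 1" for x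
    using square_le by (intro mult_mono) auto
  then have bound: "\<bar>exp (a * (e \<bullet> direction p x)\<^sup>2)\<bar> \<le> exp \<bar>a\<bar>" for x by simp
  then have bound_square: "\<bar>exp (a * (e \<bullet> direction p x)\<^sup>2) * (e \<bullet> direction p x)\<^sup>2\<bar> \<le> exp \<bar>a\<bar> * 1" for x
    unfolding abs_mult using square_le by (intro mult_mono) auto
  show "integrable (gauss p) (\<lambda>x. exp (a * (e \<bullet> direction p x)\<^sup>2))"
    by (rule integrable_gauss_direction[where k = "\<lambda>v. exp (a * (e \<bullet> v)\<^sup>2)", OF _ bound]) measurable
  show "integrable (gauss p) (\<lambda>x. exp (a * (e \<bullet> direction p x)\<^sup>2) * (e \<bullet> direction p x)\<^sup>2)"
    by (rule integrable_gauss_direction[where k = "\<lambda>v. exp (a * (e \<bullet> v)\<^sup>2) * (e \<bullet> v)\<^sup>2", OF _ bound_square])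
      measurable
qed

text \<open>
  Conditionally on the direction of a Gaussian vector, Jensen's inequality replaces its squared length by the
  mean \<open>p\<close>. Conditioning is avoided by integrating the tangent line inequality for the exponential at \<open>p\<close>.
\<close>

lemma sphere_uniform_mgf:
  assumes e: "e \<in> unit_sphere p" and l: "l < 1 / 2"
  shows "(\<integral>\<^sup>+v. ennreal (exp (l * real p * (e \<bullet> v)\<^sup>2)) \<partial>sphere_uniform p) \<le> ennreal (1 / sqrt (1 - 2 * l))"
proof -
  note [measurable] = measurable_scalar_prod_const[OF unit_sphereD(1)[OF e]]
  define k where "k v = exp (l * real p * (e \<bullet> v)\<^sup>2)" for v
  define kh where "kh v = k v * (e \<bullet> v)\<^sup>2" for v
  define g where "g x = exp (l * ((e \<bullet> direction p x)\<^sup>2 * sumsq p x))" for x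
  let ?tangent = "\<lambda>x. k (direction p x) + l * (kh (direction p x) * sumsq p x - real p * kh (direction p x))"
  have k_meas: "k \<in> borel_measurable (vec_borel p)" and kh_meas: "kh \<in> borel_measurable (vec_borel p)"
    unfolding k_def kh_def by measurable
  have kh_nonneg: "0 \<le> kh v" for v by (simp add: kh_def k_def)
  have integrable: "integrable (gauss p) (\<lambda>x. k (direction p x))" "integrable (gauss p) (\<lambda>x. kh (direction p x))"
    unfolding kh_def k_def by (rule integrable_gauss_exp_direction[OF e])+
  note uncorrelated = integral_gauss_direction_sumsq[OF kh_meas kh_nonneg integrable(2)]
  have g: "has_bochner_integral (gauss p) g (1 / sqrt (1 - 2 * l))"
    unfolding g_def by (rule has_bochner_integral_gauss_exp_square[OF e l])
  have "(\<integral>x. k (direction p x) \<partial>gauss p) = (\<integral>x. ?tangent x \<partial>gauss p)"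
    using uncorrelated integrable by simp
  also have "\<dots> \<le> (\<integral>x. g x \<partial>gauss p)"
  proof (rule integral_mono)
    show "integrable (gauss p) ?tangent" using uncorrelated(1) integrable by simp
    show "?tangent x \<le> g x" for x unfolding g_def kh_def k_def by (rule exp_tangent_mixed)
  qed (use g in \<open>simp add: has_bochner_integral_iff\<close>)
  also have "\<dots> = 1 / sqrt (1 - 2 * l)" using g by (simp add: has_bochner_integral_iff)
  finally have "ennreal (\<integral>x. k (direction p x) \<partial>gauss p) \<le> ennreal (1 / sqrt (1 - 2 * l))" by (rule ennreal_leI)
  moreover have "(\<integral>\<^sup>+v. ennreal (k v) \<partial>sphere_uniform p) = ennreal (\<integral>x. k (direction p x) \<partial>gauss p)"
    using integrable(1) k_meas
    by (subst nn_integral_sphere_uniform_gauss) (auto simp: k_def intro!: nn_integral_eq_integral)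
  ultimately show ?thesis by (simp add: k_def)
qed

lemma sets_sphere_uniform [simp]: "sets (sphere_uniform p) = sets (vec_borel p)"
  by (simp add: sphere_uniform_def)

lemma space_sphere_uniform [simp]: "space (sphere_uniform p) = carrier_vec p"
  using sets_eq_imp_space_eq[OF sets_sphere_uniform] by simp

lemma prob_space_sphere_uniform: "prob_space (sphere_uniform p)"
proof
  interpret G: prob_space "gauss p" by (rule prob_space_gauss)
  have "emeasure (sphere_uniform p) (space (sphere_uniform p)) = (\<integral>\<^sup>+v. 1 \<partial>sphere_uniform p)" by simp
  also have "\<dots> = 1" using nn_integral_sphere_uniform_gauss[of "\<lambda>_. 1" p] G.emeasure_space_1 by simp
  finally show "emeasure (sphere_uniform p) (space (sphere_uniform p)) = 1" .
qed

lemma AE_gauss_nonzero: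
  assumes p: "1 \<le> p"
  shows "AE x in gauss p. Matrix.vec p x \<noteq> 0\<^sub>v p"
proof -
  have "AE y in density lborel std_normal_density. y \<noteq> 0"
    using AE_lborel_singleton[of "0 :: real"] by (subst AE_density) (auto elim: eventually_mono)
  then have "AE x in gauss p. x 0 \<noteq> 0"
    using p by (intro AE_PiM_component) (auto simp: prob_space_normal_density)
  then show ?thesis
  proof eventually_elim
    case (elim x)
    moreover have "Matrix.vec p x $ 0 = x 0" "0\<^sub>v p $ 0 = (0 :: real)" using p by simp_all
    ultimately show ?case by metis
  qed
qed

lemma unit_sphere_sets: "unit_sphere p \<in> sets (vec_borel p)"
  using measurable_sets[OF measurable_scalar_prod_self[of p], of "{1}"]
  by (simp add: unit_sphere_def vimage_def Int_def conj_commute)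

lemma AE_sphere_uniform:
  assumes p: "1 \<le> p"
  shows "AE v in sphere_uniform p. v \<in> unit_sphere p"
proof -
  let ?N = "carrier_vec p - unit_sphere p"
  have N: "?N \<in> sets (vec_borel p)" using unit_sphere_sets sets.top[of "vec_borel p"] by auto
  have "AE x in gauss p. indicator ?N (direction p x) = (0 :: ennreal)"
    using AE_gauss_nonzero[OF p]
    by eventually_elim (simp add: direction_def normalized_in_unit_sphere)
  then have "(\<integral>\<^sup>+x. indicator ?N (direction p x) \<partial>gauss p) = 0"
    using measurable_compose[OF measurable_direction borel_measurable_indicator[OF N]]
    by (subst nn_integral_0_iff_AE) (simp_all add: borel_measurable_gauss)
  then have "emeasure (sphere_uniform p) ?N = 0"
    using nn_integral_sphere_uniform_gauss[of "indicator ?N" p] N by simp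
  then show ?thesis using N by (intro AE_I[where N = ?N]) auto
qed

section \<open>Elliptical samples\<close>

definition whitened :: "rmat \<Rightarrow> rvec \<Rightarrow> rvec" where
  "whitened R x = normalized (mat_inv R *\<^sub>v x)"

lemma whitened_carrier: "pos_def p R \<Longrightarrow> x \<in> carrier_vec p \<Longrightarrow> whitened R x \<in> carrier_vec p"
  by (simp add: whitened_def pos_def_mat_inv_vec)

lemma measurable_whitened:
  assumes R: "pos_def p R"
  shows "whitened R \<in> measurable (vec_borel p) (vec_borel p)"
  unfolding whitened_def
  by (intro measurable_compose[OF _ measurable_normalized] measurable_mult_mat_vec pos_def_mat_inv_mult(1)[OF R]) simp

lemma whitened_scaled_image:
  assumes R: "pos_def p R" and v: "v \<in> unit_sphere p" and u: "u \<noteq> 0"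
  shows "whitened R (u \<cdot>\<^sub>v (R *\<^sub>v v)) = sgn u \<cdot>\<^sub>v v"
proof -
  note v = unit_sphereD[OF v]
  have "mat_inv R *\<^sub>v (u \<cdot>\<^sub>v (R *\<^sub>v v)) = u \<cdot>\<^sub>v v"
    using mult_mat_vec[OF pos_def_mat_inv_mult(1)[OF R], of "R *\<^sub>v v" u] pos_def_mat_inv_vec(3)[OF R v(1)]
      pos_def_carrier[OF R] v(1) by simp
  then show ?thesis
    using v u by (intro eq_vecI) (auto simp: whitened_def normalized_def euclid_norm_smult sgn_real_def)
qed

lemma scaled_image_whitened:
  assumes R: "pos_def p R" and x: "x \<in> carrier_vec p"
  shows "x = euclid_norm (mat_inv R *\<^sub>v x) \<cdot>\<^sub>v (R *\<^sub>v whitened R x)"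
proof -
  note inv = pos_def_mat_inv_vec[OF R x]
  have "euclid_norm (mat_inv R *\<^sub>v x) \<cdot>\<^sub>v (R *\<^sub>v whitened R x) = R *\<^sub>v (euclid_norm (mat_inv R *\<^sub>v x) \<cdot>\<^sub>v whitened R x)"
    by (rule mult_mat_vec[OF pos_def_carrier[OF R] whitened_carrier[OF R x], symmetric])
  then show ?thesis using inv by (simp add: whitened_def smult_normalized)
qed

lemma elliptical_pos_def: "elliptical p \<Sigma> D \<Longrightarrow> pos_def p \<Sigma>"
  and elliptical_trace: "elliptical p \<Sigma> D \<Longrightarrow> mat_trace \<Sigma> = real p"
  and elliptical_sets: "elliptical p \<Sigma> D \<Longrightarrow> sets D = sets (vec_borel p)"
  by (auto simp: elliptical_def)

lemma elliptical_space: "elliptical p \<Sigma> D \<Longrightarrow> space D = carrier_vec p"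
  using sets_eq_imp_space_eq[OF elliptical_sets] by simp

lemma elliptical_measurable: "elliptical p \<Sigma> D \<Longrightarrow> measurable D N = measurable (vec_borel p) N"
  by (rule measurable_cong_sets[OF elliptical_sets refl])

lemma elliptical_sqrt_pos_def: "elliptical p \<Sigma> D \<Longrightarrow> pos_def p (mat_sqrt \<Sigma>)"
  by (rule mat_sqrt_pos_def(1)[OF elliptical_pos_def])

lemma measurable_elliptical_map:
  assumes R: "R \<in> carrier_mat p p" and \<mu>: "sets \<mu> = sets (borel :: real measure)"
  shows "(\<lambda>(u, v). u \<cdot>\<^sub>v (R *\<^sub>v v)) \<in> measurable (\<mu> \<Otimes>\<^sub>M sphere_uniform p) (vec_borel p)"
proof -
  have "fst \<in> borel_measurable (\<mu> \<Otimes>\<^sub>M sphere_uniform p)"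
    using measurable_fst[of \<mu> "sphere_uniform p"] measurable_cong_sets[OF refl \<mu>] by blast
  moreover have "snd \<in> measurable (\<mu> \<Otimes>\<^sub>M sphere_uniform p) (vec_borel p)"
    using measurable_snd[of \<mu> "sphere_uniform p"] measurable_cong_sets[OF refl sets_sphere_uniform] by blast
  ultimately show ?thesis
    unfolding case_prod_beta by (intro measurable_smult_vec measurable_mult_mat_vec R)
qed

lemma elliptical_prob_space:
  assumes "elliptical p \<Sigma> D"
  shows "prob_space D"
proof -
  obtain \<mu> :: "real measure" where \<mu>: "prob_space \<mu>" "sets \<mu> = sets borel"
    and D: "D = distr (\<mu> \<Otimes>\<^sub>M sphere_uniform p) (vec_borel p) (\<lambda>(u, v). u \<cdot>\<^sub>v (mat_sqrt \<Sigma> *\<^sub>v v))"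
    using assms by (auto simp: elliptical_def)
  interpret \<mu>: prob_space \<mu> by fact
  interpret S: prob_space "sphere_uniform p" by (rule prob_space_sphere_uniform)
  interpret pair_prob_space \<mu> "sphere_uniform p" ..
  show ?thesis
    unfolding D by (rule prob_space_distr[OF measurable_elliptical_map[OF pos_def_carrier[OF elliptical_sqrt_pos_def[OF assms]] \<mu>(2)]])
qed

text \<open>The radial factor only affects the sign of the whitened sample.\<close>

lemma nn_integral_elliptical_whitened:
  assumes E: "elliptical p \<Sigma> D" and p: "1 \<le> p" and F: "F \<in> borel_measurable (vec_borel p)"
    and even: "\<And>v. v \<in> carrier_vec p \<Longrightarrow> F ((- 1) \<cdot>\<^sub>v v) = F v"
  shows "(\<integral>\<^sup>+x. F (whitened (mat_sqrt \<Sigma>) x) \<partial>D) = (\<integral>\<^sup>+v. F v \<partial>sphere_uniform p)"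
proof -
  let ?R = "mat_sqrt \<Sigma>"
  obtain \<mu> :: "real measure" where \<mu>: "prob_space \<mu>" "sets \<mu> = sets borel" "AE u in \<mu>. u \<noteq> 0"
    and D: "D = distr (\<mu> \<Otimes>\<^sub>M sphere_uniform p) (vec_borel p) (\<lambda>(u, v). u \<cdot>\<^sub>v (?R *\<^sub>v v))"
    using E by (auto simp: elliptical_def)
  note R = elliptical_sqrt_pos_def[OF E]
  note map = measurable_elliptical_map[OF pos_def_carrier[OF R] \<mu>(2)]
  note FW = measurable_compose[OF measurable_whitened[OF R] F]
  interpret \<mu>: prob_space \<mu> by fact
  interpret S: prob_space "sphere_uniform p" by (rule prob_space_sphere_uniform)
  have "(\<integral>\<^sup>+x. F (whitened ?R x) \<partial>D) = (\<integral>\<^sup>+z. F (whitened ?R (case z of (u, v) \<Rightarrow> u \<cdot>\<^sub>v (?R *\<^sub>v v))) \<partial>(\<mu> \<Otimes>\<^sub>M sphere_uniform p))"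
    unfolding D by (rule nn_integral_distr[OF map]) (use FW in simp)
  also have "\<dots> = (\<integral>\<^sup>+u. \<integral>\<^sup>+v. F (whitened ?R (u \<cdot>\<^sub>v (?R *\<^sub>v v))) \<partial>sphere_uniform p \<partial>\<mu>)"
    by (subst S.nn_integral_fst[symmetric]) (use measurable_compose[OF map FW] in auto)
  also have "\<dots> = (\<integral>\<^sup>+u. \<integral>\<^sup>+v. F v \<partial>sphere_uniform p \<partial>\<mu>)"
  proof (rule nn_integral_cong_AE)
    show "AE u in \<mu>. (\<integral>\<^sup>+v. F (whitened ?R (u \<cdot>\<^sub>v (?R *\<^sub>v v))) \<partial>sphere_uniform p) = (\<integral>\<^sup>+v. F v \<partial>sphere_uniform p)"
      using \<mu>(3)
    proof eventually_elim
      case (elim u)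
      have "F (whitened ?R (u \<cdot>\<^sub>v (?R *\<^sub>v v))) = F v" if "v \<in> unit_sphere p" for v
        using even unit_sphereD[OF that] elim by (simp add: whitened_scaled_image[OF R that] sgn_real_def)
      then show ?case
        using AE_sphere_uniform[OF p] by (intro nn_integral_cong_AE) (auto elim: eventually_mono)
    qed
  qed
  also have "\<dots> = (\<integral>\<^sup>+v. F v \<partial>sphere_uniform p)" using \<mu>.emeasure_space_1 by simp
  finally show ?thesis .
qed

lemma elliptical_mgf:
  assumes E: "elliptical p \<Sigma> D" and p: "1 \<le> p" and e: "e \<in> unit_sphere p" and l: "l < 1 / 2"
  shows "(\<integral>\<^sup>+x. ennreal (exp (l * (real p * (e \<bullet> whitened (mat_sqrt \<Sigma>) x)\<^sup>2))) \<partial>D) \<le> ennreal (1 / sqrt (1 - 2 * l))"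
proof -
  note [measurable] = measurable_scalar_prod_const[OF unit_sphereD(1)[OF e]]
  have "(\<integral>\<^sup>+x. ennreal (exp (l * (real p * (e \<bullet> whitened (mat_sqrt \<Sigma>) x)\<^sup>2))) \<partial>D) =
      (\<integral>\<^sup>+v. ennreal (exp (l * (real p * (e \<bullet> v)\<^sup>2))) \<partial>sphere_uniform p)"
    by (rule nn_integral_elliptical_whitened[OF E p]) (use unit_sphereD(1)[OF e] in auto)
  then show ?thesis using sphere_uniform_mgf[OF e l] by (simp add: mult.assoc)
qed

lemma elliptical_AE_whitened:
  assumes E: "elliptical p \<Sigma> D" and p: "1 \<le> p"
  shows "AE x in D. whitened (mat_sqrt \<Sigma>) x \<in> unit_sphere p"
proof -
  let ?N = "carrier_vec p - unit_sphere p" and ?W = "whitened (mat_sqrt \<Sigma>)"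
  have N: "?N \<in> sets (vec_borel p)" using unit_sphere_sets sets.top[of "vec_borel p"] by auto
  have "(\<integral>\<^sup>+x. indicator ?N (?W x) \<partial>D) = (\<integral>\<^sup>+v. indicator ?N v \<partial>sphere_uniform p)"
    by (rule nn_integral_elliptical_whitened[OF E p borel_measurable_indicator[OF N]])
      (auto simp: indicator_def unit_sphere_def)
  also have "\<dots> = 0"
    using AE_sphere_uniform[OF p] N
    by (subst nn_integral_0_iff_AE) (auto elim: eventually_mono intro!: borel_measurable_indicator)
  finally have "AE x in D. indicator ?N (?W x) = (0 :: ennreal)"
    using measurable_compose[OF measurable_whitened[OF elliptical_sqrt_pos_def[OF E]] borel_measurable_indicator[OF N]]
    by (subst (asm) nn_integral_0_iff_AE) (simp_all add: elliptical_measurable[OF E])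
  with AE_space show ?thesis
    by eventually_elim
      (auto simp: indicator_def elliptical_space[OF E] whitened_carrier[OF elliptical_sqrt_pos_def[OF E]] split: if_splits)
qed

section \<open>Concentration\<close>

lemma chernoff_PiM:
  fixes D :: "'a measure" and n :: nat
  assumes D: "prob_space D" and g: "g \<in> borel_measurable D"
    and mgf: "(\<integral>\<^sup>+x. ennreal (exp (g x)) \<partial>D) \<le> ennreal b" and b: "0 \<le> b"
  defines "P \<equiv> \<Pi>\<^sub>M i\<in>{..<n}. D"
  shows "measure P {x \<in> space P. a \<le> (\<Sum>i<n. g (x i))} \<le> b ^ n * exp (- a)"
    and "{x \<in> space P. a \<le> (\<Sum>i<n. g (x i))} \<in> sets P"
proof -
  interpret D: prob_space D by fact
  interpret P: product_prob_space "\<lambda>_ :: nat. D" "{..<n}" ..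
  have "(\<lambda>x. g (x i)) \<in> borel_measurable P" if "i < n" for i
    unfolding P_def using that by (intro measurable_compose[OF _ g]) simp
  then have [measurable]: "(\<lambda>x. \<Sum>i<n. g (x i)) \<in> borel_measurable P"
    by (intro borel_measurable_sum) auto
  show "{x \<in> space P. a \<le> (\<Sum>i<n. g (x i))} \<in> sets P" by measurable
  have "emeasure P {x \<in> space P. a \<le> (\<Sum>i<n. g (x i))} \<le>
      ennreal (exp (- a)) * (\<integral>\<^sup>+x. ennreal (exp (\<Sum>i<n. g (x i))) * indicator (space P) x \<partial>P)"
    using Chernoff_ineq_nn_integral_ge[of 1 "space P" P "\<lambda>x. \<Sum>i<n. g (x i)" a] by simp
  also have "(\<integral>\<^sup>+x. ennreal (exp (\<Sum>i<n. g (x i))) * indicator (space P) x \<partial>P) = (\<integral>\<^sup>+x. (\<Prod>i<n. ennreal (exp (g (x i)))) \<partial>P)"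
    by (intro nn_integral_cong) (simp add: exp_sum prod_ennreal)
  also have "\<dots> = (\<Prod>i<n. \<integral>\<^sup>+x. ennreal (exp (g x)) \<partial>D)"
    unfolding P_def using g by (intro P.product_nn_integral_prod) auto
  also have "ennreal (exp (- a)) * \<dots> \<le> ennreal (exp (- a)) * ennreal (b ^ n)"
    using power_mono[OF mgf, of n] b by (intro mult_left_mono) (simp_all add: ennreal_power)
  also have "\<dots> = ennreal (b ^ n * exp (- a))"
    using b by (simp add: ennreal_mult mult.commute)
  finally have "emeasure P {x \<in> space P. a \<le> (\<Sum>i<n. g (x i))} \<le> ennreal (b ^ n * exp (- a))" .
  then show "measure P {x \<in> space P. a \<le> (\<Sum>i<n. g (x i))} \<le> b ^ n * exp (- a)"
    using b by (simp add: P_def P.emeasure_eq_measure)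
qed

lemma inverse_sqrt_le_exp:
  fixes l :: real
  assumes "\<bar>l\<bar> \<le> 1 / 4"
  shows "1 / sqrt (1 - 2 * l) \<le> exp (l + 4 * l\<^sup>2)"
proof -
  have pos: "0 < 1 - 2 * l" using assms by linarith
  have "\<bar>ln (1 + (- 2 * l)) - (- 2 * l)\<bar> \<le> 2 * (- 2 * l)\<^sup>2"
    using assms by (intro abs_ln_one_plus_x_minus_x_bound) auto
  then have "- (ln (1 - 2 * l) / 2) \<le> l + 4 * l\<^sup>2" by (simp add: abs_le_iff power2_eq_square algebra_simps)
  moreover have "1 / sqrt (1 - 2 * l) = exp (- (ln (1 - 2 * l) / 2))"
    using pos by (simp add: exp_minus inverse_eq_divide ln_sqrt[symmetric])
  ultimately show ?thesis by simp
qed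

lemma small_ball_mgf_constant: "1 + exp 4 * (1 / sqrt 32769) \<le> exp (1 / 2 :: real)"
proof -
  have "exp 4 = (exp (1 :: real)) ^ 4" by (simp add: exp_of_nat_mult[symmetric])
  also have "\<dots> \<le> (272 / 100) ^ 4" using e_less_272 by (intro power_mono) auto
  also have "\<dots> \<le> 60" by (simp add: power4_eq_xxxx)
  finally have "exp 4 \<le> (60 :: real)" .
  moreover have "1 / sqrt 32769 \<le> (1 / 180 :: real)"
    using real_le_rsqrt[of 180 32769] by (intro divide_left_mono) auto
  ultimately have "exp 4 * (1 / sqrt 32769) \<le> 60 * (1 / 180 :: real)" by (intro mult_mono) auto
  then show ?thesis using exp_ge_add_one_self[of "1 / 2 :: real"] by linarith
qed

locale elliptical_sample =
  fixes p n :: nat and \<Sigma> :: rmat and D :: "rvec measure"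
  assumes elliptical: "elliptical p \<Sigma> D" and dim_pos: "1 \<le> p" and size_pos: "0 < n"
begin

abbreviation P :: "(nat \<Rightarrow> rvec) measure" where
  "P \<equiv> \<Pi>\<^sub>M i\<in>{..<n}. D"

abbreviation whiten :: "rvec \<Rightarrow> rvec" where
  "whiten \<equiv> whitened (mat_sqrt \<Sigma>)"

sublocale prob_space P
  by (rule prob_space_PiM) (rule elliptical_prob_space[OF elliptical])

lemma sample_carrier: "x \<in> space P \<Longrightarrow> i < n \<Longrightarrow> x i \<in> carrier_vec p"
  using elliptical_space[OF elliptical] by (auto simp: space_PiM)

lemma measurable_cosine:
  assumes "e \<in> carrier_vec p"
  shows "(\<lambda>x. real p * (e \<bullet> whiten x)\<^sup>2) \<in> borel_measurable D"
proof -
  note [measurable] = measurable_compose[OF measurable_whitened[OF elliptical_sqrt_pos_def[OF elliptical]]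
    measurable_scalar_prod_const[OF assms]]
  show ?thesis unfolding elliptical_measurable[OF elliptical] by measurable
qed

lemma AE_whitened_unit: "AE x in P. \<forall>i<n. whiten (x i) \<in> unit_sphere p"
proof -
  have "AE x in P. whiten (x i) \<in> unit_sphere p" if "i < n" for i
    using that elliptical_prob_space[OF elliptical]
    by (intro AE_PiM_component elliptical_AE_whitened[OF elliptical dim_pos]) auto
  then have "AE x in P. \<forall>i\<in>{..<n}. whiten (x i) \<in> unit_sphere p" by (intro AE_finite_allI) auto
  then show ?thesis by (simp add: Ball_def)
qed

definition isotropy_failure :: "rvec \<Rightarrow> real \<Rightarrow> real \<Rightarrow> (nat \<Rightarrow> rvec) set" where
  "isotropy_failure e \<tau> \<sigma> = {x \<in> space P. real n * \<tau> \<le> \<sigma> * ((\<Sum>i<n. real p * (e \<bullet> whiten (x i))\<^sup>2) - real n)}"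

lemma isotropy_failure_tail:
  assumes e: "e \<in> unit_sphere p" and \<tau>: "0 < \<tau>" "\<tau> \<le> 1" and \<sigma>: "\<sigma> = 1 \<or> \<sigma> = - 1"
  shows "prob (isotropy_failure e \<tau> \<sigma>) \<le> exp (- real n * \<tau>\<^sup>2 / 16)" and "isotropy_failure e \<tau> \<sigma> \<in> events"
proof -
  define l where "l = \<sigma> * \<tau> / 8"
  define a where "a = \<tau> / 8 * (real n * \<tau> + \<sigma> * real n)"
  have l: "\<bar>l\<bar> \<le> 1 / 4" "l < 1 / 2" using \<tau> \<sigma> by (auto simp: l_def)
  let ?g = "\<lambda>x. l * (real p * (e \<bullet> whiten x)\<^sup>2)"
  have g: "?g \<in> borel_measurable D" using measurable_cosine[OF unit_sphereD(1)[OF e]] by measurable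
  have mgf: "(\<integral>\<^sup>+x. ennreal (exp (?g x)) \<partial>D) \<le> ennreal (exp (l + 4 * l\<^sup>2))"
    using elliptical_mgf[OF elliptical dim_pos e l(2)] inverse_sqrt_le_exp[OF l(1)] order_trans ennreal_leI by blast
  have "real n * \<tau> \<le> \<sigma> * (s - real n) \<longleftrightarrow> a \<le> l * s" for s
  proof -
    have "a \<le> l * s \<longleftrightarrow> \<tau> / 8 * (real n * \<tau> + \<sigma> * real n) \<le> \<tau> / 8 * (\<sigma> * s)" by (simp add: a_def l_def mult_ac)
    also have "\<dots> \<longleftrightarrow> real n * \<tau> + \<sigma> * real n \<le> \<sigma> * s" using \<tau> by (intro mult_le_cancel_left_pos) simp
    finally show ?thesis by (auto simp: algebra_simps)
  qed
  then have failure: "isotropy_failure e \<tau> \<sigma> = {x \<in> space P. a \<le> (\<Sum>i<n. ?g (x i))}"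
    unfolding isotropy_failure_def by (simp add: sum_distrib_left)
  note chernoff = chernoff_PiM[OF elliptical_prob_space[OF elliptical] g mgf, where n = n and a = a]
  show "isotropy_failure e \<tau> \<sigma> \<in> events" unfolding failure by (rule chernoff(2)) simp
  have "prob (isotropy_failure e \<tau> \<sigma>) \<le> exp (l + 4 * l\<^sup>2) ^ n * exp (- a)" unfolding failure by (rule chernoff(1)) simp
  also have "\<dots> = exp (real n * (l + 4 * l\<^sup>2) - a)" by (simp add: exp_of_nat_mult[symmetric] exp_add[symmetric])
  also have "real n * (l + 4 * l\<^sup>2) - a = - real n * \<tau>\<^sup>2 / 16"
    using \<sigma> by (auto simp: a_def l_def power2_eq_square field_simps)
  finally show "prob (isotropy_failure e \<tau> \<sigma>) \<le> exp (- real n * \<tau>\<^sup>2 / 16)" .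
qed

definition spread_failure :: "rvec \<Rightarrow> (nat \<Rightarrow> rvec) set" where
  "spread_failure e = {x \<in> space P. real n \<le> 3 * real (card {i. i < n \<and> real p * (e \<bullet> whiten (x i))\<^sup>2 < 1 / 2 ^ 14})}"

lemma small_ball_mgf:
  assumes e: "e \<in> unit_sphere p"
  shows "(\<integral>\<^sup>+x. ennreal (exp (if real p * (e \<bullet> whiten x)\<^sup>2 < 1 / 2 ^ 14 then 3 else 0)) \<partial>D) \<le> ennreal (exp (1 / 2))"
proof -
  interpret D: prob_space D by (rule elliptical_prob_space[OF elliptical])
  let ?Q = "\<lambda>x. real p * (e \<bullet> whiten x)\<^sup>2"
  note [measurable] = measurable_cosine[OF unit_sphereD(1)[OF e]]
  have "(\<integral>\<^sup>+x. ennreal (exp (if ?Q x < 1 / 2 ^ 14 then 3 else 0)) \<partial>D) \<le>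
      (\<integral>\<^sup>+x. 1 + ennreal (exp 4) * ennreal (exp ((- 16384) * ?Q x)) \<partial>D)"
  proof (rule nn_integral_mono)
    fix x
    have "exp (if ?Q x < 1 / 2 ^ 14 then 3 else 0) \<le> 1 + exp 4 * exp ((- 16384) * ?Q x)"
    proof (cases "?Q x < 1 / 2 ^ 14")
      case True
      then have "3 \<le> 4 + (- 16384) * ?Q x" by simp
      then have "exp 3 \<le> exp (4 + (- 16384) * ?Q x)" by simp
      then show ?thesis using True unfolding exp_add by simp
    qed simp
    then show "ennreal (exp (if ?Q x < 1 / 2 ^ 14 then 3 else 0)) \<le> 1 + ennreal (exp 4) * ennreal (exp ((- 16384) * ?Q x))"
      by (simp add: ennreal_mult[symmetric] ennreal_plus[symmetric] ennreal_1[symmetric] del: ennreal_plus ennreal_1)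
  qed
  also have "\<dots> = 1 + ennreal (exp 4) * (\<integral>\<^sup>+x. ennreal (exp ((- 16384) * ?Q x)) \<partial>D)"
    by (subst nn_integral_add, simp_all, subst nn_integral_cmult, simp_all add: D.emeasure_space_1)
  also have "\<dots> \<le> 1 + ennreal (exp 4) * ennreal (1 / sqrt (1 - 2 * (- 16384)))"
    by (intro add_mono mult_left_mono elliptical_mgf[OF elliptical dim_pos e]) auto
  also have "\<dots> = ennreal (1 + exp 4 * (1 / sqrt 32769))"
    by (simp add: ennreal_mult[symmetric] ennreal_plus[symmetric] ennreal_1[symmetric] del: ennreal_plus ennreal_1)
  also have "\<dots> \<le> ennreal (exp (1 / 2))" by (rule ennreal_leI[OF small_ball_mgf_constant])
  finally show ?thesis .
qed

lemma spread_failure_tail: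
  assumes e: "e \<in> unit_sphere p"
  shows "prob (spread_failure e) \<le> exp (- real n / 2)" and "spread_failure e \<in> events"
proof -
  let ?g = "\<lambda>x. if real p * (e \<bullet> whiten x)\<^sup>2 < 1 / 2 ^ 14 then 3 else 0 :: real"
  have g: "?g \<in> borel_measurable D" using measurable_cosine[OF unit_sphereD(1)[OF e]] by measurable
  have "(\<Sum>i<n. ?g (x i)) = 3 * real (card {i. i < n \<and> real p * (e \<bullet> whiten (x i))\<^sup>2 < 1 / 2 ^ 14})" for x
    using sum.inter_filter[of "{..<n}" "\<lambda>_. 3 :: real" "\<lambda>i. real p * (e \<bullet> whiten (x i))\<^sup>2 < 1 / 2 ^ 14"] by simp
  then have failure: "spread_failure e = {x \<in> space P. real n \<le> (\<Sum>i<n. ?g (x i))}"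
    unfolding spread_failure_def by simp
  note chernoff = chernoff_PiM[OF elliptical_prob_space[OF elliptical] g small_ball_mgf[OF e], where n = n and a = "real n"]
  show "spread_failure e \<in> events" unfolding failure by (rule chernoff(2)) simp
  have "prob (spread_failure e) \<le> exp (1 / 2) ^ n * exp (- real n)" unfolding failure by (rule chernoff(1)) simp
  also have "\<dots> = exp (- real n / 2)" by (simp add: exp_of_nat_mult[symmetric] exp_add[symmetric])
  finally show "prob (spread_failure e) \<le> exp (- real n / 2)" .
qed

end

section \<open>Nets on the unit sphere\<close>

definition sphere_net :: "nat \<Rightarrow> real \<Rightarrow> rvec set \<Rightarrow> bool" where
  "sphere_net p \<delta> \<N> \<longleftrightarrow> finite \<N> \<and> \<N> \<subseteq> unit_sphere p \<and> (\<forall>e \<in> unit_sphere p. \<exists>a \<in> \<N>. euclid_norm (e - a) \<le> \<delta>)"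

lemma sphere_netE:
  assumes "sphere_net p \<delta> \<N>" "e \<in> unit_sphere p"
  obtains a where "a \<in> \<N>" "a \<in> unit_sphere p" "euclid_norm (e - a) \<le> \<delta>"
  using assms unfolding sphere_net_def by blast

lemma form_bound_sphere_net:
  assumes H: "symmetric p H" and net: "sphere_net p (1 / 4) \<N>" and \<tau>: "0 \<le> \<tau>"
    and bound: "\<And>a. a \<in> \<N> \<Longrightarrow> \<bar>a \<bullet> (H *\<^sub>v a)\<bar> \<le> \<tau>"
  shows "form_bound p H (2 * \<tau>)"
proof -
  note H_carrier = symmetric_carrier[OF H]
  define h where "h = form_norm p H"
  have h: "0 \<le> h" "form_bound p H h"
    unfolding h_def by (rule form_norm_nonneg[OF H_carrier], rule form_bound_form_norm[OF H_carrier])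
  have "form_bound p H (\<tau> + h / 2)"
  proof (rule form_bound_if_unit_sphere[OF H_carrier])
    fix e assume e: "e \<in> unit_sphere p"
    obtain a where "a \<in> \<N>" and a: "a \<in> unit_sphere p" and near: "euclid_norm (e - a) \<le> 1 / 4"
      using net e by (rule sphere_netE)
    note e = unit_sphereD[OF e] and a = unit_sphereD[OF a]
    have carriers: "e - a \<in> carrier_vec p" "e + a \<in> carrier_vec p" using e a by auto
    have "(e - a) \<bullet> (H *\<^sub>v (e + a)) = e \<bullet> (H *\<^sub>v e) - a \<bullet> (H *\<^sub>v a)"
      using e a H_carrier form_commute[OF H e(1) a(1)]
      by (simp add: mult_add_distrib_mat_vec[OF H_carrier] scalar_prod_add_distrib[where n = p]
          minus_scalar_prod_distrib[where n = p])
    moreover have "\<bar>(e - a) \<bullet> (H *\<^sub>v (e + a))\<bar> \<le> h * euclid_norm (e - a) * euclid_norm (e + a)"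
      by (rule form_bound_bilinear[OF H h(2) carriers])
    moreover have "h * euclid_norm (e - a) * euclid_norm (e + a) \<le> h * (1 / 4) * 2"
      using h(1) near euclid_norm_add[OF e(1) a(1)] e(3) a(3) by (intro mult_mono) auto
    ultimately show "\<bar>e \<bullet> (H *\<^sub>v e)\<bar> \<le> \<tau> + h / 2" using bound[OF \<open>a \<in> \<N>\<close>] by linarith
  qed
  then have "h \<le> \<tau> + h / 2" unfolding h_def by (rule form_norm_le[rotated]) (use \<tau> h h_def in simp)
  then show ?thesis by (intro form_bound_mono[OF h(2)]) simp
qed

abbreviation int_vec :: "nat \<Rightarrow> (nat \<Rightarrow> int) \<Rightarrow> rvec" where
  "int_vec p z \<equiv> Matrix.vec p (\<lambda>i. real_of_int (z i))"

definition lattice_ball :: "nat \<Rightarrow> nat \<Rightarrow> (nat \<Rightarrow> int) set" where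
  "lattice_ball p N = {z \<in> extensional {..<p}. (\<Sum>i<p. (z i)\<^sup>2) \<le> int N}"

lemma abs_le_square_int: "\<bar>k\<bar> \<le> (k :: int)\<^sup>2"
proof (cases "k = 0")
  case False
  then have "\<bar>k\<bar> * 1 \<le> \<bar>k\<bar> * \<bar>k\<bar>" by (intro mult_left_mono) auto
  then show ?thesis by (simp add: power2_eq_square)
qed simp

lemma lattice_ball_l1:
  assumes "z \<in> lattice_ball p N"
  shows "(\<Sum>i<p. nat \<bar>z i\<bar>) \<le> N"
proof -
  have "int (\<Sum>i<p. nat \<bar>z i\<bar>) = (\<Sum>i<p. \<bar>z i\<bar>)" by simp
  also have "\<dots> \<le> (\<Sum>i<p. (z i)\<^sup>2)" by (intro sum_mono abs_le_square_int)
  also have "\<dots> \<le> int N" using assms by (simp add: lattice_ball_def)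
  finally show ?thesis by (simp only: of_nat_le_iff)
qed

lemma lattice_ball_subset: "lattice_ball p N \<subseteq> {..<p} \<rightarrow>\<^sub>E {- int N..int N}"
proof
  fix z assume z: "z \<in> lattice_ball p N"
  have "nat \<bar>z i\<bar> \<le> N" if "i < p" for i
    using member_le_sum[of i "{..<p}" "\<lambda>i. nat \<bar>z i\<bar>"] that lattice_ball_l1[OF z] by simp
  then show "z \<in> {..<p} \<rightarrow>\<^sub>E {- int N..int N}"
    using z by (auto simp: lattice_ball_def PiE_iff) (smt (verit) nat_le_iff)+
qed

lemma finite_lattice_ball: "finite (lattice_ball p N)"
  by (rule finite_subset[OF lattice_ball_subset]) (intro finite_PiE; simp)

lemma sum_half_powers_int: "(\<Sum>j\<in>{- int m..int m}. (1 / 2 :: real) ^ nat \<bar>j\<bar>) = 3 - 2 * (1 / 2) ^ m"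
proof (induction m)
  case (Suc m)
  have "{- int (Suc m)..int (Suc m)} = insert (- int (Suc m)) (insert (int (Suc m)) {- int m..int m})" by auto
  then have "(\<Sum>j\<in>{- int (Suc m)..int (Suc m)}. (1 / 2 :: real) ^ nat \<bar>j\<bar>) =
      (1 / 2) ^ Suc m + ((1 / 2) ^ Suc m + (\<Sum>j\<in>{- int m..int m}. (1 / 2 :: real) ^ nat \<bar>j\<bar>))"
    by (simp add: nat_add_distrib)
  then show ?case using Suc by simp
qed simp

text \<open>Weighting each lattice point by \<open>2 ^ (N - \<Sum>\<bar>z i\<bar>) \<ge> 1\<close> turns the count into a product of geometric sums.\<close>

lemma card_lattice_ball: "real (card (lattice_ball p N)) \<le> 2 ^ N * 3 ^ p"
proof -
  let ?Z = "{..<p} \<rightarrow>\<^sub>E {- int N..int N}"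
  have "real (card (lattice_ball p N)) = (\<Sum>z\<in>lattice_ball p N. 1)" by simp
  also have "\<dots> \<le> (\<Sum>z\<in>lattice_ball p N. 2 ^ N * (\<Prod>i<p. (1 / 2) ^ nat \<bar>z i\<bar>))"
  proof (rule sum_mono)
    fix z assume "z \<in> lattice_ball p N"
    then have "(2 :: real) ^ (\<Sum>i<p. nat \<bar>z i\<bar>) \<le> 2 ^ N" by (intro power_increasing lattice_ball_l1) auto
    moreover have "(\<Prod>i<p. (1 / 2 :: real) ^ nat \<bar>z i\<bar>) = 1 / 2 ^ (\<Sum>i<p. nat \<bar>z i\<bar>)"
      by (simp add: power_sum power_one_over prod_dividef)
    ultimately show "1 \<le> (2 :: real) ^ N * (\<Prod>i<p. (1 / 2) ^ nat \<bar>z i\<bar>)" by simp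
  qed
  also have "\<dots> \<le> (\<Sum>z\<in>?Z. 2 ^ N * (\<Prod>i<p. (1 / 2) ^ nat \<bar>z i\<bar>))"
    by (intro sum_mono2 finite_PiE lattice_ball_subset) (auto simp: prod_nonneg)
  also have "\<dots> = 2 ^ N * (\<Prod>i<p. \<Sum>j\<in>{- int N..int N}. (1 / 2) ^ nat \<bar>j\<bar>)"
    by (subst prod_sum_PiE) (auto simp: sum_distrib_left)
  also have "\<dots> \<le> 2 ^ N * (\<Prod>i<p. 3)"
    by (intro mult_left_mono prod_mono conjI sum_nonneg) (auto simp: sum_half_powers_int)
  finally show ?thesis by simp
qed

lemma round_towards_zero: "\<exists>z :: int. \<bar>real_of_int z\<bar> \<le> \<bar>y\<bar> \<and> \<bar>y - real_of_int z\<bar> \<le> 1"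
proof (cases "y \<ge> 0")
  case True
  then have "0 \<le> real_of_int \<lfloor>y\<rfloor>" by simp
  then show ?thesis using True by (intro exI[of _ "\<lfloor>y\<rfloor>"] conjI) linarith+
next
  case False
  then have "real_of_int \<lceil>y\<rceil> \<le> 0" by simp
  then show ?thesis using False by (intro exI[of _ "\<lceil>y\<rceil>"] conjI) linarith+
qed

lemma lattice_approximation:
  assumes e: "e \<in> unit_sphere p" and N: "0 < N"
  obtains z where "z \<in> lattice_ball p N" "euclid_norm (e - (1 / sqrt (real N)) \<cdot>\<^sub>v int_vec p z) \<le> sqrt (real p / real N)"
proof -
  let ?K = "sqrt (real N)"
  have K: "0 < ?K" using N by simp
  note e = unit_sphereD[OF e]
  have "\<forall>i. \<exists>z :: int. \<bar>real_of_int z\<bar> \<le> \<bar>?K * e $ i\<bar> \<and> \<bar>?K * e $ i - real_of_int z\<bar> \<le> 1"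
    by (intro allI round_towards_zero)
  then obtain z' where "\<forall>i. \<bar>real_of_int (z' i)\<bar> \<le> \<bar>?K * e $ i\<bar> \<and> \<bar>?K * e $ i - real_of_int (z' i)\<bar> \<le> 1"
    by (auto dest: choice)
  moreover define z where "z = restrict z' {..<p}"
  ultimately have z: "\<bar>real_of_int (z i)\<bar> \<le> \<bar>?K * e $ i\<bar>" "\<bar>?K * e $ i - real_of_int (z i)\<bar> \<le> 1" if "i < p" for i
    using that by auto
  show ?thesis
  proof (rule that)
    have "real_of_int (\<Sum>i<p. (z i)\<^sup>2) = (\<Sum>i<p. (real_of_int (z i))\<^sup>2)" by simp
    also have "\<dots> \<le> (\<Sum>i<p. (?K * e $ i)\<^sup>2)"
      using z(1) by (intro sum_mono) (simp add: abs_le_square_iff)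
    also have "\<dots> = real N"
      using e scalar_prod_self_sum[OF e(1)] by (simp add: power_mult_distrib sum_distrib_left[symmetric])
    finally have "(\<Sum>i<p. (z i)\<^sup>2) \<le> int N" by linarith
    then show "z \<in> lattice_ball p N" by (simp add: lattice_ball_def z_def)
    let ?a = "(1 / ?K) \<cdot>\<^sub>v int_vec p z"
    have coordinate: "(e $ i - real_of_int (z i) / ?K)\<^sup>2 \<le> 1 / real N" if "i < p" for i
    proof -
      have "\<bar>(?K * e $ i - real_of_int (z i)) / ?K\<bar> \<le> 1 / ?K"
        using z(2)[OF that] K by (simp add: abs_divide divide_right_mono)
      then have "\<bar>e $ i - real_of_int (z i) / ?K\<bar> \<le> 1 / ?K" using K by (simp add: diff_divide_distrib)
      then have "\<bar>e $ i - real_of_int (z i) / ?K\<bar>\<^sup>2 \<le> (1 / ?K)\<^sup>2" by (intro power_mono) auto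
      then show ?thesis by (simp add: power_divide)
    qed
    have "(e - ?a) \<bullet> (e - ?a) = (\<Sum>i<p. (e $ i - real_of_int (z i) / ?K)\<^sup>2)"
      using e by (subst scalar_prod_self_sum[where p = p]) auto
    also have "\<dots> \<le> (\<Sum>i<p. 1 / real N)" using coordinate by (intro sum_mono) simp
    finally show "euclid_norm (e - ?a) \<le> sqrt (real p / real N)"
      unfolding euclid_norm_def by simp
  qed
qed

lemma euclid_norm_diff_normalized:
  assumes e: "e \<in> unit_sphere p" and a: "a \<in> carrier_vec p" "a \<noteq> 0\<^sub>v p"
  shows "euclid_norm (e - normalized a) \<le> 2 * euclid_norm (e - a)"
proof -
  note e = unit_sphereD[OF e]
  have minus: "euclid_norm (x - y) = euclid_norm (y - x)" if "x \<in> carrier_vec p" "y \<in> carrier_vec p" for x y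
  proof -
    have "x - y = (- 1) \<cdot>\<^sub>v (y - x)" using that by (intro eq_vecI) auto
    then show ?thesis by (simp add: euclid_norm_smult)
  qed
  have "a - normalized a = (euclid_norm a - 1) \<cdot>\<^sub>v normalized a"
    using euclid_norm_pos[OF a] a by (intro eq_vecI) (auto simp: normalized_def field_simps)
  then have "euclid_norm (a - normalized a) = \<bar>euclid_norm a - 1\<bar>"
    using unit_sphereD(3)[OF normalized_in_unit_sphere[OF a]] by (simp add: euclid_norm_smult)
  also have "\<dots> \<le> euclid_norm (e - a)"
    using euclid_norm_le_add_minus[OF e(1) a(1)] euclid_norm_le_add_minus[OF a(1) e(1)] minus[OF e(1) a(1)] e(3)
    by linarith
  finally have "euclid_norm (a - normalized a) \<le> euclid_norm (e - a)" .
  moreover have "e - normalized a = (e - a) + (a - normalized a)"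
    using e a by (intro eq_vecI) (auto simp: normalized_def)
  ultimately show ?thesis using euclid_norm_add[of "e - a" p "a - normalized a"] e a by simp
qed

lemma sphere_net_lattice:
  assumes N: "real p < real N"
  shows "\<exists>\<N>. sphere_net p (2 * sqrt (real p / real N)) \<N> \<and> real (card \<N>) \<le> 2 ^ N * 3 ^ p"
proof -
  have N_pos: "0 < N" using N by (cases N) auto
  define Z where "Z = {z \<in> lattice_ball p N. int_vec p z \<noteq> 0\<^sub>v p}"
  define \<N> where "\<N> = (\<lambda>z. normalized (int_vec p z)) ` Z"
  have Z: "Z \<subseteq> lattice_ball p N" by (auto simp: Z_def)
  have finite: "finite Z" by (rule finite_subset[OF Z finite_lattice_ball])
  have "\<exists>a\<in>\<N>. euclid_norm (e - a) \<le> 2 * sqrt (real p / real N)" if e: "e \<in> unit_sphere p" for e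
  proof -
    let ?k = "1 / sqrt (real N)"
    obtain z where z: "z \<in> lattice_ball p N" and near: "euclid_norm (e - ?k \<cdot>\<^sub>v int_vec p z) \<le> sqrt (real p / real N)"
      using lattice_approximation[OF e N_pos] by blast
    have "sqrt (real p / real N) < 1" using N by simp
    with near have "euclid_norm (e - ?k \<cdot>\<^sub>v int_vec p z) < 1" by linarith
    moreover have "e - ?k \<cdot>\<^sub>v 0\<^sub>v p = e" using unit_sphereD(1)[OF e] by (intro eq_vecI) auto
    ultimately have nonzero: "int_vec p z \<noteq> 0\<^sub>v p" using unit_sphereD(3)[OF e] by auto
    have k: "0 < ?k" using N_pos by simp
    have scaled_nonzero: "?k \<cdot>\<^sub>v int_vec p z \<noteq> 0\<^sub>v p"
      using nonzero k by (auto simp: vec_eq_iff)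
    have "normalized (?k \<cdot>\<^sub>v int_vec p z) = normalized (int_vec p z)"
      using k by (intro eq_vecI) (auto simp: normalized_def euclid_norm_smult)
    then have "euclid_norm (e - normalized (int_vec p z)) \<le> 2 * sqrt (real p / real N)"
      using euclid_norm_diff_normalized[OF e _ scaled_nonzero] near by simp
    then show ?thesis using z nonzero by (auto simp: \<N>_def Z_def)
  qed
  then have "sphere_net p (2 * sqrt (real p / real N)) \<N>"
    using finite by (auto simp: sphere_net_def \<N>_def Z_def intro!: normalized_in_unit_sphere)
  moreover have "card \<N> \<le> card (lattice_ball p N)"
    unfolding \<N>_def by (rule order_trans[OF card_image_le[OF finite] card_mono[OF finite_lattice_ball Z]])
  ultimately show ?thesis using card_lattice_ball[of p N] by (intro exI[of _ \<N>]) linarith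
qed

lemma sphere_net_exists:
  assumes p: "1 \<le> p" and \<delta>: "0 < \<delta>" "\<delta> \<le> 1"
  shows "\<exists>\<N>. sphere_net p \<delta> \<N> \<and> real (card \<N>) \<le> exp (7 * real p / \<delta>\<^sup>2)"
proof -
  define q where "q = real p / \<delta>\<^sup>2"
  define N where "N = nat \<lceil>4 * q\<rceil>"
  have \<delta>2: "0 < \<delta>\<^sup>2" "\<delta>\<^sup>2 \<le> 1" using \<delta> by (auto simp: power_le_one)
  have q: "real p \<le> q" "1 \<le> q" "q * \<delta>\<^sup>2 = real p"
  proof -
    show "q * \<delta>\<^sup>2 = real p" using \<delta>2 by (simp add: q_def)
    have "real p * \<delta>\<^sup>2 \<le> real p * 1" using \<delta>2 by (intro mult_left_mono) auto
    then show "real p \<le> q" using \<delta>2 by (simp add: q_def pos_le_divide_eq)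
    then show "1 \<le> q" using p by linarith
  qed
  have N: "4 * q \<le> real N" "real N \<le> 4 * q + 1" using q(2) unfolding N_def by linarith+
  obtain \<N> where net: "sphere_net p (2 * sqrt (real p / real N)) \<N>" and card: "real (card \<N>) \<le> 2 ^ N * 3 ^ p"
    using sphere_net_lattice[of p N] q N by auto
  have "real p / real N \<le> real p / (4 * q)" using N q by (intro divide_left_mono) auto
  also have "\<dots> = (\<delta> / 2)\<^sup>2" using q by (simp add: field_simps)
  finally have "2 * sqrt (real p / real N) \<le> \<delta>"
    using real_le_lsqrt[of "\<delta> / 2" "real p / real N"] \<delta> by simp
  then have "sphere_net p \<delta> \<N>" using net unfolding sphere_net_def by (meson order_trans)
  moreover have "2 ^ N * 3 ^ p \<le> exp (7 * real p / \<delta>\<^sup>2)"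
  proof -
    have two: "(2 :: real) \<le> exp 1" using exp_ge_add_one_self[of "1 :: real"] by simp
    have "(3 :: real) \<le> exp 1 * exp 1" using mult_mono[OF two two] by simp
    then have "(2 :: real) ^ N * 3 ^ p \<le> exp 1 ^ N * exp 2 ^ p"
      using two by (intro mult_mono power_mono) (auto simp: exp_add[symmetric])
    also have "\<dots> = exp (real N + 2 * real p)" by (simp add: exp_of_nat_mult[symmetric] exp_add[symmetric] mult.commute)
    also have "\<dots> \<le> exp (7 * q)" using N q by simp
    finally show ?thesis by (simp add: q_def)
  qed
  ultimately show ?thesis using card by (intro exI[of _ \<N>]) linarith
qed

section \<open>From nets to the deterministic conditions\<close>

lemma cosine_less_on_net:
  assumes v: "v \<in> unit_sphere p" and e: "e \<in> carrier_vec p" and a: "a \<in> carrier_vec p"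
    and near: "euclid_norm (e - a) \<le> r" and small: "(e \<bullet> v)\<^sup>2 < r\<^sup>2" and r: "0 < r"
  shows "(a \<bullet> v)\<^sup>2 < 4 * r\<^sup>2"
proof -
  note v = unit_sphereD[OF v]
  have "\<bar>e \<bullet> v\<bar> < r" using small r abs_square_less_1 by (metis abs_of_pos power2_less_imp_less power2_abs less_imp_le)
  moreover have "\<bar>(e - a) \<bullet> v\<bar> \<le> r"
    using abs_scalar_prod_le[of "e - a" p v] near v e a by simp
  moreover have "(e - a) \<bullet> v = e \<bullet> v - a \<bullet> v" using v e a by (simp add: minus_scalar_prod_distrib[where n = p])
  ultimately have "\<bar>a \<bullet> v\<bar> < 2 * r" by linarith
  then have "\<bar>a \<bullet> v\<bar>\<^sup>2 < (2 * r)\<^sup>2" by (intro power_strict_mono) auto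
  then show ?thesis by (simp add: power_mult_distrib)
qed

text \<open>Fewer than \<open>2 n / 3\<close> samples are nearly orthogonal to \<open>e\<close> or \<open>f\<close>, and all others contribute at least \<open>q\<^sup>2\<close>.\<close>

lemma spread_unit_if_few_small_cosines:
  assumes few: "\<And>e. e \<in> unit_sphere p \<Longrightarrow> 3 * real (card {i. i < n \<and> (e \<bullet> v i)\<^sup>2 < q}) < real n"
    and q: "0 \<le> q" and e: "e \<in> unit_sphere p" and f: "f \<in> unit_sphere p"
  shows "real n / 3 * q\<^sup>2 \<le> (\<Sum>i<n. (e \<bullet> v i)\<^sup>2 * (f \<bullet> v i)\<^sup>2)"
proof -
  define B where "B e = {i. i < n \<and> (e \<bullet> v i)\<^sup>2 < q}" for e
  let ?G = "{..<n} - (B e \<union> B f)"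
  have finite: "finite (B g)" "B g \<subseteq> {..<n}" for g by (auto simp: B_def)
  have "real n - real (card (B e \<union> B f)) = real (card ?G)"
  proof -
    have "card ?G = n - card (B e \<union> B f)" using finite by (subst card_Diff_subset) auto
    moreover have "card (B e \<union> B f) \<le> n" using finite card_mono[of "{..<n}" "B e \<union> B f"] by simp
    ultimately show ?thesis by simp
  qed
  moreover have "real (card (B e \<union> B f)) \<le> real (card (B e)) + real (card (B f))"
    using card_Un_le[of "B e" "B f"] by linarith
  ultimately have "real n / 3 \<le> real (card ?G)" using few[OF e] few[OF f] unfolding B_def by linarith
  then have "real n / 3 * q\<^sup>2 \<le> real (card ?G) * q\<^sup>2" by (intro mult_right_mono) auto
  also have "\<dots> = (\<Sum>i\<in>?G. q * q)" by (simp add: power2_eq_square)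
  also have "\<dots> \<le> (\<Sum>i\<in>?G. (e \<bullet> v i)\<^sup>2 * (f \<bullet> v i)\<^sup>2)"
    using q by (intro sum_mono mult_mono) (auto simp: B_def)
  also have "\<dots> \<le> (\<Sum>i<n. (e \<bullet> v i)\<^sup>2 * (f \<bullet> v i)\<^sup>2)" by (intro sum_mono2) auto
  finally show ?thesis .
qed

lemma spread_if_spread_unit:
  assumes v: "\<And>i. i < n \<Longrightarrow> v i \<in> carrier_vec p" and e: "e \<in> carrier_vec p" and f: "f \<in> carrier_vec p"
    and unit: "\<And>e f. e \<in> unit_sphere p \<Longrightarrow> f \<in> unit_sphere p \<Longrightarrow> k \<le> (\<Sum>i<n. (e \<bullet> v i)\<^sup>2 * (f \<bullet> v i)\<^sup>2)"
  shows "k * (e \<bullet> e) * (f \<bullet> f) \<le> (\<Sum>i<n. (v i \<bullet> e)\<^sup>2 * (v i \<bullet> f)\<^sup>2)"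
proof (cases "e = 0\<^sub>v p \<or> f = 0\<^sub>v p")
  case True
  then have "(e \<bullet> e) * (f \<bullet> f) = 0" by auto
  then show ?thesis by (simp only: mult.assoc) (simp add: sum_nonneg)
next
  case False
  then have normalized: "normalized e \<in> unit_sphere p" "normalized f \<in> unit_sphere p"
    using e f by (auto intro: normalized_in_unit_sphere)
  have scale: "(v i \<bullet> g)\<^sup>2 = (g \<bullet> g) * (normalized g \<bullet> v i)\<^sup>2" if "i < n" "g \<in> carrier_vec p" for i g
    using scalar_prod_normalized[OF v[OF that(1)] that(2)] comm_scalar_prod[OF v[OF that(1)] normalized_carrier[OF that(2)]]
    by (simp add: power_mult_distrib euclid_norm_square)
  have "k * ((e \<bullet> e) * (f \<bullet> f)) \<le>
      (\<Sum>i<n. (normalized e \<bullet> v i)\<^sup>2 * (normalized f \<bullet> v i)\<^sup>2) * ((e \<bullet> e) * (f \<bullet> f))"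
    by (intro mult_right_mono unit[OF normalized] mult_nonneg_nonneg scalar_prod_self_nonneg)
  also have "\<dots> = (\<Sum>i<n. (v i \<bullet> e)\<^sup>2 * (v i \<bullet> f)\<^sup>2)"
    using scale[OF _ e] scale[OF _ f] by (simp add: sum_distrib_left sum_distrib_right mult_ac)
  finally show ?thesis by (simp add: mult.assoc)
qed

definition spread_const :: real where
  "spread_const = 1 / 2 ^ 34"

lemma spread_if_few_small_cosines_on_net:
  assumes p: "1 \<le> p" and n: "0 < n" and v: "\<And>i. i < n \<Longrightarrow> v i \<in> unit_sphere p"
    and net: "sphere_net p (1 / (256 * sqrt (real p))) \<N>"
    and few: "\<And>a. a \<in> \<N> \<Longrightarrow> 3 * real (card {i. i < n \<and> real p * (a \<bullet> v i)\<^sup>2 < 1 / 2 ^ 14}) < real n"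
    and e: "e \<in> carrier_vec p" and f: "f \<in> carrier_vec p"
  shows "spread_const / real p * (e \<bullet> e) * (f \<bullet> f) \<le> real p / real n * (\<Sum>i<n. (v i \<bullet> e)\<^sup>2 * (v i \<bullet> f)\<^sup>2)"
proof -
  define r where "r = 1 / (256 * sqrt (real p))"
  have r: "0 < r" "r\<^sup>2 = 1 / (2 ^ 16 * real p)" using p by (auto simp: r_def power_divide power_mult_distrib)
  have "3 * real (card {i. i < n \<and> (g \<bullet> v i)\<^sup>2 < r\<^sup>2}) < real n" if g: "g \<in> unit_sphere p" for g
  proof -
    obtain a where "a \<in> \<N>" and a: "a \<in> unit_sphere p" "euclid_norm (g - a) \<le> r"
      using sphere_netE[OF net g] unfolding r_def by blast
    have "real p * (a \<bullet> v i)\<^sup>2 < 1 / 2 ^ 14" if "i < n" "(g \<bullet> v i)\<^sup>2 < r\<^sup>2" for i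
    proof -
      have "(a \<bullet> v i)\<^sup>2 < 4 * r\<^sup>2"
        by (rule cosine_less_on_net[OF v[OF that(1)] unit_sphereD(1)[OF g] unit_sphereD(1)[OF a(1)] a(2) that(2) r(1)])
      then have "real p * (a \<bullet> v i)\<^sup>2 < real p * (4 * r\<^sup>2)" using p by (intro mult_strict_left_mono) auto
      also have "\<dots> = 1 / 2 ^ 14" using p by (simp add: r(2))
      finally show ?thesis .
    qed
    then have "card {i. i < n \<and> (g \<bullet> v i)\<^sup>2 < r\<^sup>2} \<le> card {i. i < n \<and> real p * (a \<bullet> v i)\<^sup>2 < 1 / 2 ^ 14}"
      by (intro card_mono) auto
    then show ?thesis using few[OF \<open>a \<in> \<N>\<close>] by linarith
  qed
  then have unit: "real n / 3 * (r\<^sup>2)\<^sup>2 \<le> (\<Sum>i<n. (e \<bullet> v i)\<^sup>2 * (f \<bullet> v i)\<^sup>2)"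
    if "e \<in> unit_sphere p" "f \<in> unit_sphere p" for e f
    using that by (intro spread_unit_if_few_small_cosines) auto
  have "real p / real n * (real n / 3 * (r\<^sup>2)\<^sup>2) = 1 / (3 * 2 ^ 32) / real p"
    unfolding r(2) using p n by (simp add: power_divide power_mult_distrib power2_eq_square[of "real p"])
  moreover have "spread_const / real p \<le> 1 / (3 * 2 ^ 32) / real p"
    by (rule divide_right_mono) (simp_all add: spread_const_def)
  ultimately have "spread_const / real p \<le> real p / real n * (real n / 3 * (r\<^sup>2)\<^sup>2)" by (simp only:)
  then have "spread_const / real p * ((e \<bullet> e) * (f \<bullet> f)) \<le>
      real p / real n * (real n / 3 * (r\<^sup>2)\<^sup>2) * ((e \<bullet> e) * (f \<bullet> f))"
    by (intro mult_right_mono mult_nonneg_nonneg scalar_prod_self_nonneg)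
  also have "\<dots> = real p / real n * (real n / 3 * (r\<^sup>2)\<^sup>2 * (e \<bullet> e) * (f \<bullet> f))" by (simp only: mult.assoc)
  also have "\<dots> \<le> real p / real n * (\<Sum>i<n. (v i \<bullet> e)\<^sup>2 * (v i \<bullet> f)\<^sup>2)"
    by (intro mult_left_mono spread_if_spread_unit[OF unit_sphereD(1)[OF v] e f] unit) auto
  finally show ?thesis by (simp only: mult.assoc)
qed

lemma isotropic_if_isotropic_on_net:
  assumes n: "0 < n" and v: "\<And>i. i < n \<Longrightarrow> v i \<in> carrier_vec p" and net: "sphere_net p (1 / 4) \<N>" and \<tau>: "0 \<le> \<tau>"
    and deviation: "\<And>a. a \<in> \<N> \<Longrightarrow> \<bar>(\<Sum>i<n. real p * (a \<bullet> v i)\<^sup>2) - real n\<bar> \<le> real n * \<tau>"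
  shows "form_bound p (scatter p n v (\<lambda>_. 1) - 1\<^sub>m p) (2 * \<tau>)"
proof (rule form_bound_sphere_net[OF symmetric_minus[OF scatter_symmetric symmetric_one] net \<tau>])
  fix a assume "a \<in> \<N>"
  then have a: "a \<in> carrier_vec p" "a \<bullet> a = 1" using net by (auto simp: sphere_net_def unit_sphere_def)
  have "a \<bullet> ((scatter p n v (\<lambda>_. 1) - 1\<^sub>m p) *\<^sub>v a) = a \<bullet> (scatter p n v (\<lambda>_. 1) *\<^sub>v a) - 1"
    using form_minus[OF scatter_carrier one_carrier_mat a(1) a(1)] a by simp
  also have "a \<bullet> (scatter p n v (\<lambda>_. 1) *\<^sub>v a) = real p / real n * (\<Sum>i<n. 1 * (v i \<bullet> a)\<^sup>2)"
    by (rule scatter_quadratic_form[OF v a(1)])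
  also have "\<dots> - 1 = ((\<Sum>i<n. real p * (a \<bullet> v i)\<^sup>2) - real n) / real n"
    using n comm_scalar_prod[OF v a(1)] by (simp add: sum_distrib_left[symmetric] field_simps)
  finally have "\<bar>a \<bullet> ((scatter p n v (\<lambda>_. 1) - 1\<^sub>m p) *\<^sub>v a)\<bar> = \<bar>(\<Sum>i<n. real p * (a \<bullet> v i)\<^sup>2) - real n\<bar> / real n"
    by (simp only: abs_divide abs_of_nat)
  then show "\<bar>a \<bullet> ((scatter p n v (\<lambda>_. 1) - 1\<^sub>m p) *\<^sub>v a)\<bar> \<le> \<tau>"
    using deviation[OF \<open>a \<in> \<N>\<close>] n by (simp only: pos_divide_le_eq of_nat_0_less_iff mult.commute)
qed

section \<open>Measurability of the event\<close>

lemma measurable_exists_zero: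
  fixes K :: "'k :: {metric_space, second_countable_topology} set" and g :: "'x \<Rightarrow> 'k \<Rightarrow> real"
  assumes K: "compact K" and cont: "\<And>x. x \<in> space M \<Longrightarrow> continuous_on K (g x)"
    and meas: "\<And>k. k \<in> K \<Longrightarrow> (\<lambda>x. g x k) \<in> borel_measurable M" and nonneg: "\<And>x k. 0 \<le> g x k"
  shows "{x \<in> space M. \<exists>k\<in>K. g x k = 0} \<in> sets M"
proof -
  obtain C where C: "countable C" "C \<subseteq> K" "K \<subseteq> closure C" using separable[of K] by blast
  have "(\<exists>k\<in>K. g x k = 0) \<longleftrightarrow> (\<forall>j :: nat. \<exists>k\<in>C. g x k < 1 / real (Suc j))" if x: "x \<in> space M" for x
  proof
    assume "\<exists>k\<in>K. g x k = 0"
    then obtain k where k: "k \<in> K" "g x k = 0" by blast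
    show "\<forall>j :: nat. \<exists>k\<in>C. g x k < 1 / real (Suc j)"
    proof
      fix j :: nat
      obtain \<delta> where \<delta>: "\<delta> > 0" "\<And>y. y \<in> K \<Longrightarrow> dist y k < \<delta> \<Longrightarrow> dist (g x y) (g x k) < 1 / real (Suc j)"
        using cont[OF x, unfolded continuous_on_iff, rule_format, OF k(1), of "1 / real (Suc j)"] by auto
      obtain y where y: "y \<in> C" "dist y k < \<delta>" using k(1) C(3) \<delta>(1) closure_approachable by blast
      then have "dist (g x y) 0 < 1 / real (Suc j)" using \<delta>(2)[of y] k(2) C(2) by auto
      then show "\<exists>k\<in>C. g x k < 1 / real (Suc j)" using y(1) by (intro bexI[of _ y]) (simp_all add: dist_real_def)
    qed
  next
    assume small: "\<forall>j :: nat. \<exists>k\<in>C. g x k < 1 / real (Suc j)"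
    then have "K \<noteq> {}" using C(2) by blast
    then obtain k where k: "k \<in> K" "\<And>y. y \<in> K \<Longrightarrow> g x k \<le> g x y"
      using continuous_attains_inf[OF K _ cont[OF x]] by blast
    have "g x k < 1 / real (Suc j)" for j using small k(2) C(2) by (meson order_le_less_trans subsetD)
    then have "\<not> 0 < g x k" using nat_approx_posE[of "g x k"] by (metis less_asym)
    then show "\<exists>k\<in>K. g x k = 0" using k(1) nonneg[of x k] by (intro bexI[of _ k]) auto
  qed
  then have "{x \<in> space M. \<exists>k\<in>K. g x k = 0} = (\<Inter>j. \<Union>k\<in>C. {x \<in> space M. g x k < 1 / real (Suc j)})"
    by auto
  also have "\<dots> \<in> sets M"
  proof (intro sets.countable_INT image_subsetI sets.countable_UN'[OF C(1)])
    fix j :: nat and k assume "k \<in> C"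
    then have "(\<lambda>x. g x k) \<in> borel_measurable M" using meas C(2) by auto
    then show "{x \<in> space M. g x k < 1 / real (Suc j)} \<in> sets M" by measurable
  qed simp
  finally show ?thesis .
qed

type_synonym entries = "nat \<times> nat \<Rightarrow> real"

definition entry_box :: "nat \<Rightarrow> nat \<Rightarrow> entries set" where
  "entry_box p m = Pi UNIV (\<lambda>ij. if ij \<in> {..<p} \<times> {..<p} then {- real m..real m} else {0})"

lemma compact_entry_box: "compact (entry_box p m)"
proof -
  let ?X = "\<lambda>ij. if ij \<in> {..<p} \<times> {..<p} then {- real m..real m} else {0}"
  have "compactin (product_topology (\<lambda>_ :: nat \<times> nat. euclidean :: real topology) UNIV) (Pi\<^sub>E UNIV ?X)"
    by (subst compactin_PiE) auto
  then show ?thesis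
    unfolding euclidean_product_topology compactin_euclidean_iff by (simp add: entry_box_def PiE_UNIV_domain)
qed

definition entries_of :: "nat \<Rightarrow> rmat \<Rightarrow> entries" where
  "entries_of p A = (\<lambda>ij. if ij \<in> {..<p} \<times> {..<p} then A $$ ij else 0)"

lemma mat_entries_of: "A \<in> carrier_mat p p \<Longrightarrow> Matrix.mat p p (entries_of p A) = A"
  by (intro eq_matI) (auto simp: entries_of_def)

lemma entries_of_mat: "k \<in> entry_box p m \<Longrightarrow> entries_of p (Matrix.mat p p k) = k"
  by (auto simp: entries_of_def entry_box_def Pi_def fun_eq_iff split: if_splits)

lemma continuous_on_entry [continuous_intros]: "continuous_on A (\<lambda>k :: entries. k ij)"
  by (rule continuous_on_subset[OF continuous_on_product_coordinates]) simp

text \<open>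
  The positive definite matrices are exhausted by the closed sets of matrices whose smallest eigenvalue is at least
  \<open>1 / (m + 1)\<close>.
\<close>

definition pos_def_box :: "nat \<Rightarrow> nat \<Rightarrow> entries set" where
  "pos_def_box p m = {k \<in> entry_box p m.
     (\<forall>a\<in>{..<p}. \<forall>b\<in>{..<p}. k (a, b) = k (b, a)) \<and>
     (\<forall>y. (\<Sum>a<p. (y a)\<^sup>2) / real (Suc m) \<le> (\<Sum>a<p. \<Sum>b<p. y a * k (a, b) * y b))}"

lemma compact_pos_def_box: "compact (pos_def_box p m)"
proof -
  let ?C = "{k :: entries. (\<forall>a\<in>{..<p}. \<forall>b\<in>{..<p}. k (a, b) = k (b, a)) \<and>
     (\<forall>y. (\<Sum>a<p. (y a)\<^sup>2) / real (Suc m) \<le> (\<Sum>a<p. \<Sum>b<p. y a * k (a, b) * y b))}"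
  have "closed ?C"
    unfolding Ball_def
    by (intro closed_Collect_conj closed_Collect_all closed_Collect_imp closed_Collect_eq closed_Collect_le
        continuous_intros open_Collect_const)
  then have "compact (entry_box p m \<inter> ?C)" by (intro compact_Int_closed compact_entry_box)
  moreover have "entry_box p m \<inter> ?C = pos_def_box p m" unfolding pos_def_box_def by blast
  ultimately show ?thesis by simp
qed

lemma pos_def_if_pos_def_box:
  assumes k: "k \<in> pos_def_box p m"
  shows "pos_def p (Matrix.mat p p k)"
proof (rule pos_defI)
  show "symmetric p (Matrix.mat p p k)" using k by (intro symmetricI) (auto simp: pos_def_box_def)
  fix x :: rvec assume x: "x \<in> carrier_vec p" "x \<noteq> 0\<^sub>v p"
  have "0 < (x \<bullet> x) / real (Suc m)" using scalar_prod_self_pos[OF x] by simp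
  also have "\<dots> \<le> (\<Sum>a<p. \<Sum>b<p. x $ a * k (a, b) * x $ b)"
    using k by (simp add: pos_def_box_def scalar_prod_self_sum[OF x(1)])
  also have "\<dots> = x \<bullet> (Matrix.mat p p k *\<^sub>v x)"
    using x(1) by (subst form_entries[where p = p]) auto
  finally show "0 < x \<bullet> (Matrix.mat p p k *\<^sub>v x)" .
qed

lemma entries_of_in_pos_def_box:
  assumes W: "pos_def p W"
  shows "\<exists>m0. \<forall>m\<ge>m0. entries_of p W \<in> pos_def_box p m"
proof -
  note W_symmetric = pos_def_symmetric[OF W] and W_carrier = pos_def_carrier[OF W]
  obtain d where d: "form_bound p W d" using form_bound_exists[OF W_carrier] by blast
  obtain c where c: "0 < c" "\<And>x. x \<in> carrier_vec p \<Longrightarrow> c * (x \<bullet> x) \<le> x \<bullet> (W *\<^sub>v x)"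
    using pos_def_lower_bound[OF W] by blast
  obtain m0 :: nat where m0: "max d (1 / c) \<le> real m0" using real_arch_simple by blast
  have "entries_of p W \<in> pos_def_box p m" if "m \<ge> m0" for m
    unfolding pos_def_box_def
  proof (intro CollectI conjI ballI allI)
    have m: "d \<le> real m" "1 / c \<le> real (Suc m)" using m0 that by auto
    have "\<bar>W $$ (a, b)\<bar> \<le> real m" if "a < p" "b < p" for a b
      using form_bound_entry[OF W_symmetric d that] m(1) by linarith
    then show "entries_of p W \<in> entry_box p m"
      by (auto simp: entries_of_def entry_box_def abs_le_iff minus_le_iff)
    show "entries_of p W (a, b) = entries_of p W (b, a)" if "a \<in> {..<p}" "b \<in> {..<p}" for a b
      using symmetric_index[OF W_symmetric, of a b] that by (simp add: entries_of_def)
    fix y :: "nat \<Rightarrow> real"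
    let ?y = "Matrix.vec p y"
    have y: "?y \<in> carrier_vec p" by simp
    have "1 / real (Suc m) \<le> c" using m(2) c(1) by (simp add: field_simps)
    then have "1 / real (Suc m) * (?y \<bullet> ?y) \<le> c * (?y \<bullet> ?y)"
      by (intro mult_right_mono scalar_prod_self_nonneg)
    also have "\<dots> \<le> ?y \<bullet> (W *\<^sub>v ?y)" by (rule c(2)[OF y])
    also have "\<dots> = (\<Sum>a<p. \<Sum>b<p. y a * entries_of p W (a, b) * y b)"
      unfolding form_entries[OF W_carrier y y] by (intro sum.cong refl) (auto simp: entries_of_def)
    finally show "(\<Sum>a<p. (y a)\<^sup>2) / real (Suc m) \<le> (\<Sum>a<p. \<Sum>b<p. y a * entries_of p W (a, b) * y b)"
      by (simp add: scalar_prod_self_sum[OF y])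
  qed
  then show ?thesis by blast
qed

definition tyler_precision :: "nat \<Rightarrow> nat \<Rightarrow> (nat \<Rightarrow> rvec) \<Rightarrow> rmat \<Rightarrow> bool" where
  "tyler_precision p n x W \<longleftrightarrow> pos_def p W \<and> tyler_solution p n x (mat_inv W)"

lemma tyler_precision_carrier: "tyler_precision p n x W \<Longrightarrow> W \<in> carrier_mat p p"
  by (simp add: tyler_precision_def pos_def_carrier)

lemma tyler_precision_mat_inv:
  assumes "tyler_solution p n x S"
  shows "tyler_precision p n x (mat_inv S)"
  using assms pos_def_mat_inv[of p S] mat_inv_mat_inv[of p S] by (auto simp: tyler_precision_def tyler_solution_def)

lemma tyler_exists_and_iff_precision:
  "tyler_exists p n x \<and> Q (mat_inv (tyler p n x)) \<longleftrightarrow>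
    (\<exists>W. tyler_precision p n x W \<and> Q W) \<and> \<not> (\<exists>V W. tyler_precision p n x V \<and> tyler_precision p n x W \<and> V \<noteq> W)"
proof
  assume Q: "tyler_exists p n x \<and> Q (mat_inv (tyler p n x))"
  then have ex1: "\<exists>!S. tyler_solution p n x S" by (simp add: tyler_exists_def)
  then have "tyler_solution p n x (tyler p n x)" unfolding tyler_def by (rule theI')
  moreover have "V = W" if "tyler_precision p n x V" "tyler_precision p n x W" for V W
    using that ex1 mat_inv_mat_inv unfolding tyler_precision_def by metis
  ultimately show "(\<exists>W. tyler_precision p n x W \<and> Q W) \<and>
      \<not> (\<exists>V W. tyler_precision p n x V \<and> tyler_precision p n x W \<and> V \<noteq> W)"
    using Q tyler_precision_mat_inv by blast
next
  assume unique: "(\<exists>W. tyler_precision p n x W \<and> Q W) \<and>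
      \<not> (\<exists>V W. tyler_precision p n x V \<and> tyler_precision p n x W \<and> V \<noteq> W)"
  then obtain W where W: "tyler_precision p n x W" "Q W" by blast
  have solution: "tyler_solution p n x (mat_inv W)" using W(1) by (simp add: tyler_precision_def)
  have eq: "S = mat_inv W" if "tyler_solution p n x S" for S
  proof -
    have "mat_inv S = W" using tyler_precision_mat_inv[OF that] W(1) unique by blast
    then show ?thesis using mat_inv_mat_inv[of p S] that by (simp add: tyler_solution_def)
  qed
  have "tyler p n x = mat_inv W" unfolding tyler_def using solution eq by blast
  moreover have "mat_inv (mat_inv W) = W" using W(1) mat_inv_mat_inv by (auto simp: tyler_precision_def)
  moreover have "tyler_exists p n x" unfolding tyler_exists_def using solution eq by blast
  ultimately show "tyler_exists p n x \<and> Q (mat_inv (tyler p n x))" using W(2) by simp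
qed

definition tyler_residual :: "nat \<Rightarrow> nat \<Rightarrow> (nat \<Rightarrow> rvec) \<Rightarrow> rmat \<Rightarrow> real" where
  "tyler_residual p n x W = (let F = scatter p n x (\<lambda>i. 1 / (x i \<bullet> (W *\<^sub>v x i))) in
     (\<Sum>a<p. \<Sum>b<p. \<bar>(F * W - 1\<^sub>m p) $$ (a, b)\<bar>) + \<bar>mat_trace F - real p\<bar>)"

lemma tyler_residual_nonneg: "0 \<le> tyler_residual p n x W"
  unfolding tyler_residual_def Let_def by (intro add_nonneg_nonneg sum_nonneg abs_ge_zero)

lemma tyler_residual_eq_0_iff:
  assumes W: "pos_def p W"
  shows "tyler_residual p n x W = 0 \<longleftrightarrow> tyler_precision p n x W"
proof -
  define F where "F = tyler_map p n x (mat_inv W)"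
  have F: "F = scatter p n x (\<lambda>i. 1 / (x i \<bullet> (W *\<^sub>v x i)))" "F \<in> carrier_mat p p"
    unfolding F_def tyler_map_def mat_inv_mat_inv[OF W] by simp_all
  note W_carrier = pos_def_carrier[OF W]
  have "tyler_residual p n x W = 0 \<longleftrightarrow> (\<forall>a<p. \<forall>b<p. (F * W - 1\<^sub>m p) $$ (a, b) = 0) \<and> mat_trace F = real p"
    unfolding tyler_residual_def Let_def F(1)[symmetric]
    by (subst add_nonneg_eq_0_iff) (auto simp: sum_nonneg sum_nonneg_eq_0_iff)
  also have "\<dots> \<longleftrightarrow> F * W = 1\<^sub>m p \<and> mat_trace F = real p"
    using F(2) W_carrier by (auto simp: mat_eq_iff)
  also have "F * W = 1\<^sub>m p \<longleftrightarrow> F = mat_inv W"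
    using mat_inv_eqI[OF W_carrier F(2) mat_mult_left_right_inverse[OF F(2) W_carrier]] pos_def_mat_inv_mult(3)[OF W]
    by auto
  finally show ?thesis
    using W pos_def_mat_inv[OF W] by (auto simp: tyler_precision_def tyler_solution_iff F_def[symmetric])
qed

definition precision_scatter :: "nat \<Rightarrow> nat \<Rightarrow> (nat \<Rightarrow> rvec) \<Rightarrow> entries \<Rightarrow> nat \<Rightarrow> nat \<Rightarrow> real" where
  "precision_scatter p n x k a b =
     real p / real n * (\<Sum>i<n. x i $ a * x i $ b * (1 / (\<Sum>c<p. \<Sum>d<p. x i $ c * k (c, d) * x i $ d)))"

lemma tyler_residual_entries:
  assumes x: "\<And>i. i < n \<Longrightarrow> x i \<in> carrier_vec p"
  shows "tyler_residual p n x (Matrix.mat p p k) =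
    (\<Sum>a<p. \<Sum>b<p. \<bar>(\<Sum>c<p. precision_scatter p n x k a c * k (c, b)) - (if a = b then 1 else 0)\<bar>) +
    \<bar>(\<Sum>a<p. precision_scatter p n x k a a) - real p\<bar>"
proof -
  have "x i \<bullet> (Matrix.mat p p k *\<^sub>v x i) = (\<Sum>c<p. \<Sum>d<p. x i $ c * k (c, d) * x i $ d)" if "i < n" for i
    using x[OF that] by (subst form_entries[where p = p]) auto
  then have "scatter p n x (\<lambda>i. 1 / (x i \<bullet> (Matrix.mat p p k *\<^sub>v x i))) =
      Matrix.mat p p (\<lambda>(a, b). precision_scatter p n x k a b)"
    by (intro eq_matI) (simp_all add: scatter_def precision_scatter_def)
  then show ?thesis
    by (simp add: tyler_residual_def mat_trace_def scalar_prod_def atLeast0LessThan)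
qed

lemma continuous_on_precision_scatter:
  assumes x: "\<And>i. i < n \<Longrightarrow> x i \<in> carrier_vec p" and ab: "a < p" "b < p"
  shows "continuous_on (pos_def_box p m) (\<lambda>k. precision_scatter p n x k a b)"
  unfolding precision_scatter_def
proof (rule continuous_on_mult_left, rule continuous_on_sum)
  fix i assume "i \<in> {..<n}"
  then have x: "x i \<in> carrier_vec p" using x by simp
  let ?form = "\<lambda>k. \<Sum>c<p. \<Sum>d<p. x i $ c * k (c, d) * x i $ d"
  show "continuous_on (pos_def_box p m) (\<lambda>k. x i $ a * x i $ b * (1 / ?form k))"
  proof (cases "x i = 0\<^sub>v p")
    case False
    have "?form k \<noteq> 0" if "k \<in> pos_def_box p m" for k
      using pos_def_pos[OF pos_def_if_pos_def_box[OF that] x False] x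
      by (subst (asm) form_entries[where p = p]) auto
    then show ?thesis by (intro continuous_intros) auto
  qed (use ab in simp)
qed

lemma continuous_on_tyler_residual:
  assumes x: "\<And>i. i < n \<Longrightarrow> x i \<in> carrier_vec p"
  shows "continuous_on (pos_def_box p m) (\<lambda>k. tyler_residual p n x (Matrix.mat p p k))"
  using x by (simp only: tyler_residual_entries) (intro continuous_intros continuous_on_precision_scatter; simp)

lemma measurable_tyler_residual:
  assumes x: "\<And>x i. x \<in> space M \<Longrightarrow> i < n \<Longrightarrow> x i \<in> carrier_vec p"
    and meas: "\<And>i a. i < n \<Longrightarrow> a < p \<Longrightarrow> (\<lambda>x. x i $ a) \<in> borel_measurable M"
  shows "(\<lambda>x. tyler_residual p n x (Matrix.mat p p k)) \<in> borel_measurable M"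
proof (subst measurable_cong[OF tyler_residual_entries[OF x]])
  have "(\<lambda>x. precision_scatter p n x k a b) \<in> borel_measurable M" if "a < p" "b < p" for a b
    unfolding precision_scatter_def
    by (intro borel_measurable_sum borel_measurable_times borel_measurable_divide borel_measurable_const meas)
      (use that in auto)
  then show "(\<lambda>x. (\<Sum>a<p. \<Sum>b<p. \<bar>(\<Sum>c<p. precision_scatter p n x k a c * k (c, b)) - (if a = b then 1 else 0)\<bar>) +
      \<bar>(\<Sum>a<p. precision_scatter p n x k a a) - real p\<bar>) \<in> borel_measurable M"
    by (intro borel_measurable_add borel_measurable_sum borel_measurable_abs borel_measurable_diff
        borel_measurable_times borel_measurable_const) auto
qed

lemma tyler_precision_pair_iff_residual:
  "(\<exists>V W. tyler_precision p n x V \<and> tyler_precision p n x W \<and> (entries_of p V, entries_of p W) \<in> C) \<longleftrightarrow>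
    (\<exists>m. \<exists>k\<in>(pos_def_box p m \<times> pos_def_box p m) \<inter> C.
      tyler_residual p n x (Matrix.mat p p (fst k)) + tyler_residual p n x (Matrix.mat p p (snd k)) = 0)"
  (is "?pair \<longleftrightarrow> (\<exists>m. \<exists>k\<in>?K m. ?r (fst k) + ?r (snd k) = 0)")
proof
  assume ?pair
  then obtain V W where VW: "tyler_precision p n x V" "tyler_precision p n x W"
    and C: "(entries_of p V, entries_of p W) \<in> C" by blast
  then have pos_def: "pos_def p V" "pos_def p W" by (auto simp: tyler_precision_def)
  obtain m where "entries_of p V \<in> pos_def_box p m" "entries_of p W \<in> pos_def_box p m"
    using entries_of_in_pos_def_box[OF pos_def(1)] entries_of_in_pos_def_box[OF pos_def(2)] by (meson linear)
  then have "(entries_of p V, entries_of p W) \<in> ?K m" using C by simp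
  moreover have "?r (entries_of p V) = 0" "?r (entries_of p W) = 0"
    using VW pos_def by (simp_all add: tyler_residual_eq_0_iff mat_entries_of pos_def_carrier)
  ultimately show "\<exists>m. \<exists>k\<in>?K m. ?r (fst k) + ?r (snd k) = 0"
    by (intro exI[of _ m] bexI[of _ "(entries_of p V, entries_of p W)"]) auto
next
  assume "\<exists>m. \<exists>k\<in>?K m. ?r (fst k) + ?r (snd k) = 0"
  then obtain m k l where kl: "k \<in> pos_def_box p m" "l \<in> pos_def_box p m" "(k, l) \<in> C" and zero: "?r k + ?r l = 0"
    by auto
  have "?r k = 0" "?r l = 0"
    using zero tyler_residual_nonneg[of p n x] by (simp_all add: add_nonneg_eq_0_iff)
  then have "tyler_precision p n x (Matrix.mat p p k)" "tyler_precision p n x (Matrix.mat p p l)"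
    using tyler_residual_eq_0_iff pos_def_if_pos_def_box kl(1,2) by blast+
  moreover have "entries_of p (Matrix.mat p p k) = k" "entries_of p (Matrix.mat p p l) = l"
    using kl by (auto simp: pos_def_box_def entries_of_mat)
  ultimately show ?pair using kl(3) by metis
qed

lemma sets_tyler_precision_pair:
  assumes x: "\<And>x i. x \<in> space M \<Longrightarrow> i < n \<Longrightarrow> x i \<in> carrier_vec p"
    and meas: "\<And>i a. i < n \<Longrightarrow> a < p \<Longrightarrow> (\<lambda>x. x i $ a) \<in> borel_measurable M"
    and C: "closed C"
  shows "{x \<in> space M. \<exists>V W. tyler_precision p n x V \<and> tyler_precision p n x W \<and> (entries_of p V, entries_of p W) \<in> C} \<in> sets M"
proof -
  define K where "K m = (pos_def_box p m \<times> pos_def_box p m) \<inter> C" for m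
  let ?r = "\<lambda>x k. tyler_residual p n x (Matrix.mat p p k)"
  have "{x \<in> space M. \<exists>V W. tyler_precision p n x V \<and> tyler_precision p n x W \<and> (entries_of p V, entries_of p W) \<in> C} =
      (\<Union>m. {x \<in> space M. \<exists>k\<in>K m. ?r x (fst k) + ?r x (snd k) = 0})"
    unfolding tyler_precision_pair_iff_residual K_def by auto
  also have "\<dots> \<in> sets M"
  proof (intro sets.countable_UN image_subsetI measurable_exists_zero)
    fix m
    show "compact (K m)" unfolding K_def by (intro compact_Int_closed compact_Times compact_pos_def_box C)
    show "continuous_on (K m) (\<lambda>k. ?r x (fst k) + ?r x (snd k))" if "x \<in> space M" for x
      by (intro continuous_on_add; rule continuous_on_compose2[OF continuous_on_tyler_residual[OF x[OF that]]])
        (auto simp: K_def intro: continuous_intros)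
  qed (auto intro!: borel_measurable_add measurable_tyler_residual x meas add_nonneg_nonneg tyler_residual_nonneg)
  finally show ?thesis .
qed

lemma continuous_on_frobenius_norm_conjugate:
  assumes R: "R \<in> carrier_mat p p"
  shows "continuous_on UNIV (\<lambda>k :: entries. frobenius_norm (1\<^sub>m p - R * Matrix.mat p p k * R))"
proof -
  have "frobenius_norm (1\<^sub>m p - R * Matrix.mat p p k * R) = sqrt (\<Sum>a<p. \<Sum>b<p.
      ((if a = b then 1 else 0) - (\<Sum>d<p. (\<Sum>c<p. R $$ (a, c) * k (c, d)) * R $$ (d, b)))\<^sup>2)" for k
    unfolding frobenius_norm_def using R
    by (auto simp: scalar_prod_def atLeast0LessThan intro!: arg_cong[where f = sqrt] sum.cong)
  then show ?thesis by (auto intro!: continuous_intros)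
qed

lemma pos_iff_ge_inverse_Suc: "0 < (y :: real) \<longleftrightarrow> (\<exists>j. 1 / real (Suc j) \<le> y)"
proof
  assume "0 < y"
  then obtain j where "1 / real (Suc j) < y" by (rule nat_approx_posE)
  then show "\<exists>j. 1 / real (Suc j) \<le> y" by (auto intro: less_imp_le)
next
  assume "\<exists>j. 1 / real (Suc j) \<le> y"
  then obtain j where "1 / real (Suc j) \<le> y" by blast
  moreover have "0 < 1 / real (Suc j)" by simp
  ultimately show "0 < y" by linarith
qed

lemma sets_tyler_event:
  assumes x: "\<And>x i. x \<in> space M \<Longrightarrow> i < n \<Longrightarrow> x i \<in> carrier_vec p"
    and meas: "\<And>i a. i < n \<Longrightarrow> a < p \<Longrightarrow> (\<lambda>x. x i $ a) \<in> borel_measurable M"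
    and R: "R \<in> carrier_mat p p"
  shows "{x \<in> space M. tyler_exists p n x \<and> frobenius_norm (1\<^sub>m p - R * mat_inv (tyler p n x) * R) \<le> \<epsilon>} \<in> sets M"
proof -
  let ?pairs = "\<lambda>C. {x \<in> space M. \<exists>V W. tyler_precision p n x V \<and> tyler_precision p n x W \<and>
    (entries_of p V, entries_of p W) \<in> C}"
  let ?near = "{kl :: entries \<times> entries. frobenius_norm (1\<^sub>m p - R * Matrix.mat p p (fst kl) * R) \<le> \<epsilon>}"
  let ?apart = "\<lambda>j. {kl :: entries \<times> entries. 1 / real (Suc j) \<le> dist (fst kl) (snd kl)}"
  have near: "(\<exists>W. tyler_precision p n x W \<and> frobenius_norm (1\<^sub>m p - R * W * R) \<le> \<epsilon>) \<longleftrightarrow>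
      (\<exists>V W. tyler_precision p n x V \<and> tyler_precision p n x W \<and> (entries_of p V, entries_of p W) \<in> ?near)" for x
    by (simp add: mat_entries_of tyler_precision_carrier cong: conj_cong) blast
  have "V \<noteq> W \<longleftrightarrow> (\<exists>j. (entries_of p V, entries_of p W) \<in> ?apart j)"
    if "tyler_precision p n x V" "tyler_precision p n x W" for x V W
  proof -
    have "V \<noteq> W \<longleftrightarrow> 0 < dist (entries_of p V) (entries_of p W)"
      using that[THEN tyler_precision_carrier, THEN mat_entries_of] by (metis zero_less_dist_iff)
    then show ?thesis by (simp add: pos_iff_ge_inverse_Suc)
  qed
  then have apart: "(\<exists>V W. tyler_precision p n x V \<and> tyler_precision p n x W \<and> V \<noteq> W) \<longleftrightarrow>
      (\<exists>j V W. tyler_precision p n x V \<and> tyler_precision p n x W \<and> (entries_of p V, entries_of p W) \<in> ?apart j)" for x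
    by (simp cong: conj_cong) blast
  have "{x \<in> space M. tyler_exists p n x \<and> frobenius_norm (1\<^sub>m p - R * mat_inv (tyler p n x) * R) \<le> \<epsilon>} =
      ?pairs ?near - (\<Union>j. ?pairs (?apart j))"
    using tyler_exists_and_iff_precision[of p n _ "\<lambda>W. frobenius_norm (1\<^sub>m p - R * W * R) \<le> \<epsilon>"]
    unfolding near apart by blast
  also have "\<dots> \<in> sets M"
    by (intro sets.Diff sets.countable_UN image_subsetI sets_tyler_precision_pair x meas closed_Collect_le
        continuous_on_compose2[OF continuous_on_frobenius_norm_conjugate[OF R]] continuous_intros) auto
  finally show ?thesis .
qed

section \<open>Failure probability\<close>

lemma (in finite_measure) measure_UNION_le_card:
  assumes "finite I" and "\<And>i. i \<in> I \<Longrightarrow> A i \<in> sets M" and bound: "\<And>i. i \<in> I \<Longrightarrow> measure M (A i) \<le> r"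
  shows "measure M (\<Union>i\<in>I. A i) \<le> real (card I) * r"
proof -
  have "measure M (\<Union>i\<in>I. A i) \<le> (\<Sum>i\<in>I. measure M (A i))" using assms by (intro measure_UNION_le)
  also have "\<dots> \<le> real (card I) * r" using bound by (rule sum_bounded_above)
  finally show ?thesis .
qed

context elliptical_sample
begin

definition good_event :: "real \<Rightarrow> (nat \<Rightarrow> rvec) set" where
  "good_event \<epsilon> = {x \<in> space P. tyler_exists p n x \<and>
     frobenius_norm (1\<^sub>m p - mat_sqrt \<Sigma> * mat_inv (tyler p n x) * mat_sqrt \<Sigma>) \<le> \<epsilon>}"

lemma sets_good_event: "good_event \<epsilon> \<in> events"
  unfolding good_event_def
proof (rule sets_tyler_event)
  show "x i \<in> carrier_vec p" if "x \<in> space P" "i < n" for x i by (rule sample_carrier[OF that])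
  show "mat_sqrt \<Sigma> \<in> carrier_mat p p" by (rule pos_def_carrier[OF elliptical_sqrt_pos_def[OF elliptical]])
  fix i a assume ia: "i < n" "a < p"
  have "(\<lambda>v. v $ a) \<in> borel_measurable D"
    unfolding elliptical_measurable[OF elliptical] by (rule measurable_vec_borel_index[OF ia(2)])
  then show "(\<lambda>x. x i $ a) \<in> borel_measurable P"
    using ia(1) by (intro measurable_compose[OF measurable_component_singleton]) auto
qed

lemma well_spread_if_no_failure:
  assumes x: "x \<in> space P" and unit: "\<forall>i<n. whiten (x i) \<in> unit_sphere p" and \<tau>: "0 \<le> \<tau>"
    and coarse: "sphere_net p (1 / 4) \<N>" and fine: "sphere_net p (1 / (256 * sqrt (real p))) \<F>"
    and isotropy: "\<And>a \<sigma>. a \<in> \<N> \<Longrightarrow> \<sigma> \<in> {1, - 1} \<Longrightarrow> x \<notin> isotropy_failure a \<tau> \<sigma>"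
    and spread: "\<And>a. a \<in> \<F> \<Longrightarrow> x \<notin> spread_failure a"
  shows "well_spread_sample p n (\<lambda>i. whiten (x i)) spread_const (2 * \<tau>)"
proof
  show "form_bound p (scatter p n (\<lambda>i. whiten (x i)) (\<lambda>_. 1) - 1\<^sub>m p) (2 * \<tau>)"
  proof (rule isotropic_if_isotropic_on_net[OF size_pos _ coarse \<tau>])
    show "\<bar>(\<Sum>i<n. real p * (a \<bullet> whiten (x i))\<^sup>2) - real n\<bar> \<le> real n * \<tau>" if "a \<in> \<N>" for a
      using isotropy[OF that, of 1] isotropy[OF that, of "- 1"] x by (simp add: isotropy_failure_def)
  qed (use unit unit_sphereD(1) in blast)
  show "spread_const / real p * (e \<bullet> e) * (f \<bullet> f) \<le> real p / real n * (\<Sum>i<n. (whiten (x i) \<bullet> e)\<^sup>2 * (whiten (x i) \<bullet> f)\<^sup>2)"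
    if "e \<in> carrier_vec p" "f \<in> carrier_vec p" for e f
    using unit spread x that
    by (intro spread_if_few_small_cosines_on_net[OF dim_pos size_pos _ fine]) (auto simp: spread_failure_def not_le)
qed (use unit dim_pos size_pos in \<open>auto simp: spread_const_def\<close>)

lemma good_event_if_well_spread:
  assumes x: "x \<in> space P" and unit: "\<forall>i<n. whiten (x i) \<in> unit_sphere p"
    and sample: "well_spread_sample p n (\<lambda>i. whiten (x i)) spread_const t"
    and d: "0 < d" "d \<le> spread_const / 80" and t: "t \<le> spread_const * d / 2"
  shows "x \<in> good_event (4 * d * sqrt (real p))"
proof -
  let ?R = "mat_sqrt \<Sigma>"
  note R = elliptical_sqrt_pos_def[OF elliptical]
  define u where "u i = euclid_norm (mat_inv ?R *\<^sub>v x i)" for i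
  have "u i \<noteq> 0" if "i < n" for i
  proof
    assume "u i = 0"
    then have "whiten (x i) \<bullet> whiten (x i) = 0" by (simp add: u_def whitened_def normalized_def)
    then show False using unit that by (simp add: unit_sphere_def)
  qed
  moreover have "x i = u i \<cdot>\<^sub>v (?R *\<^sub>v whiten (x i))" if "i < n" for i
    unfolding u_def by (rule scaled_image_whitened[OF R sample_carrier[OF x that]])
  ultimately show ?thesis
    using tyler_estimate[OF elliptical_pos_def[OF elliptical] elliptical_trace[OF elliptical] sample d t, of u x] x
    by (auto simp: good_event_def)
qed

lemma good_event_union_bound:
  assumes \<tau>: "0 < \<tau>" "\<tau> \<le> 1" and d: "0 < d" "d \<le> spread_const / 80" and \<tau>d: "2 * \<tau> \<le> spread_const * d / 2"
    and coarse: "sphere_net p (1 / 4) \<N>" and fine: "sphere_net p (1 / (256 * sqrt (real p))) \<F>"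
  shows "1 - (2 * real (card \<N>) * exp (- real n * \<tau>\<^sup>2 / 16) + real (card \<F>) * exp (- real n / 2))
    \<le> prob (good_event (4 * d * sqrt (real p)))"
proof -
  let ?good = "good_event (4 * d * sqrt (real p))" and ?I = "\<N> \<times> {1, - 1 :: real}"
  define A where "A = (\<Union>(a, \<sigma>)\<in>?I. isotropy_failure a \<tau> \<sigma>)"
  define B where "B = (\<Union>a\<in>\<F>. spread_failure a)"
  have nets: "finite \<N>" "finite \<F>" "\<And>a. a \<in> \<N> \<Longrightarrow> a \<in> unit_sphere p" "\<And>a. a \<in> \<F> \<Longrightarrow> a \<in> unit_sphere p"
    using coarse fine by (auto simp: sphere_net_def)
  note isotropy_tail = isotropy_failure_tail[OF nets(3) \<tau>] and spread_tail = spread_failure_tail[OF nets(4)]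
  have "prob A \<le> real (card ?I) * exp (- real n * \<tau>\<^sup>2 / 16)"
    unfolding A_def by (rule measure_UNION_le_card) (use nets isotropy_tail in auto)
  moreover have "prob B \<le> real (card \<F>) * exp (- real n / 2)"
    unfolding B_def by (rule measure_UNION_le_card) (use nets spread_tail in auto)
  moreover have "card ?I = 2 * card \<N>" by (simp add: card_cartesian_product)
  moreover have events: "A \<in> events" "B \<in> events"
    unfolding A_def B_def using nets isotropy_tail(2) spread_tail(2) by (auto intro!: sets.finite_UN)
  then have "prob (A \<union> B) \<le> prob A + prob B" by (rule measure_Un_le)
  moreover have "prob (space P - ?good) \<le> prob (A \<union> B)"
  proof (rule finite_measure_mono_AE)
    have good: "x \<in> ?good" if "x \<in> space P" "\<forall>i<n. whiten (x i) \<in> unit_sphere p" "x \<notin> A \<union> B" for x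
    proof (rule good_event_if_well_spread[OF that(1,2) _ d \<tau>d])
      show "well_spread_sample p n (\<lambda>i. whiten (x i)) spread_const (2 * \<tau>)"
        using that(3) \<tau>(1) by (intro well_spread_if_no_failure[OF that(1,2) _ coarse fine]) (auto simp: A_def B_def)
    qed
    show "AE x in P. x \<in> space P - ?good \<longrightarrow> x \<in> A \<union> B"
      using AE_whitened_unit by eventually_elim (use good in blast)
  qed (use events in auto)
  ultimately show ?thesis using prob_compl[OF sets_good_event, of "4 * d * sqrt (real p)"] by simp
qed

end

definition rate_const :: real where
  "rate_const = spread_const\<^sup>2 / 4096"

lemma rate_const_bounds: "0 < rate_const" "rate_const \<le> 1 / 2 ^ 13"
  by (simp_all add: rate_const_def spread_const_def power_divide)

text \<open>The factors \<open>112 = 7 \<cdot> 4\<^sup>2\<close> and \<open>458752 = 7 \<cdot> 256\<^sup>2\<close> come from the sizes of the two nets.\<close>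

lemma failure_probability_bound:
  fixes X k :: real
  assumes p: "1 \<le> p" and k: "0 < k" "k \<le> 1 / 2 ^ 13" and X: "300 / k \<le> X"
  shows "2 * exp (112 * real p) * exp (- (k * X * real p)) + exp (458752 * (real p)\<^sup>2) * exp (- (X * (real p)\<^sup>2 / 2))
    \<le> exp (- (k / 2 * X))"
proof -
  have kX: "300 \<le> k * X" using k X by (simp add: field_simps)
  have "2457600 \<le> 300 / k" using k by (simp add: field_simps)
  then have X_large: "2457600 \<le> X" using X by linarith
  have p1: "1 \<le> real p" "1 \<le> (real p)\<^sup>2" using p by auto
  have half: "exp (- 1) \<le> (1 / 2 :: real)"
    using exp_ge_add_one_self[of "1 :: real"] by (simp add: exp_minus field_simps)
  have quarter: "2 * exp (- 2) \<le> (1 / 2 :: real)"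
    using mult_mono[OF half half] by (simp add: exp_add[symmetric])
  have "k * X * 1 \<le> k * X * real p" using kX p1 by (intro mult_left_mono) auto
  moreover have "300 * real p \<le> k * X * real p" using kX p1 by (intro mult_right_mono) auto
  ultimately have "112 * real p - k * X * real p \<le> - 2 - k / 2 * X" using p1 by linarith
  then have "2 * exp (112 * real p - k * X * real p) \<le> 2 * exp (- 2 - k / 2 * X)" by simp
  also have "\<dots> = 2 * exp (- 2) * exp (- (k / 2 * X))" by (simp add: exp_add[symmetric])
  also have "\<dots> \<le> 1 / 2 * exp (- (k / 2 * X))" using quarter by (intro mult_right_mono) auto
  finally have coarse: "2 * exp (112 * real p - k * X * real p) \<le> 1 / 2 * exp (- (k / 2 * X))" .
  have "2457600 * (real p)\<^sup>2 \<le> X * (real p)\<^sup>2" using X_large by (intro mult_right_mono) auto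
  moreover have "X * 1 \<le> X * (real p)\<^sup>2" using X_large p1 by (intro mult_left_mono) auto
  moreover have "k / 2 * X \<le> 1 / 4 * X" using k X_large by (intro mult_right_mono) auto
  ultimately have "458752 * (real p)\<^sup>2 - X * (real p)\<^sup>2 / 2 \<le> - 1 - k / 2 * X" using p1 by linarith
  then have "exp (458752 * (real p)\<^sup>2 - X * (real p)\<^sup>2 / 2) \<le> exp (- 1 - k / 2 * X)" by simp
  also have "\<dots> = exp (- 1) * exp (- (k / 2 * X))" by (simp add: exp_add[symmetric])
  also have "\<dots> \<le> 1 / 2 * exp (- (k / 2 * X))" using half by (intro mult_right_mono) auto
  finally have fine: "exp (458752 * (real p)\<^sup>2 - X * (real p)\<^sup>2 / 2) \<le> 1 / 2 * exp (- (k / 2 * X))" .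
  show ?thesis using add_mono[OF coarse fine] by (simp add: mult.assoc exp_add[symmetric])
qed

context elliptical_sample
begin

lemma prob_good_event:
  assumes \<epsilon>: "0 < \<epsilon>" "\<epsilon> \<le> spread_const / 20" and X: "300 / rate_const \<le> real n * \<epsilon>\<^sup>2 / (real p)\<^sup>2"
  shows "1 - exp (- (rate_const / 2 * (real n * \<epsilon>\<^sup>2 / (real p)\<^sup>2))) \<le> prob (good_event \<epsilon>)"
proof -
  define X where "X = real n * \<epsilon>\<^sup>2 / (real p)\<^sup>2"
  define d where "d = \<epsilon> / (4 * sqrt (real p))"
  define \<tau> where "\<tau> = spread_const * d / 4"
  have spread_const: "0 < spread_const" "spread_const \<le> 1" by (simp_all add: spread_const_def)
  have sqrt_p: "1 \<le> sqrt (real p)" using dim_pos by simp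
  have "d \<le> \<epsilon> / 4" unfolding d_def using sqrt_p \<epsilon>(1) by (intro divide_left_mono) auto
  then have d: "0 < d" "d \<le> spread_const / 80" using \<epsilon> sqrt_p by (auto simp: d_def)
  have \<tau>: "0 < \<tau>" "\<tau> \<le> 1" "2 * \<tau> \<le> spread_const * d / 2"
    using d spread_const mult_mono[of spread_const 1 d 1] by (auto simp: \<tau>_def)
  obtain \<N> where coarse: "sphere_net p (1 / 4) \<N>" and card_coarse: "real (card \<N>) \<le> exp (7 * real p / (1 / 4)\<^sup>2)"
    using sphere_net_exists[OF dim_pos, of "1 / 4"] by auto
  obtain \<F> where fine: "sphere_net p (1 / (256 * sqrt (real p))) \<F>"
    and card_fine: "real (card \<F>) \<le> exp (7 * real p / (1 / (256 * sqrt (real p)))\<^sup>2)"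
    using sphere_net_exists[OF dim_pos, of "1 / (256 * sqrt (real p))"] sqrt_p by auto
  have rate: "real n * \<tau>\<^sup>2 / 16 = rate_const * X * real p"
    using dim_pos
    by (simp add: rate_const_def X_def \<tau>_def d_def power_divide power_mult_distrib power2_eq_square[of "real p"])
  have "\<epsilon>\<^sup>2 \<le> 1" using \<epsilon> spread_const by (simp add: power_le_one)
  then have size: "X * (real p)\<^sup>2 \<le> real n" using dim_pos mult_left_mono[of "\<epsilon>\<^sup>2" 1 "real n"] by (simp add: X_def)
  have "2 * real (card \<N>) * exp (- real n * \<tau>\<^sup>2 / 16) + real (card \<F>) * exp (- real n / 2) \<le>
      2 * exp (112 * real p) * exp (- (rate_const * X * real p)) +
      exp (458752 * (real p)\<^sup>2) * exp (- (X * (real p)\<^sup>2 / 2))"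
    using card_coarse card_fine rate size
    by (intro add_mono mult_mono) (simp_all add: power_divide power_mult_distrib power2_eq_square)
  also have "\<dots> \<le> exp (- (rate_const / 2 * X))"
    by (rule failure_probability_bound[OF dim_pos rate_const_bounds X[folded X_def]])
  finally show ?thesis
    using good_event_union_bound[OF \<tau>(1,2) d \<tau>(3) coarse fine] sqrt_p by (simp add: X_def d_def)
qed

end

theorem theorem1p2:
  shows "\<exists>C c \<epsilon>0 :: real. C > 0 \<and> c > 0 \<and> \<epsilon>0 > 0 \<and>
    (\<forall>(\<epsilon> :: real) (p :: nat) (n :: nat) (\<Sigma> :: rmat) (D :: rvec measure).
       0 < \<epsilon> \<longrightarrow> \<epsilon> \<le> \<epsilon>0 \<longrightarrow> p \<ge> 1 \<longrightarrow> elliptical p \<Sigma> D \<longrightarrow>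
       real n \<ge> C * (real p)\<^sup>2 / \<epsilon>\<^sup>2 \<longrightarrow>
       \<P>(x in \<Pi>\<^sub>M i\<in>{..<n}. D.
           tyler_exists p n x \<and>
           frobenius_norm (1\<^sub>m p - mat_sqrt \<Sigma> * mat_inv (tyler p n x) * mat_sqrt \<Sigma>) \<le> \<epsilon>)
         \<ge> 1 - exp (- c * real n * \<epsilon>\<^sup>2 / (real p)\<^sup>2))"
proof (rule exI[of _ "300 / rate_const"], rule exI[of _ "rate_const / 2"], rule exI[of _ "spread_const / 20"],
    intro conjI allI impI)
  fix \<epsilon> :: real and p n :: nat and \<Sigma> :: rmat and D :: "rvec measure"
  assume \<epsilon>: "0 < \<epsilon>" "\<epsilon> \<le> spread_const / 20" and p: "1 \<le> p" and D: "elliptical p \<Sigma> D"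
    and n: "300 / rate_const * (real p)\<^sup>2 / \<epsilon>\<^sup>2 \<le> real n"
  have "0 < 300 / rate_const * (real p)\<^sup>2 / \<epsilon>\<^sup>2" using rate_const_bounds \<epsilon> p by simp
  then interpret elliptical_sample p n \<Sigma> D using n p D by unfold_locales linarith+
  have "0 < \<epsilon>\<^sup>2" "0 < (real p)\<^sup>2" using \<epsilon> p by simp_all
  then have "300 / rate_const \<le> real n * \<epsilon>\<^sup>2 / (real p)\<^sup>2"
    using n by (simp only: pos_divide_le_eq pos_le_divide_eq)
  from prob_good_event[OF \<epsilon> this]
  show "1 - exp (- (rate_const / 2) * real n * \<epsilon>\<^sup>2 / (real p)\<^sup>2) \<le>
      \<P>(x in \<Pi>\<^sub>M i\<in>{..<n}. D. tyler_exists p n x \<and>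
        frobenius_norm (1\<^sub>m p - mat_sqrt \<Sigma> * mat_inv (tyler p n x) * mat_sqrt \<Sigma>) \<le> \<epsilon>)"
    by (simp add: good_event_def mult.assoc)
qed (use rate_const_bounds in \<open>auto simp: spread_const_def\<close>)

end
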